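(* Let $M\subset\mathbb{C}^2$ be a strictly pseudoconvex Reinhardt real hypersurface with closed generating curve $\gamma$. Let $\ell$ be the length of $\gamma$ and let $\kappa(s)>0$, $0\le s<\ell$, be the curvature of $\gamma$ in an arc-length parametrization $s$. Let $\lambda_1(\Box_b)$ be the first positive eigenvalue of the Kohn Laplacian $\Box_b$ on $M$ associated to the normalized pseudohermitian structure $\theta=\eta'\,dx-\xi'\,dy$. Then \[ \lambda_1(\Box_b)\le \frac{1}{4\pi}\int_0^{\ell}\kappa(s)^2\,ds . \] Equality occurs if and only if $\gamma$ is a circle, namely, if and only if \[ M=\left\{(z,w)\in\mathbb{C}^2 : zw\neq 0,\ (\log (a|z|))^2+(\log (b|w|))^2=\frac{\ell^2}{4\pi^2}\right\} \] for some $a,b>0$.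
   Context: Write $\mathbb{T}=\mathbb{R}/2\pi\mathbb{Z}$ and let $(z,w)$ be the coordinates on $\mathbb{C}^2$. All hypersurfaces are smooth. Reinhardt hypersurfaces. A real hypersurface $M\subset\mathbb{C}^2$ is Reinhardt if it is invariant under the standard action of $\mathbb{T}^2$, $(z,w)\mapsto(e^{i\alpha}z,e^{i\beta}w)$. Put $M^\ast=\{(z,w)\in M: zw\ne0\}$. The generating curve $\gamma\subset\mathbb{R}^2$ of $M$ is the image of $M^\ast$ under $(z,w)\mapsto(\xi,\eta)=(\log|z|,\log|w|)$. One says that $M$ has a closed generating curve if $M$ is compact, connected, and $M=M^\ast$; in this case $\gamma$ is a simple closed curve. Parametrization and curvature. If $\gamma(s)=(\xi(s),\eta(s))$ is an arc-length parametrization ($s\in\mathbb{R}/\ell\mathbb{Z}$, $\ell$ the length of $\gamma$), then $M$ is parametrized by $(s,x,y)\mapsto(e^{\xi(s)+ix},e^{\eta(s)+iy})$, $(s,x,y)\in\mathbb{R}/\ell\mathbb{Z}\times\mathbb{T}^2$. The curvature $\kappa$ is defined by $\xi''=-\kappa\eta'$, $\eta''=\kappa\xi'$. Since $M$ is strictly pseudoconvex, $\gamma$ can be, and is, oriented so that $\kappa(s)>0$ for all $s$. Pseudohermitian structure and Kohn Laplacian. The normalized pseudohermitian structure on $M$ is the real one-form $\theta=\eta'\,dx-\xi'\,dy$; its volume form $\theta\wedge d\theta$ gives (up to orientation) the measure $dV=\kappa(s)\,ds\,dx\,dy$. Let $Z_1$ be a smooth section of the holomorphic tangent bundle $T^{1,0}M$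 normalized by $-i\,d\theta(Z_1,\overline{Z_1})=1$ (with $d\theta(X,Y)=X\theta(Y)-Y\theta(X)-\theta([X,Y])$); for instance $Z_1=\frac{1}{\sqrt{2\kappa}}\left(\partial_s-i\xi'\partial_x-i\eta'\partial_y\right)$. Put $Z_{\bar1}=\overline{Z_1}$. The Kohn Laplacian on functions is $\Box_b=\bar\partial_b^*\bar\partial_b$, i.e. the second-order differential operator determined by \[ \int_M(\Box_bu)\,\overline{f}\,dV=\int_M (Z_{\bar1}u)\,\overline{(Z_{\bar1}f)}\,dV\qquad\text{for all }u,f\in C^\infty(M). \] It is essentially self-adjoint and nonnegative on $C^\infty(M)\subset L^2(M,dV)$, its spectrum in $(0,+\infty)$ consists of discrete eigenvalues of finite multiplicity, and zero is isolated in the spectrum; $\lambda_1(\Box_b)$ is its smallest positive eigenvalue. *)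

theory Defs
  imports "HOL-Analysis.Analysis"
begin

text \<open>Smoothness on an open set \<open>S\<close>, through iterated directional derivatives.\<close>

fun Ck_on :: "nat \<Rightarrow> 'a::real_normed_vector set \<Rightarrow> ('a \<Rightarrow> 'b::real_normed_vector) \<Rightarrow> bool" where
  "Ck_on 0 S f \<longleftrightarrow> continuous_on S f"
| "Ck_on (Suc k) S f \<longleftrightarrow> (\<forall>x\<in>S. f differentiable (at x)) \<and>
     (\<forall>v. Ck_on k S (\<lambda>x. frechet_derivative f (at x) v))"

definition smooth_on :: "'a::real_normed_vector set \<Rightarrow> ('a \<Rightarrow> 'b::real_normed_vector) \<Rightarrow> bool" where
  "smooth_on S f \<longleftrightarrow> (\<forall>k. Ck_on k S f)"


subsection \<open>Reinhardt hypersurfaces of \<open>\<complex>\<^sup>2\<close>\<close>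

definition local_defining_function ::
    "(complex \<times> complex) set \<Rightarrow> (complex \<times> complex) set \<Rightarrow> (complex \<times> complex \<Rightarrow> real) \<Rightarrow> bool" where
  "local_defining_function M U \<rho> \<longleftrightarrow> open U \<and> smooth_on U \<rho> \<and> M \<inter> U = {q \<in> U. \<rho> q = 0} \<and>
     (\<forall>q \<in> M \<inter> U. \<exists>v. frechet_derivative \<rho> (at q) v \<noteq> 0)"

definition real_hypersurface :: "(complex \<times> complex) set \<Rightarrow> bool" where
  "real_hypersurface M \<longleftrightarrow> (\<forall>p\<in>M. \<exists>U \<rho>. p \<in> U \<and> local_defining_function M U \<rho>)"

text \<open>The Wirtinger derivatives: for \<open>e = (1, 0)\<close> they are \<open>\<partial>f/\<partial>z\<close> and \<open>\<partial>f/\<partial>z\<close>-bar,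
  for \<open>e = (0, 1)\<close> they are \<open>\<partial>f/\<partial>w\<close> and \<open>\<partial>f/\<partial>w\<close>-bar.\<close>

definition wirt ::
    "complex \<times> complex \<Rightarrow> (complex \<times> complex \<Rightarrow> complex) \<Rightarrow> complex \<times> complex \<Rightarrow> complex" where
  "wirt e f p = (frechet_derivative f (at p) e
     - \<i> * frechet_derivative f (at p) (\<i> * fst e, \<i> * snd e)) / 2"

definition wirt_bar ::
    "complex \<times> complex \<Rightarrow> (complex \<times> complex \<Rightarrow> complex) \<Rightarrow> complex \<times> complex \<Rightarrow> complex" where
  "wirt_bar e f p = (frechet_derivative f (at p) e
     + \<i> * frechet_derivative f (at p) (\<i> * fst e, \<i> * snd e)) / 2"

definition holomorphic_tangent ::
    "(complex \<times> complex \<Rightarrow> real) \<Rightarrow> complex \<times> complex \<Rightarrow> complex \<times> complex \<Rightarrow> bool" where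
  "holomorphic_tangent \<rho> p t \<longleftrightarrow>
     wirt (1, 0) (\<lambda>q. complex_of_real (\<rho> q)) p * fst t
     + wirt (0, 1) (\<lambda>q. complex_of_real (\<rho> q)) p * snd t = 0"

text \<open>The Levi form is real-valued because the complex Hessian is Hermitian;
  \<^const>\<open>Re\<close> only changes the type.\<close>

definition levi_form ::
    "(complex \<times> complex \<Rightarrow> real) \<Rightarrow> complex \<times> complex \<Rightarrow> complex \<times> complex \<Rightarrow> real" where
  "levi_form \<rho> p t =
     (let h = (\<lambda>e e'. wirt e (wirt_bar e' (\<lambda>q. complex_of_real (\<rho> q))) p) in
      Re (h (1, 0) (1, 0) * fst t * cnj (fst t) + h (1, 0) (0, 1) * fst t * cnj (snd t)
        + h (0, 1) (1, 0) * snd t * cnj (fst t) + h (0, 1) (0, 1) * snd t * cnj (snd t)))"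

text \<open>A hypersurface has no preferred side, so the sign of the local defining function,
  hence that of its Levi form, is free.\<close>

definition strictly_pseudoconvex :: "(complex \<times> complex) set \<Rightarrow> bool" where
  "strictly_pseudoconvex M \<longleftrightarrow> (\<forall>p\<in>M. \<exists>U \<rho>. p \<in> U \<and> local_defining_function M U \<rho> \<and>
     (\<forall>t. t \<noteq> 0 \<and> holomorphic_tangent \<rho> p t \<longrightarrow> levi_form \<rho> p t > 0))"

definition reinhardt :: "(complex \<times> complex) set \<Rightarrow> bool" where
  "reinhardt M \<longleftrightarrow> (\<forall>z w. \<forall>\<alpha> \<beta>::real. (z, w) \<in> M \<longrightarrow> (cis \<alpha> * z, cis \<beta> * w) \<in> M)"

definition star_part :: "(complex \<times> complex) set \<Rightarrow> (complex \<times> complex) set" where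
  "star_part M = {(z, w) \<in> M. z * w \<noteq> 0}"

definition generating_curve :: "(complex \<times> complex) set \<Rightarrow> (real \<times> real) set" where
  "generating_curve M = (\<lambda>(z, w). (ln (cmod z), ln (cmod w))) ` star_part M"

definition has_closed_generating_curve :: "(complex \<times> complex) set \<Rightarrow> bool" where
  "has_closed_generating_curve M \<longleftrightarrow> M \<noteq> {} \<and> compact M \<and> connected M \<and> M = star_part M"


subsection \<open>Arc-length parametrization and curvature\<close>

text \<open>The length of the curve is \<open>L\<close>; functions on \<open>\<real>/L\<int>\<close> are \<open>L\<close>-periodic functions on \<open>\<real>\<close>.\<close>

definition arc_length_parametrization ::
    "(real \<times> real) set \<Rightarrow> real \<Rightarrow> (real \<Rightarrow> real) \<Rightarrow> (real \<Rightarrow> real) \<Rightarrow> bool" where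
  "arc_length_parametrization \<gamma> L \<xi> \<eta> \<longleftrightarrow> L > 0 \<and> smooth_on UNIV \<xi> \<and> smooth_on UNIV \<eta> \<and>
     (\<forall>s. \<xi> (s + L) = \<xi> s \<and> \<eta> (s + L) = \<eta> s) \<and>
     (\<forall>s. (deriv \<xi> s)\<^sup>2 + (deriv \<eta> s)\<^sup>2 = 1) \<and>
     inj_on (\<lambda>s. (\<xi> s, \<eta> s)) {0..<L} \<and> (\<lambda>s. (\<xi> s, \<eta> s)) ` {0..<L} = \<gamma>"

definition is_curvature :: "(real \<Rightarrow> real) \<Rightarrow> (real \<Rightarrow> real) \<Rightarrow> (real \<Rightarrow> real) \<Rightarrow> bool" where
  "is_curvature \<xi> \<eta> \<kappa> \<longleftrightarrow>
     (\<forall>s. deriv (deriv \<xi>) s = - \<kappa> s * deriv \<eta> s \<and> deriv (deriv \<eta>) s = \<kappa> s * deriv \<xi> s)"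


subsection \<open>The pseudohermitian structure\<close>

text \<open>Points, functions and tangent vectors on \<open>M\<close> are written in the coordinates \<open>(s, x, y)\<close>
  given by the parametrization \<open>chart \<xi> \<eta>\<close> of \<open>M\<close> by \<open>\<real>/L\<int> \<times> \<real>/2\<pi>\<int> \<times> \<real>/2\<pi>\<int>\<close>;
  functions on \<open>M\<close> become periodic functions of \<open>(s, x, y)\<close>.\<close>

type_synonym coords = "real \<times> real \<times> real"

definition chart :: "(real \<Rightarrow> real) \<Rightarrow> (real \<Rightarrow> real) \<Rightarrow> coords \<Rightarrow> complex \<times> complex" where
  "chart \<xi> \<eta> = (\<lambda>(s, x, y). (exp (complex_of_real (\<xi> s) + \<i> * complex_of_real x),
                              exp (complex_of_real (\<eta> s) + \<i> * complex_of_real y)))"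

definition periodic :: "real \<Rightarrow> (coords \<Rightarrow> 'a) \<Rightarrow> bool" where
  "periodic L u \<longleftrightarrow> (\<forall>s x y. u (s + L, x, y) = u (s, x, y) \<and>
     u (s, x + 2 * pi, y) = u (s, x, y) \<and> u (s, x, y + 2 * pi) = u (s, x, y))"

definition smooth_functions :: "real \<Rightarrow> (coords \<Rightarrow> complex) set" where
  "smooth_functions L = {u. smooth_on UNIV u \<and> periodic L u}"

definition contact_form :: "(real \<Rightarrow> real) \<Rightarrow> (real \<Rightarrow> real) \<Rightarrow> coords \<Rightarrow> coords \<Rightarrow> real" where
  "contact_form \<xi> \<eta> p v =
     deriv \<eta> (fst p) * fst (snd v) - deriv \<xi> (fst p) * snd (snd v)"

text \<open>The formula \<open>d\<omega>(X, Y) = X \<omega>(Y) - Y \<omega>(X) - \<omega>([X, Y])\<close> for the constant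
  (hence commuting) vector fields \<open>X\<close>, \<open>Y\<close>.\<close>

definition ext_deriv :: "(coords \<Rightarrow> coords \<Rightarrow> real) \<Rightarrow> coords \<Rightarrow> coords \<Rightarrow> coords \<Rightarrow> real" where
  "ext_deriv \<omega> p X Y =
     frechet_derivative (\<lambda>q. \<omega> q Y) (at p) X - frechet_derivative (\<lambda>q. \<omega> q X) (at p) Y"

text \<open>A pair \<open>(V, W)\<close> stands for the complexified tangent vector \<open>V + \<i> W\<close>.\<close>

type_synonym cvec = "coords \<times> coords"

definition cvec_cnj :: "cvec \<Rightarrow> cvec" where
  "cvec_cnj Z = (fst Z, - snd Z)"

definition cvec_apply :: "cvec \<Rightarrow> (coords \<Rightarrow> complex) \<Rightarrow> coords \<Rightarrow> complex" where
  "cvec_apply Z u p =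
     frechet_derivative u (at p) (fst Z) + \<i> * frechet_derivative u (at p) (snd Z)"

definition complexify2 :: "(coords \<Rightarrow> coords \<Rightarrow> real) \<Rightarrow> cvec \<Rightarrow> cvec \<Rightarrow> complex" where
  "complexify2 B Z Z' =
     complex_of_real (B (fst Z) (fst Z') - B (snd Z) (snd Z'))
     + \<i> * complex_of_real (B (fst Z) (snd Z') + B (snd Z) (fst Z'))"

text \<open>A complexified tangent vector of \<open>M\<close> is of type \<open>(1, 0)\<close> iff it annihilates the
  antiholomorphic coordinate functions of \<open>\<complex>\<^sup>2\<close>.\<close>

definition is_type_10 :: "(real \<Rightarrow> real) \<Rightarrow> (real \<Rightarrow> real) \<Rightarrow> coords \<Rightarrow> cvec \<Rightarrow> bool" where
  "is_type_10 \<xi> \<eta> p Z \<longleftrightarrow> cvec_apply Z (\<lambda>q. cnj (fst (chart \<xi> \<eta> q))) p = 0 \<and>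
     cvec_apply Z (\<lambda>q. cnj (snd (chart \<xi> \<eta> q))) p = 0"

definition normalized_frame ::
    "(real \<Rightarrow> real) \<Rightarrow> (real \<Rightarrow> real) \<Rightarrow> real \<Rightarrow> (coords \<Rightarrow> cvec) \<Rightarrow> bool" where
  "normalized_frame \<xi> \<eta> L Z \<longleftrightarrow> smooth_on UNIV Z \<and> periodic L Z \<and>
     (\<forall>p. is_type_10 \<xi> \<eta> p (Z p) \<and>
       - \<i> * complexify2 (ext_deriv (contact_form \<xi> \<eta>) p) (Z p) (cvec_cnj (Z p)) = 1)"

definition vol :: "real \<Rightarrow> (real \<Rightarrow> real) \<Rightarrow> coords measure" where
  "vol L \<kappa> = density lborel
     (\<lambda>p. ennreal (indicator ({0..<L} \<times> {0..<2 * pi} \<times> {0..<2 * pi}) p * \<kappa> (fst p)))"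


subsection \<open>The Kohn Laplacian\<close>

text \<open>The graph of \<open>\<box>\<^sub>b\<close> on \<open>C\<^sup>\<infinity>(M)\<close>.\<close>

definition kohn_laplacian ::
    "real \<Rightarrow> (real \<Rightarrow> real) \<Rightarrow> (coords \<Rightarrow> cvec) \<Rightarrow> (coords \<Rightarrow> complex) \<Rightarrow> (coords \<Rightarrow> complex) \<Rightarrow> bool" where
  "kohn_laplacian L \<kappa> Z u g \<longleftrightarrow> u \<in> smooth_functions L \<and> g \<in> smooth_functions L \<and>
     (\<forall>f \<in> smooth_functions L.
        (LINT p|vol L \<kappa>. g p * cnj (f p)) =
        (LINT p|vol L \<kappa>. cvec_apply (cvec_cnj (Z p)) u p
                           * cnj (cvec_apply (cvec_cnj (Z p)) f p)))"

definition L2 :: "'a measure \<Rightarrow> ('a \<Rightarrow> complex) set" where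
  "L2 N = {u \<in> borel_measurable N. integrable N (\<lambda>p. (cmod (u p))\<^sup>2)}"

definition L2_tendsto :: "'a measure \<Rightarrow> (nat \<Rightarrow> 'a \<Rightarrow> complex) \<Rightarrow> ('a \<Rightarrow> complex) \<Rightarrow> bool" where
  "L2_tendsto N u v \<longleftrightarrow> (\<lambda>n. LINT p|N. (cmod (u n p - v p))\<^sup>2) \<longlonglongrightarrow> 0"

text \<open>The graph of the closure of \<open>\<box>\<^sub>b\<close> in \<open>L\<^sup>2(M, dV)\<close>, the self-adjoint operator whose
  eigenvalues are meant.\<close>

definition kohn_laplacian_closure ::
    "real \<Rightarrow> (real \<Rightarrow> real) \<Rightarrow> (coords \<Rightarrow> cvec) \<Rightarrow> (coords \<Rightarrow> complex) \<Rightarrow> (coords \<Rightarrow> complex) \<Rightarrow> bool" where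
  "kohn_laplacian_closure L \<kappa> Z u g \<longleftrightarrow> u \<in> L2 (vol L \<kappa>) \<and> g \<in> L2 (vol L \<kappa>) \<and>
     (\<exists>U G. (\<forall>n. kohn_laplacian L \<kappa> Z (U n) (G n)) \<and>
        L2_tendsto (vol L \<kappa>) U u \<and> L2_tendsto (vol L \<kappa>) G g)"

definition kohn_eigenvalue ::
    "real \<Rightarrow> (real \<Rightarrow> real) \<Rightarrow> (coords \<Rightarrow> cvec) \<Rightarrow> real \<Rightarrow> bool" where
  "kohn_eigenvalue L \<kappa> Z \<mu> \<longleftrightarrow>
     (\<exists>u. \<not> (AE p in vol L \<kappa>. u p = 0) \<and>
        kohn_laplacian_closure L \<kappa> Z u (\<lambda>p. complex_of_real \<mu> * u p))"

text \<open>The positive eigenvalues are discrete and bounded away from \<open>0\<close> (\<open>0\<close> is isolated in the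
  spectrum), so this infimum is a minimum.\<close>

definition lambda1 :: "real \<Rightarrow> (real \<Rightarrow> real) \<Rightarrow> (coords \<Rightarrow> cvec) \<Rightarrow> real" where
  "lambda1 L \<kappa> Z = Inf {\<mu>. \<mu> > 0 \<and> kohn_eigenvalue L \<kappa> Z \<mu>}"

end

theory Submission
  imports Defs "HOL-Complex_Analysis.Great_Picard"
begin

text \<open>
  On a Fourier mode \<open>u = f(s) exp (\<i> (m x + n y))\<close> the Kohn Laplacian is the periodic Sturm-Liouville
  operator \<open>f \<mapsto> (1 / 2\<kappa>) D* D f\<close> with \<open>D = d/ds - g\<close> and \<open>g = m \<xi>' + n \<eta>'\<close>
  (\<open>kohn_mode_equation\<close>); this follows by testing the weak definition against single modes.

  Upper bound. In the mode \<open>(0, 0)\<close> the eigenvalue equation is \<open>- f'' = 2 \<lambda> \<kappa> f\<close>. The minimum \<open>\<Lambda>\<close> of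
  \<open>\<integral> f'\<^sup>2 / \<integral> \<kappa> f\<^sup>2\<close> over periodic \<open>f\<close> with \<open>\<integral> \<kappa> f = 0\<close> is attained, by the direct method of the calculus
  of variations (\<open>periodic_sturm_liouville_minimiser\<close>), and \<open>\<Lambda> / 2\<close> is an eigenvalue. Since
  \<open>\<kappa> \<xi>' = \<eta>''\<close> and \<open>\<kappa> \<eta>' = - \<xi>''\<close>, both components of the unit tangent are admissible. Adding
  the two Rayleigh inequalities gives \<open>\<Lambda> \<integral> \<kappa> \<le> \<integral> \<kappa>\<^sup>2\<close>, and \<open>\<integral> \<kappa>\<close> is a positive multiple of \<open>2\<pi>\<close> because the
  tangent vector returns to itself (\<open>total_curvature_ge\<close>). If the bound is attained, then \<open>\<xi>'\<close> and
  \<open>\<eta>'\<close> are minimisers, hence solve the eigenvalue equation; eliminating between the two equations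
  leaves \<open>\<kappa>' = 0\<close>, and the curve is a circle.

  Circles. Conversely, over a circle of curvature \<open>c\<close> no mode may have a positive eigenvalue below
  \<open>c / 2\<close>. After a rotation of the circle, which depends on the mode, and a rescaling, \<open>g = a sin t\<close>.
  The reflection \<open>t \<mapsto> - t\<close> anticommutes with \<open>D\<close>, so \<open>D\<close> exchanges even and odd functions, and both
  parities reduce to an estimate for odd functions. These vanish at \<open>0\<close> and \<open>\<pi>\<close>, and on such
  functions \<open>D* D\<close> and \<open>D D*\<close> are bounded below by \<open>1\<close> (\<open>dirichlet_gap\<close>, \<open>circle_mode_gap\<close>).

  Eigenfunctions of the closure are only square integrable, whereas the gap concerns smooth functions.
  It is therefore used as a bound \<open>\<parallel>f\<parallel>\<^sup>2 \<le> C \<parallel>(D* D / 2\<kappa> - \<mu>) f\<parallel>\<^sup>2\<close> for \<open>0 < \<mu> < c / 2\<close>, uniform over the modes: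
  if smooth \<open>U\<^sub>n\<close> approximate an eigenfunction with eigenvalue \<open>\<mu>\<close>, every Fourier mode of \<open>U\<^sub>n\<close> tends to
  \<open>0\<close>, and the density of trigonometric polynomials (\<open>trig_poly_dense\<close>) forces the limit to vanish
  (\<open>circle_eigenvalue_lower_bound\<close>).
\<close>


section \<open>Smooth functions\<close>

lemma Ck_on_Suc_imp:
  assumes "Ck_on (Suc k) S f" shows "Ck_on k S f"
  using assms
proof (induction k arbitrary: f)
  case 0
  then have "\<forall>x\<in>S. f differentiable (at x)" by simp
  then show ?case
    by (simp add: continuous_at_imp_continuous_on differentiable_imp_continuous_within)
next
  case (Suc k)
  then have "Ck_on (Suc k) S (\<lambda>x. frechet_derivative f (at x) v)" for v by simp
  then have "Ck_on k S (\<lambda>x. frechet_derivative f (at x) v)" for v by (rule Suc.IH)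
  then show ?case using Suc.prems by simp
qed

text \<open>Smoothness by coinduction: a class of functions closed under directional derivatives consists
  of smooth functions. It spares every higher-order derivative formula below.\<close>

lemma smooth_on_coinduct:
  assumes "P f"
    and "\<And>f. P f \<Longrightarrow> (\<forall>x\<in>S. f differentiable (at x)) \<and> (\<forall>v. P (\<lambda>x. frechet_derivative f (at x) v))"
  shows "smooth_on S f"
proof -
  have "P f \<Longrightarrow> Ck_on k S f" for k f
  proof (induction k arbitrary: f)
    case 0
    then show ?case using assms(2)
      by (simp add: continuous_at_imp_continuous_on differentiable_imp_continuous_within)
  next
    case (Suc k)
    then show ?case using assms(2) by simp
  qed
  then show ?thesis using assms(1) by (simp add: smooth_on_def)
qed

lemma smooth_on_differentiable: "smooth_on UNIV f \<Longrightarrow> f differentiable (at x)"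
  unfolding smooth_on_def by (drule spec[of _ "Suc 0"]) simp

lemma smooth_on_has_derivative:
  "smooth_on UNIV f \<Longrightarrow> (f has_derivative frechet_derivative f (at x)) (at x)"
  using smooth_on_differentiable frechet_derivative_works by blast

lemma smooth_on_frechet: "smooth_on UNIV f \<Longrightarrow> smooth_on UNIV (\<lambda>x. frechet_derivative f (at x) v)"
  unfolding smooth_on_def
proof
  fix k assume "\<forall>k. Ck_on k UNIV f"
  then have "Ck_on (Suc k) UNIV f" by blast
  then show "Ck_on k UNIV (\<lambda>x. frechet_derivative f (at x) v)" by simp
qed

lemma smooth_on_continuous: "smooth_on UNIV f \<Longrightarrow> continuous_on A f"
  unfolding smooth_on_def by (drule spec[of _ 0]) (simp add: continuous_on_subset[of UNIV])

lemma smooth_on_const: "smooth_on UNIV (\<lambda>x. c)"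
  by (rule smooth_on_coinduct[where P="\<lambda>f. \<exists>c. f = (\<lambda>x. c)"])
     (auto simp: frechet_derivative_const)

lemma Ck_on_add:
  "Ck_on k UNIV f \<Longrightarrow> Ck_on k UNIV g \<Longrightarrow> Ck_on k UNIV (\<lambda>x. f x + g x)"
proof (induction k arbitrary: f g)
  case 0
  then show ?case by (simp add: continuous_on_add)
next
  case (Suc k)
  have d: "f differentiable (at x)" "g differentiable (at x)" for x using Suc.prems by auto
  have "frechet_derivative (\<lambda>x. f x + g x) (at x)
      = (\<lambda>v. frechet_derivative f (at x) v + frechet_derivative g (at x) v)" for x
    by (rule frechet_derivative_at[symmetric])
       (intro has_derivative_add d[unfolded frechet_derivative_works])
  then show ?case using Suc d by (simp)
qed

lemma Ck_on_linear:
  assumes "bounded_linear h"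
  shows "Ck_on k UNIV f \<Longrightarrow> Ck_on k UNIV (\<lambda>x. h (f x))"
proof (induction k arbitrary: f)
  case 0
  then show ?case using assms
    by (simp add: linear_continuous_on_compose linear_continuous_on continuous_on_compose2 bounded_linear.continuous_on)
next
  case (Suc k)
  have hd: "((\<lambda>x. h (f x)) has_derivative (\<lambda>v. h (frechet_derivative f (at x) v))) (at x)" for x
    using Suc.prems bounded_linear.has_derivative[OF assms, of f "frechet_derivative f (at x)" "at x"]
    by (auto simp: frechet_derivative_works)
  have "frechet_derivative (\<lambda>x. h (f x)) (at x) = (\<lambda>v. h (frechet_derivative f (at x) v))" for x
    using frechet_derivative_at[OF hd] by simp
  then show ?case using Suc hd by (auto simp: differentiable_def)
qed

lemma Ck_on_mult:
  fixes f g :: "_ \<Rightarrow> 'b::real_normed_algebra"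
  shows "Ck_on k UNIV f \<Longrightarrow> Ck_on k UNIV g \<Longrightarrow> Ck_on k UNIV (\<lambda>x. f x * g x)"
proof (induction k arbitrary: f g)
  case 0
  then show ?case by (simp add: continuous_on_mult)
next
  case (Suc k)
  have hd: "((\<lambda>x. f x * g x) has_derivative (\<lambda>v. f x * frechet_derivative g (at x) v
      + frechet_derivative f (at x) v * g x)) (at x)" for x
    using Suc.prems by (intro has_derivative_mult) (auto simp: frechet_derivative_works)
  have eq: "frechet_derivative (\<lambda>x. f x * g x) (at x) = (\<lambda>v. f x * frechet_derivative g (at x) v
      + frechet_derivative f (at x) v * g x)" for x
    using frechet_derivative_at[OF hd] by simp
  have c: "Ck_on k UNIV f" "Ck_on k UNIV g" using Suc.prems Ck_on_Suc_imp by blast+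
  have "Ck_on k UNIV (\<lambda>x. f x * frechet_derivative g (at x) v + frechet_derivative f (at x) v * g x)" for v
    using Suc c by (intro Ck_on_add) auto
  then show ?case using hd eq by (auto simp: differentiable_def)
qed

lemma smooth_on_add: "smooth_on UNIV f \<Longrightarrow> smooth_on UNIV g \<Longrightarrow> smooth_on UNIV (\<lambda>x. f x + g x)"
  by (simp add: smooth_on_def Ck_on_add)

lemma smooth_on_linear: "bounded_linear h \<Longrightarrow> smooth_on UNIV f \<Longrightarrow> smooth_on UNIV (\<lambda>x. h (f x))"
  by (simp add: smooth_on_def Ck_on_linear)

lemma smooth_on_mult:
  fixes f g :: "_ \<Rightarrow> 'b::real_normed_algebra"
  shows "smooth_on UNIV f \<Longrightarrow> smooth_on UNIV g \<Longrightarrow> smooth_on UNIV (\<lambda>x. f x * g x)"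
  by (simp add: smooth_on_def Ck_on_mult)

lemma smooth_on_of_real:
  "smooth_on UNIV f \<Longrightarrow> smooth_on UNIV (\<lambda>x. of_real (f x) :: complex)"
  by (rule smooth_on_linear[OF bounded_linear_of_real])

lemma smooth_on_minus: "smooth_on UNIV f \<Longrightarrow> smooth_on UNIV (\<lambda>x. - f x)"
  by (rule smooth_on_linear[OF bounded_linear_minus[OF bounded_linear_ident]])

lemma smooth_on_diff: "smooth_on UNIV f \<Longrightarrow> smooth_on UNIV g \<Longrightarrow> smooth_on UNIV (\<lambda>x. f x - g x)"
  using smooth_on_add[OF _ smooth_on_minus, of f g] by simp

lemma frechet_derivative_vector:
  assumes "(f has_vector_derivative f') (at x)"
  shows "frechet_derivative f (at x) v = v *\<^sub>R f'"
  by (simp add: frechet_derivative_at[OF assms[unfolded has_vector_derivative_def], symmetric])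

lemma smooth_on_has_vector_derivative:
  fixes f :: "real \<Rightarrow> 'b::real_normed_vector"
  assumes "smooth_on UNIV f"
  shows "(f has_vector_derivative frechet_derivative f (at x) 1) (at x)"
proof -
  have "frechet_derivative f (at x) v = v *\<^sub>R frechet_derivative f (at x) 1" for v
    using linear_cmul[OF linear_frechet_derivative[OF smooth_on_differentiable[OF assms, of x]], of v 1] by simp
  then have "frechet_derivative f (at x) = (\<lambda>v. v *\<^sub>R frechet_derivative f (at x) 1)" by (rule ext)
  then show ?thesis using smooth_on_has_derivative[OF assms, of x]
    unfolding has_vector_derivative_def by metis
qed

lemma smooth_on_deriv:
  fixes f :: "real \<Rightarrow> real"
  assumes "smooth_on UNIV f"
  shows "smooth_on UNIV (deriv f)" "(f has_real_derivative deriv f x) (at x)"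
proof -
  have *: "(f has_real_derivative frechet_derivative f (at x) 1) (at x)" for x
    using smooth_on_has_vector_derivative[OF assms]
    by (simp add: has_real_derivative_iff_has_vector_derivative)
  then have "deriv f = (\<lambda>x. frechet_derivative f (at x) 1)" by (auto intro: DERIV_imp_deriv)
  then show "smooth_on UNIV (deriv f)" "(f has_real_derivative deriv f x) (at x)"
    using smooth_on_frechet[OF assms] * by auto
qed

text \<open>Bootstrapping: if \<open>f\<close> and \<open>f'\<close> are of class \<open>C\<^sup>k\<close>, then so is \<open>f'' = q f\<close>, so both are of class
  \<open>C\<^sup>k\<^sup>+\<^sup>1\<close>.\<close>

lemma smooth_on_linear_ode:
  fixes f g q :: "real \<Rightarrow> real"
  assumes f: "\<And>s. (f has_real_derivative g s) (at s)"
    and g: "\<And>s. (g has_real_derivative q s * f s) (at s)"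
    and q: "smooth_on UNIV q"
  shows "smooth_on UNIV f"
proof -
  have "Ck_on k UNIV f \<and> Ck_on k UNIV g" for k
  proof (induction k)
    case 0
    have "continuous_on UNIV f" "continuous_on UNIV g"
      by (rule continuous_at_imp_continuous_on, blast intro: DERIV_isCont f g)+
    then show ?case by simp
  next
    case (Suc k)
    have e: "frechet_derivative f (at x) v = v * g x" "frechet_derivative g (at x) v = v * (q x * f x)" for x v
      using frechet_derivative_vector[OF f[of x, unfolded has_real_derivative_iff_has_vector_derivative], of v]
        frechet_derivative_vector[OF g[of x, unfolded has_real_derivative_iff_has_vector_derivative], of v]
      by simp_all
    have d: "f differentiable at x" "g differentiable at x" for x
      using f[of x] g[of x] unfolding real_differentiable_def by blast+
    have "Ck_on k UNIV (\<lambda>x. q x * f x)"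
      by (intro Ck_on_mult conjunct1[OF Suc]) (use q in \<open>simp add: smooth_on_def\<close>)
    then have "Ck_on k UNIV (\<lambda>x. v * (q x * f x))" "Ck_on k UNIV (\<lambda>x. v * g x)" for v
      using Ck_on_linear[OF bounded_linear_mult_right] Suc by blast+
    then show ?case using d by (simp add: e)
  qed
  then show ?thesis by (simp add: smooth_on_def)
qed


section \<open>Primitives and periodic functions\<close>

lemma integrable_on_if_continuous_UNIV:
  fixes f :: "real \<Rightarrow> 'b::banach"
  shows "continuous_on UNIV f \<Longrightarrow> f integrable_on {a..b}"
  by (meson continuous_on_subset integrable_continuous_real top_greatest)

lemma DERIV_UNIV_imp_continuous_on:
  fixes f :: "real \<Rightarrow> real"
  shows "(\<And>s. (f has_real_derivative f' s) (at s)) \<Longrightarrow> continuous_on A f"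
  by (auto intro!: continuous_at_imp_continuous_on DERIV_isCont)

lemma integral_of_derivative:
  fixes f :: "real \<Rightarrow> 'b::banach"
  assumes "a \<le> b" "\<And>s. (F has_vector_derivative f s) (at s)"
  shows "integral {a..b} f = F b - F a"
  using assms by (intro integral_unique fundamental_theorem_of_calculus)
    (auto intro: has_vector_derivative_at_within)

lemma continuous_antiderivative:
  fixes q :: "real \<Rightarrow> real"
  assumes "continuous_on UNIV q"
  obtains Q where "\<And>s. (Q has_real_derivative q s) (at s)"
proof -
  have "isCont q x" for x using assms by (simp add: continuous_on_eq_continuous_at)
  then obtain Q where "\<forall>x::real. -\<infinity> < ereal x \<longrightarrow> ereal x < \<infinity> \<longrightarrow> (Q has_vector_derivative q x) (at x)"
    using einterval_antiderivative[of "-\<infinity>" "\<infinity>" q] by auto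
  then show thesis
    by (intro that[of Q]) (simp add: has_real_derivative_iff_has_vector_derivative)
qed

lemma DERIV_const_diff_const:
  fixes Q :: "real \<Rightarrow> real"
  assumes "\<And>s. (Q has_real_derivative q s) (at s)" "\<And>s. q (s + L) = q s"
  shows "Q (s + L) - Q s = Q L - Q 0"
proof -
  have "((\<lambda>s. Q (s + L) - Q s) has_real_derivative 0) (at s)" for s
  proof -
    have "((\<lambda>s. Q (s + L)) has_real_derivative q (s + L)) (at s)"
      using assms(1)[of "s + L"] by (simp add: DERIV_shift)
    from DERIV_diff[OF this assms(1)[of s]] show ?thesis using assms(2) by simp
  qed
  from DERIV_const_ratio_const[OF _ this, of s 0] show ?thesis
    by (cases "s = 0") (auto simp: DERIV_const_ratio_const)
qed

lemma integral_periodic_shift: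
  fixes f :: "real \<Rightarrow> real"
  assumes "continuous_on UNIV f" "\<And>s. f (s + L) = f s" "L \<ge> 0"
  shows "integral {a..a + L} f = integral {0..L} f"
proof -
  obtain Q where Q: "\<And>s. (Q has_real_derivative f s) (at s)"
    using continuous_antiderivative[OF assms(1)] by blast
  then have "integral {a..a+L} f = Q (a + L) - Q a" "integral {0..L} f = Q L - Q 0"
    using assms(3) by (auto intro!: integral_of_derivative simp: has_real_derivative_iff_has_vector_derivative[symmetric])
  then show ?thesis using DERIV_const_diff_const[OF Q assms(2)] by simp
qed

section \<open>The spectral gap of the modes of a circle\<close>

text \<open>Both \<open>f\<close> and \<open>sin\<close> vanish to first order at \<open>p\<close>, so the quotient \<open>f\<^sup>2 / sin\<close> vanishes there. This
  is the boundary term in the next lemma.\<close>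

lemma sq_quotient_sin_tendsto_0:
  fixes f :: "real \<Rightarrow> real"
  assumes f: "(f has_real_derivative d) (at p)" "f p = 0" and p: "sin p = 0"
  shows "((\<lambda>t. cos t / sin t * (f t)\<^sup>2) \<longlongrightarrow> 0) (at p)"
proof -
  have c: "cos p \<noteq> 0" using p sin_cos_squared_add[of p] by auto
  have 1: "((\<lambda>t. f t / (t - p)) \<longlongrightarrow> d) (at p)"
    using f by (simp add: has_field_derivative_iff)
  have 2: "((\<lambda>t. sin t / (t - p)) \<longlongrightarrow> cos p) (at p)"
    using DERIV_sin[of p] p by (simp add: has_field_derivative_iff)
  have 3: "(f \<longlongrightarrow> 0) (at p)" using DERIV_isCont[OF f(1)] f(2) by (simp add: isCont_def)
  have 4: "(cos \<longlongrightarrow> cos p) (at p)" using isCont_cos by (simp add: isCont_def)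
  have "((\<lambda>t. cos t * (f t / (t - p) * f t / (sin t / (t - p)))) \<longlongrightarrow> cos p * (d * 0 / cos p)) (at p)"
    by (intro tendsto_intros 1 2 3 4 c)
  then have "((\<lambda>t. cos t * (f t / (t - p) * f t / (sin t / (t - p)))) \<longlongrightarrow> 0) (at p)" by simp
  moreover have "eventually (\<lambda>t. cos t * (f t / (t - p) * f t / (sin t / (t - p))) = cos t / sin t * (f t)\<^sup>2) (at p)"
  proof (rule eventually_mono)
    show "eventually (\<lambda>t. t \<noteq> p) (at p)" by (simp add: eventually_at_filter)
    fix t :: real assume "t \<noteq> p"
    then have "t - p \<noteq> 0" by simp
    then have e: "f t / (t - p) * f t / (sin t / (t - p)) = f t * f t / sin t" by (cases "sin t = 0") (simp_all add: divide_simps)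
    show "cos t * (f t / (t - p) * f t / (sin t / (t - p))) = cos t / sin t * (f t)\<^sup>2"
      unfolding e by (simp add: power2_eq_square)
  qed
  ultimately show ?thesis by (rule Lim_transform_eventually)
qed

text \<open>A Hardy-type substitution: with \<open>f = k sin\<close> and \<open>u = f' - f cot = k' sin\<close> one has
  \<open>\<integral> (f'\<^sup>2 - f\<^sup>2) = \<integral> u\<^sup>2\<close>, and integrating \<open>a cos t\<close> by parts turns it into \<open>- (2a/3) sin t f u\<close>. The resulting
  quadratic form \<open>u\<^sup>2 - (2a/3) (f sin) u + a\<^sup>2 (f sin)\<^sup>2\<close> is positive. To avoid the singularity of \<open>k\<close>, the
  integration by parts is recorded by \<open>H = f\<^sup>2 cot + (a/3) f\<^sup>2 sin\<close>, whose derivative is at most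
  the difference of the integrands and which extends continuously by \<open>0\<close> to both end points.\<close>

lemma dirichlet_gap:
  fixes f f1 :: "real \<Rightarrow> real"
  assumes f: "\<And>t. (f has_real_derivative f1 t) (at t)" and c: "continuous_on UNIV f1"
    and z: "f 0 = 0" "f pi = 0"
  shows "integral {0..pi} (\<lambda>t. (f t)\<^sup>2)
    \<le> integral {0..pi} (\<lambda>t. (f1 t)\<^sup>2 + (a\<^sup>2 * (sin t)\<^sup>2 + a * cos t) * (f t)\<^sup>2)"
proof -
  define q where "q = (\<lambda>t. (f1 t)\<^sup>2 + (a\<^sup>2 * (sin t)\<^sup>2 + a * cos t - 1) * (f t)\<^sup>2)"
  define H where "H = (\<lambda>t. cos t / sin t * (f t)\<^sup>2 + a / 3 * (sin t * (f t)\<^sup>2))"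
  have cf: "continuous_on UNIV f" by (rule DERIV_UNIV_imp_continuous_on[OF f])
  have cq: "continuous_on UNIV q" unfolding q_def by (intro continuous_intros c cf)
  obtain Q where Q: "\<And>s. (Q has_real_derivative q s) (at s)"
    using continuous_antiderivative[OF cq] by blast
  have H0: "H 0 = 0" "H pi = 0" by (simp_all add: H_def)
  have Hlim: "(H \<longlongrightarrow> H p) (at p)" if "p = 0 \<or> p = pi" for p
  proof -
    have "((\<lambda>t. a / 3 * (sin t * (f t)\<^sup>2)) \<longlongrightarrow> a / 3 * (sin p * (f p)\<^sup>2)) (at p)"
      by (intro tendsto_intros DERIV_isCont[OF f, unfolded isCont_def])
    moreover have "((\<lambda>t. cos t / sin t * (f t)\<^sup>2) \<longlongrightarrow> 0) (at p)"
      using that z by (intro sq_quotient_sin_tendsto_0[OF f]) auto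
    ultimately show ?thesis using that H0 tendsto_add unfolding H_def by fastforce
  qed
  have Hder: "(H has_real_derivative ((- (sin t * sin t) - cos t * cos t) / (sin t * sin t) * (f t)\<^sup>2 + cos t / sin t * (2 * f t * f1 t)
       + a / 3 * (cos t * (f t)\<^sup>2 + sin t * (2 * f t * f1 t)))) (at t)" if "0 < t" "t < pi" for t
    unfolding H_def using sin_gt_zero[OF that]
    by (auto intro!: derivative_eq_intros f simp: power2_eq_square field_simps)
  have pos: "(- (sin t * sin t) - cos t * cos t) / (sin t * sin t) * (f t)\<^sup>2 + cos t / sin t * (2 * f t * f1 t)
       + a / 3 * (cos t * (f t)\<^sup>2 + sin t * (2 * f t * f1 t)) \<le> q t" if "0 < t" "t < pi" for t
  proof -
    define S C u where "S = sin t" and "C = cos t" and "u = f1 t - cos t / sin t * f t"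
    have S: "S > 0" using sin_gt_zero[OF that] by (simp add: S_def)
    have SC: "C * C = 1 - S * S" unfolding S_def C_def using sin_cos_squared_add[of t] by (simp add: power2_eq_square)
    have f1: "f1 t = u + C / S * f t" by (simp add: u_def S_def C_def)
    have "q t - ((- (S * S) - C * C) / (S * S) * (f t)\<^sup>2 + C / S * (2 * f t * f1 t)
       + a / 3 * (C * (f t)\<^sup>2 + S * (2 * f t * f1 t))) = u\<^sup>2 - 2 * a / 3 * (S * f t) * u + a\<^sup>2 * (S * f t)\<^sup>2"
      unfolding q_def f1 S_def[symmetric] C_def[symmetric]
    proof -
      have i: "C / S * C / S = (1 - S * S) / (S * S)" using SC S by (simp add: field_simps)
      have j: "(- (S * S) - C * C) / (S * S) = - 1 / (S * S)" using SC by simp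
      have k: "(1 - S * S) / (S * S) = 1 / (S * S) - 1" using S by (simp add: field_simps)
      define K where "K = C / S"
      have KS: "K * S = C" using S by (simp add: K_def)
      have KK: "K\<^sup>2 = 1 / (S * S) - 1" using i k by (simp add: K_def power2_eq_square)
      show "(u + C / S * f t)\<^sup>2 + (a\<^sup>2 * S\<^sup>2 + a * C - 1) * (f t)\<^sup>2 -
        ((- (S * S) - C * C) / (S * S) * (f t)\<^sup>2 + C / S * (2 * f t * (u + C / S * f t)) +
         a / 3 * (C * (f t)\<^sup>2 + S * (2 * f t * (u + C / S * f t)))) =
        u\<^sup>2 - 2 * a / 3 * (S * f t) * u + a\<^sup>2 * (S * f t)\<^sup>2"
      proof -
        have "1 / (S * S) = K\<^sup>2 + 1" using KK by simp
        then have j': "(- (S * S) - C * C) / (S * S) = - K\<^sup>2 - 1" using j by simp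
        show ?thesis unfolding j' K_def[symmetric] KS[symmetric] using S
          by (simp add: power2_eq_square field_simps)
      qed
    qed
    also have "\<dots> = (u - a / 3 * (S * f t))\<^sup>2 + 8 / 9 * (a * (S * f t))\<^sup>2"
      by (simp add: power2_eq_square field_simps)
    also have "\<dots> \<ge> 0" by simp
    finally show ?thesis by (simp add: S_def C_def)
  qed
  have "continuous (at t) H" if "0 \<le> t" "t \<le> pi" for t
  proof (cases "t = 0 \<or> t = pi")
    case True then show ?thesis using Hlim isCont_def by blast
  next
    case False then show ?thesis using DERIV_isCont[OF Hder] that by auto
  qed
  then have "continuous_on {0..pi} (\<lambda>t. Q t - H t)"
    using DERIV_isCont[OF Q] by (intro continuous_intros) (auto intro!: continuous_at_imp_continuous_on)
  then have "Q 0 - H 0 \<le> Q pi - H pi"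
  proof (rule DERIV_nonneg_imp_increasing_open[rotated 2])
    fix t :: real assume "0 < t" "t < pi"
    then show "\<exists>y. ((\<lambda>t. Q t - H t) has_real_derivative y) (at t) \<and> 0 \<le> y"
      using DERIV_diff[OF Q Hder] pos by fastforce
  qed auto
  moreover have "integral {0..pi} q = Q pi - Q 0"
    using Q by (auto intro!: integral_of_derivative simp: has_real_derivative_iff_has_vector_derivative[symmetric])
  ultimately have "0 \<le> integral {0..pi} q" using H0 by simp
  also have "q = (\<lambda>t. ((f1 t)\<^sup>2 + (a\<^sup>2 * (sin t)\<^sup>2 + a * cos t) * (f t)\<^sup>2) - (f t)\<^sup>2)"
    by (auto simp: q_def algebra_simps)
  also have "integral {0..pi} \<dots> = integral {0..pi} (\<lambda>t. (f1 t)\<^sup>2 + (a\<^sup>2 * (sin t)\<^sup>2 + a * cos t) * (f t)\<^sup>2)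
     - integral {0..pi} (\<lambda>t. (f t)\<^sup>2)"
    by (intro integral_diff integrable_on_if_continuous_UNIV continuous_intros c cf)
  finally show ?thesis by simp
qed

text \<open>The half period from \<open>\<pi>\<close> to \<open>2\<pi>\<close> reduces to the first one with \<open>- a\<close> in place of \<open>a\<close>, since \<open>cos\<close>
  changes sign under a shift by \<open>\<pi>\<close>.\<close>

lemma dirichlet_gap_circle:
  fixes f f1 :: "real \<Rightarrow> real"
  assumes f: "\<And>t. (f has_real_derivative f1 t) (at t)" and c: "continuous_on UNIV f1"
    and z: "f 0 = 0" "f pi = 0" "f (2 * pi) = 0"
  shows "integral {0..2 * pi} (\<lambda>t. (f t)\<^sup>2)
    \<le> integral {0..2 * pi} (\<lambda>t. (f1 t)\<^sup>2 + (a\<^sup>2 * (sin t)\<^sup>2 + a * cos t) * (f t)\<^sup>2)"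
proof -
  have cf: "continuous_on UNIV f" by (rule DERIV_UNIV_imp_continuous_on[OF f])
  let ?q = "\<lambda>t. (f1 t)\<^sup>2 + (a\<^sup>2 * (sin t)\<^sup>2 + a * cos t) * (f t)\<^sup>2"
  have cq: "continuous_on UNIV ?q" by (intro continuous_intros c cf)
  have cf2: "continuous_on UNIV (\<lambda>t. (f t)\<^sup>2)" by (intro continuous_intros cf)
  have split: "integral {0..2*pi} h = integral {0..pi} h + integral {0..pi} (\<lambda>t. h (t + pi))"
    if "continuous_on UNIV h" for h :: "real \<Rightarrow> real"
  proof -
    have "integral {0..2*pi} h = integral {0..pi} h + integral {pi..2*pi} h"
      using that by (intro Henstock_Kurzweil_Integration.integral_combine[symmetric] integrable_on_if_continuous_UNIV) auto
    moreover have "integral {pi..2*pi} h = integral {0..pi} (\<lambda>t. h (t + pi))"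
      using integral_shift_Icc_real[of 0 pi h pi] by (simp add: o_def add.commute)
    ultimately show ?thesis by simp
  qed
  have "integral {0..pi} (\<lambda>t. (f (t + pi))\<^sup>2)
    \<le> integral {0..pi} (\<lambda>t. (f1 (t + pi))\<^sup>2 + ((-a)\<^sup>2 * (sin t)\<^sup>2 + (-a) * cos t) * (f (t + pi))\<^sup>2)"
  proof (rule dirichlet_gap)
    show "((\<lambda>t. f (t + pi)) has_real_derivative f1 (t + pi)) (at t)" for t
      using f[of "t + pi"] by (simp add: DERIV_shift)
    show "continuous_on UNIV (\<lambda>t. f1 (t + pi))"
      by (intro continuous_on_compose2[OF c] continuous_intros) auto
    show "f (0 + pi) = 0" using z by simp
    show "f (pi + pi) = 0" using z(3) by (simp only: mult_2)
  qed
  also have "(\<lambda>t. (f1 (t + pi))\<^sup>2 + ((-a)\<^sup>2 * (sin t)\<^sup>2 + (-a) * cos t) * (f (t + pi))\<^sup>2) = (\<lambda>t. ?q (t + pi))"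
    by simp
  finally have "integral {0..pi} (\<lambda>t. (f (t + pi))\<^sup>2) \<le> integral {0..pi} (\<lambda>t. ?q (t + pi))" .
  moreover have "integral {0..pi} (\<lambda>t. (f t)\<^sup>2) \<le> integral {0..pi} ?q"
    by (rule dirichlet_gap[OF f c z(1,2)])
  ultimately show ?thesis unfolding split[OF cq] split[OF cf2] by simp
qed


text \<open>Stated with a primitive \<open>Q\<close> so that it covers scalings, shifts and reflections (negative \<open>k\<close>)
  alike.\<close>

lemma integral_affine:
  fixes h :: "real \<Rightarrow> real"
  assumes "\<And>s. (Q has_real_derivative h s) (at s)" "b \<ge> 0"
  shows "k * integral {0..b} (\<lambda>t. h (p + k * t)) = Q (p + k * b) - Q p"
proof -
  have "((\<lambda>t. Q (p + k * t)) has_real_derivative k * h (p + k * t)) (at t)" for t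
  proof -
    have "((\<lambda>t. p + k * t) has_real_derivative k) (at t)" by (auto intro!: derivative_eq_intros)
    from DERIV_chain2[where f = Q, OF assms(1) this] show ?thesis by (simp add: mult.commute)
  qed
  then have "integral {0..b} (\<lambda>t. k * h (p + k * t)) = Q (p + k * b) - Q (p + k * 0)"
    using assms(2) by (intro integral_of_derivative) (auto simp: has_real_derivative_iff_has_vector_derivative)
  then show ?thesis by simp
qed

lemma integral_reflection:
  fixes h :: "real \<Rightarrow> real"
  assumes "continuous_on UNIV h" "b \<ge> 0"
  shows "integral {0..b} (\<lambda>t. h (b - t)) = integral {0..b} h"
proof -
  obtain Q where Q: "\<And>s. (Q has_real_derivative h s) (at s)"
    using continuous_antiderivative[OF assms(1)] by blast
  show ?thesis
    using integral_affine[OF Q assms(2), of "-1" b] integral_affine[OF Q assms(2), of 1 0] by simp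
qed

text \<open>With \<open>D = d/dt - a sin t\<close> the expression \<open>f'' - (a\<^sup>2 sin\<^sup>2 t + a cos t) f\<close> is \<open>- D* D f\<close>; both
  identities are integrations by parts.\<close>

lemma circle_mode_energy:
  fixes f f1 f2 :: "real \<Rightarrow> real"
  assumes f: "\<And>t. (f has_real_derivative f1 t) (at t)" and f1: "\<And>t. (f1 has_real_derivative f2 t) (at t)"
    and c: "continuous_on UNIV f2" and per: "f (2 * pi) = f 0" "f1 (2 * pi) = f1 0"
  shows "integral {0..2 * pi} (\<lambda>t. (f1 t - a * sin t * f t)\<^sup>2)
     = - integral {0..2 * pi} (\<lambda>t. f t * (f2 t - (a\<^sup>2 * (sin t)\<^sup>2 + a * cos t) * f t))"
    and "integral {0..2 * pi} (\<lambda>t. (f1 t - a * sin t * f t)\<^sup>2)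
     = integral {0..2 * pi} (\<lambda>t. (f1 t)\<^sup>2 + (a\<^sup>2 * (sin t)\<^sup>2 + a * cos t) * (f t)\<^sup>2)"
proof -
  have cf: "continuous_on UNIV f" by (rule DERIV_UNIV_imp_continuous_on[OF f])
  have cf1: "continuous_on UNIV f1" by (rule DERIV_UNIV_imp_continuous_on[OF f1])
  let ?P = "\<lambda>t. (f1 t - a * sin t * f t)\<^sup>2" and ?q = "\<lambda>t. f t * (f2 t - (a\<^sup>2 * (sin t)\<^sup>2 + a * cos t) * f t)"
    and ?r = "\<lambda>t. (f1 t)\<^sup>2 + (a\<^sup>2 * (sin t)\<^sup>2 + a * cos t) * (f t)\<^sup>2"
  have i: "?P integrable_on {0..2*pi}" "?q integrable_on {0..2*pi}" "?r integrable_on {0..2*pi}"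
    by (intro integrable_on_if_continuous_UNIV continuous_intros c cf cf1)+
  have "((\<lambda>t. f t * f1 t - a * (sin t * (f t)\<^sup>2)) has_real_derivative ?P t + ?q t) (at t)" for t
    by (auto intro!: derivative_eq_intros f f1 simp: power2_eq_square field_simps)
  then have "integral {0..2*pi} (\<lambda>t. ?P t + ?q t) = 0"
    by (subst integral_of_derivative[where F="\<lambda>t. f t * f1 t - a * (sin t * (f t)\<^sup>2)"])
       (auto simp: has_real_derivative_iff_has_vector_derivative per)
  moreover have "((\<lambda>t. - a * (sin t * (f t)\<^sup>2)) has_real_derivative ?P t - ?r t) (at t)" for t
    by (auto intro!: derivative_eq_intros f f1 simp: power2_eq_square field_simps)
  then have "integral {0..2*pi} (\<lambda>t. ?P t - ?r t) = 0"
    by (subst integral_of_derivative[where F="\<lambda>t. - a * (sin t * (f t)\<^sup>2)"])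
       (auto simp: has_real_derivative_iff_has_vector_derivative per)
  ultimately show "integral {0..2*pi} ?P = - integral {0..2*pi} ?q" "integral {0..2*pi} ?P = integral {0..2*pi} ?r"
    using i by (simp_all add: integral_add integral_diff)
qed

text \<open>The Dirichlet estimate reads \<open>\<parallel>f\<parallel>\<^sup>2 \<le> \<parallel>D f\<parallel>\<^sup>2 = \<langle>D* D f, f\<rangle>\<close>, and \<open>\<parallel>D* D f - f\<parallel>\<^sup>2 \<ge> 0\<close> then gives
  \<open>\<parallel>D* D f\<parallel>\<^sup>2 \<ge> 2 \<parallel>D f\<parallel>\<^sup>2 - \<parallel>f\<parallel>\<^sup>2 \<ge> \<parallel>D f\<parallel>\<^sup>2\<close>. Oddness enters through the zeros of \<open>f\<close>.\<close>

lemma circle_mode_gap_odd: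
  fixes f f1 f2 :: "real \<Rightarrow> real"
  assumes f: "\<And>t. (f has_real_derivative f1 t) (at t)" and f1: "\<And>t. (f1 has_real_derivative f2 t) (at t)"
    and c: "continuous_on UNIV f2" and per: "f1 (2 * pi) = f1 0"
    and z: "f 0 = 0" "f pi = 0" "f (2 * pi) = 0"
  shows "integral {0..2 * pi} (\<lambda>t. (f1 t - a * sin t * f t)\<^sup>2)
     \<le> integral {0..2 * pi} (\<lambda>t. (f2 t - (a\<^sup>2 * (sin t)\<^sup>2 + a * cos t) * f t)\<^sup>2)"
proof -
  have cf: "continuous_on UNIV f" by (rule DERIV_UNIV_imp_continuous_on[OF f])
  have cf1: "continuous_on UNIV f1" by (rule DERIV_UNIV_imp_continuous_on[OF f1])
  define w where "w = (\<lambda>t. f2 t - (a\<^sup>2 * (sin t)\<^sup>2 + a * cos t) * f t)"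
  have cw: "continuous_on UNIV w" unfolding w_def by (intro continuous_intros c cf)
  define v where "v = integral {0..2 * pi} (\<lambda>t. (f1 t - a * sin t * f t)\<^sup>2)"
  have v: "v = - integral {0..2*pi} (\<lambda>t. f t * w t)"
    "v = integral {0..2 * pi} (\<lambda>t. (f1 t)\<^sup>2 + (a\<^sup>2 * (sin t)\<^sup>2 + a * cos t) * (f t)\<^sup>2)"
    using circle_mode_energy[OF f f1 c _ per, of a] z by (simp_all add: v_def w_def)
  have "integral {0..2*pi} (\<lambda>t. (f t)\<^sup>2) \<le> v"
    unfolding v(2) by (rule dirichlet_gap_circle[OF f cf1 z])
  moreover have "0 \<le> integral {0..2*pi} (\<lambda>t. (w t + f t)\<^sup>2)"
    by (intro integral_nonneg integrable_on_if_continuous_UNIV continuous_intros cw cf) simp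
  moreover have "(\<lambda>t. (w t + f t)\<^sup>2) = (\<lambda>t. (w t)\<^sup>2 + 2 * (f t * w t) + (f t)\<^sup>2)"
    by (auto simp: power2_eq_square algebra_simps)
  moreover have "integral {0..2*pi} (\<lambda>t. (w t)\<^sup>2 + 2 * (f t * w t) + (f t)\<^sup>2)
     = integral {0..2*pi} (\<lambda>t. (w t)\<^sup>2) + integral {0..2*pi} (\<lambda>t. 2 * (f t * w t)) + integral {0..2*pi} (\<lambda>t. (f t)\<^sup>2)"
    by (subst integral_add integral_add, (intro integrable_on_if_continuous_UNIV continuous_intros cw cf)+)+ simp
  ultimately have "v \<le> integral {0..2*pi} (\<lambda>t. (w t)\<^sup>2)" using v(1) by simp
  then show ?thesis by (simp add: v_def w_def)
qed

text \<open>For even \<open>f\<close> it is \<open>v = D f\<close> that has the zeros of an odd function, and the Dirichlet estimate applies to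
  \<open>\<parallel>D* v\<parallel>\<^sup>2 = \<langle>D D* v, v\<rangle>\<close>, which has the same form with \<open>- a\<close> in place of \<open>a\<close>.\<close>

lemma circle_mode_gap_even:
  fixes f f1 f2 f3 :: "real \<Rightarrow> real"
  assumes f: "\<And>t. (f has_real_derivative f1 t) (at t)" and f1: "\<And>t. (f1 has_real_derivative f2 t) (at t)"
    and c: "continuous_on UNIV f2" and z: "f1 0 = 0" "f1 pi = 0" "f1 (2 * pi) = 0"
  shows "integral {0..2 * pi} (\<lambda>t. (f1 t - a * sin t * f t)\<^sup>2)
     \<le> integral {0..2 * pi} (\<lambda>t. (f2 t - (a\<^sup>2 * (sin t)\<^sup>2 + a * cos t) * f t)\<^sup>2)"
proof -
  have cf: "continuous_on UNIV f" by (rule DERIV_UNIV_imp_continuous_on[OF f])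
  have cf1: "continuous_on UNIV f1" by (rule DERIV_UNIV_imp_continuous_on[OF f1])
  define v where "v = (\<lambda>t. f1 t - a * sin t * f t)"
  define v1 where "v1 = (\<lambda>t. f2 t - a * cos t * f t - a * sin t * f1 t)"
  have dv: "(v has_real_derivative v1 t) (at t)" for t
    unfolding v_def v1_def by (auto intro!: derivative_eq_intros f f1 simp: algebra_simps)
  have cv1: "continuous_on UNIV v1" unfolding v1_def by (intro continuous_intros c cf cf1)
  have cv: "continuous_on UNIV v" unfolding v_def by (intro continuous_intros c cf cf1)
  have zv: "v 0 = 0" "v pi = 0" "v (2*pi) = 0" using z by (simp_all add: v_def)
  let ?A = "\<lambda>t. (v1 t + a * sin t * v t)\<^sup>2"
    and ?B = "\<lambda>t. (v1 t)\<^sup>2 + ((-a)\<^sup>2 * (sin t)\<^sup>2 + (-a) * cos t) * (v t)\<^sup>2"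
  have "((\<lambda>t. a * (sin t * (v t)\<^sup>2)) has_real_derivative ?A t - ?B t) (at t)" for t
    by (auto intro!: derivative_eq_intros dv simp: power2_eq_square field_simps)
  then have "integral {0..2*pi} (\<lambda>t. ?A t - ?B t) = 0"
    by (subst integral_of_derivative[where F="\<lambda>t. a * (sin t * (v t)\<^sup>2)"])
       (auto simp: has_real_derivative_iff_has_vector_derivative)
  moreover have "?A integrable_on {0..2*pi}" "?B integrable_on {0..2*pi}"
    by (intro integrable_on_if_continuous_UNIV continuous_intros cv cv1)+
  ultimately have "integral {0..2*pi} ?A = integral {0..2*pi} ?B" by (simp add: integral_diff)
  moreover have "integral {0..2*pi} (\<lambda>t. (v t)\<^sup>2) \<le> integral {0..2*pi} ?B"
    by (rule dirichlet_gap_circle[OF dv cv1 zv])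
  moreover have "?A = (\<lambda>t. (f2 t - (a\<^sup>2 * (sin t)\<^sup>2 + a * cos t) * f t)\<^sup>2)"
    by (auto simp: v_def v1_def power2_eq_square algebra_simps)
  ultimately show ?thesis by (simp add: v_def)
qed

text \<open>Split \<open>f\<close> into its parts even and odd under \<open>t \<mapsto> 2\<pi> - t\<close>. The operator \<open>D\<close> reverses and \<open>D* D\<close>
  preserves parity, so no cross terms arise. In terms of eigenvalues: the positive spectrum of
  \<open>D* D\<close> starts at \<open>1\<close> or above.\<close>

lemma circle_mode_gap:
  fixes f f1 f2 :: "real \<Rightarrow> real"
  assumes f: "\<And>t. (f has_real_derivative f1 t) (at t)" and f1: "\<And>t. (f1 has_real_derivative f2 t) (at t)"
    and c: "continuous_on UNIV f2" and per: "f (2 * pi) = f 0" "f1 (2 * pi) = f1 0"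
  shows "integral {0..2 * pi} (\<lambda>t. (f1 t - a * sin t * f t)\<^sup>2)
     \<le> integral {0..2 * pi} (\<lambda>t. (f2 t - (a\<^sup>2 * (sin t)\<^sup>2 + a * cos t) * f t)\<^sup>2)"
proof -
  have cf: "continuous_on UNIV f" by (rule DERIV_UNIV_imp_continuous_on[OF f])
  have cf1: "continuous_on UNIV f1" by (rule DERIV_UNIV_imp_continuous_on[OF f1])
  define q where "q = (\<lambda>t. a\<^sup>2 * (sin t)\<^sup>2 + a * cos t)"
  have q: "q (2 * pi - t) = q t" "sin (2 * pi - t) = - sin t" for t by (simp_all add: q_def sin_diff cos_diff)
  have cq: "continuous_on UNIV q" unfolding q_def by (intro continuous_intros)
  define o0 o1 o2 e0 e1 e2 where defs: "o0 = (\<lambda>t. (f t - f (2*pi - t)) / 2)" "o1 = (\<lambda>t. (f1 t + f1 (2*pi - t)) / 2)"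
    "o2 = (\<lambda>t. (f2 t - f2 (2*pi - t)) / 2)" "e0 = (\<lambda>t. (f t + f (2*pi - t)) / 2)"
    "e1 = (\<lambda>t. (f1 t - f1 (2*pi - t)) / 2)" "e2 = (\<lambda>t. (f2 t + f2 (2*pi - t)) / 2)"
  have dr: "((\<lambda>t. f (2*pi - t)) has_real_derivative - f1 (2*pi - t)) (at t)"
    "((\<lambda>t. f1 (2*pi - t)) has_real_derivative - f2 (2*pi - t)) (at t)" for t
  proof -
    have d: "((\<lambda>t. 2 * pi - t) has_real_derivative - 1) (at t)" by (auto intro!: derivative_eq_intros)
    show "((\<lambda>t. f (2*pi - t)) has_real_derivative - f1 (2*pi - t)) (at t)"
      "((\<lambda>t. f1 (2*pi - t)) has_real_derivative - f2 (2*pi - t)) (at t)"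
      using DERIV_chain2[where f = f, OF f d] DERIV_chain2[where f = f1, OF f1 d] by simp_all
  qed
  have do: "(o0 has_real_derivative o1 t) (at t)" "(o1 has_real_derivative o2 t) (at t)"
    and de: "(e0 has_real_derivative e1 t) (at t)" "(e1 has_real_derivative e2 t) (at t)" for t
    using DERIV_cdivide[OF DERIV_diff[OF f dr(1)], of 2 t] DERIV_cdivide[OF DERIV_add[OF f1 dr(2)], of 2 t]
      DERIV_cdivide[OF DERIV_add[OF f dr(1)], of 2 t] DERIV_cdivide[OF DERIV_diff[OF f1 dr(2)], of 2 t]
    unfolding defs by simp_all
  have c2r: "continuous_on UNIV (\<lambda>t. f2 (2*pi - t))"
    by (intro continuous_on_compose2[OF c] continuous_intros) auto
  have co: "continuous_on UNIV o2" and ce: "continuous_on UNIV e2"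
    unfolding defs by (intro continuous_intros c c2r; simp)+
  have co0: "continuous_on UNIV o0" and ce0: "continuous_on UNIV e0"
    and co1: "continuous_on UNIV o1" and ce1: "continuous_on UNIV e1"
    by (fact DERIV_UNIV_imp_continuous_on[OF do(1)] DERIV_UNIV_imp_continuous_on[OF de(1)]
        DERIV_UNIV_imp_continuous_on[OF do(2)] DERIV_UNIV_imp_continuous_on[OF de(2)])+
  define vo ve wo we where vw: "vo = (\<lambda>t. o1 t - a * sin t * o0 t)" "ve = (\<lambda>t. e1 t - a * sin t * e0 t)"
    "wo = (\<lambda>t. o2 t - q t * o0 t)" "we = (\<lambda>t. e2 t - q t * e0 t)"
  have cvw: "continuous_on UNIV vo" "continuous_on UNIV ve" "continuous_on UNIV wo" "continuous_on UNIV we"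
    unfolding vw by (intro continuous_intros co ce co0 ce0 co1 ce1 cq)+
  have O: "integral {0..2*pi} (\<lambda>t. (vo t)\<^sup>2) \<le> integral {0..2*pi} (\<lambda>t. (wo t)\<^sup>2)"
    unfolding vw q_def by (rule circle_mode_gap_odd[OF do co]) (auto simp: defs per)
  have E: "integral {0..2*pi} (\<lambda>t. (ve t)\<^sup>2) \<le> integral {0..2*pi} (\<lambda>t. (we t)\<^sup>2)"
    unfolding vw q_def by (rule circle_mode_gap_even[OF de ce]) (auto simp: defs per)
  have orth: "integral {0..2*pi} (\<lambda>t. (g t + h t)\<^sup>2) = integral {0..2*pi} (\<lambda>t. (g t)\<^sup>2) + integral {0..2*pi} (\<lambda>t. (h t)\<^sup>2)"
    if cg: "continuous_on UNIV g" "continuous_on UNIV h" and r: "\<And>t. g (2*pi - t) = - g t" "\<And>t. h (2*pi - t) = h t" for g h :: "real \<Rightarrow> real"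
  proof -
    have "integral {0..2*pi} (\<lambda>t. g t * h t) = integral {0..2*pi} (\<lambda>t. g (2*pi - t) * h (2*pi - t))"
      by (rule integral_reflection[symmetric]) (auto intro!: continuous_intros cg)
    then have z: "integral {0..2*pi} (\<lambda>t. g t * h t) = 0" by (simp add: r)
    have "(\<lambda>t. (g t + h t)\<^sup>2) = (\<lambda>t. (g t)\<^sup>2 + (h t)\<^sup>2 + 2 * (g t * h t))"
      by (auto simp: power2_eq_square algebra_simps)
    moreover have "integral {0..2*pi} \<dots> = integral {0..2*pi} (\<lambda>t. (g t)\<^sup>2) + integral {0..2*pi} (\<lambda>t. (h t)\<^sup>2)
        + integral {0..2*pi} (\<lambda>t. 2 * (g t * h t))"
      by (subst integral_add integral_add, (intro integrable_on_if_continuous_UNIV continuous_intros cg)+)+ simp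
    ultimately show ?thesis using z by simp
  qed
  have par: "ve (2*pi - t) = - ve t" "vo (2*pi - t) = vo t" "wo (2*pi - t) = - wo t" "we (2*pi - t) = we t" for t
    unfolding vw defs q by (simp_all add: field_simps)
  have "integral {0..2*pi} (\<lambda>t. (ve t + vo t)\<^sup>2) \<le> integral {0..2*pi} (\<lambda>t. (wo t + we t)\<^sup>2)"
    using O E orth[OF cvw(2,1) par(1,2)] orth[OF cvw(3,4) par(3,4)] by simp
  moreover have "ve t + vo t = f1 t - a * sin t * f t" "wo t + we t = f2 t - q t * f t" for t
    unfolding vw defs by (simp_all add: field_simps)
  ultimately show ?thesis by (simp add: q_def)
qed


section \<open>The first eigenvalue of a periodic Sturm-Liouville problem\<close>

text \<open>The derivatives are carried along as arguments, which keeps the variational computations free of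
  side conditions on differentiability.\<close>

definition c2_periodic :: "real \<Rightarrow> (real \<Rightarrow> real) \<Rightarrow> (real \<Rightarrow> real) \<Rightarrow> (real \<Rightarrow> real) \<Rightarrow> bool" where
  "c2_periodic L f f1 f2 \<longleftrightarrow> (\<forall>s. (f has_real_derivative f1 s) (at s)) \<and>
     (\<forall>s. (f1 has_real_derivative f2 s) (at s)) \<and> continuous_on UNIV f2 \<and> (\<forall>s. f (s + L) = f s)"

lemma periodic_derivative:
  fixes f :: "real \<Rightarrow> real"
  assumes "\<And>s. (f has_real_derivative f1 s) (at s)" "\<And>s. f (s + L) = f s"
  shows "f1 (s + L) = f1 s"
proof -
  have "((\<lambda>t. f (t + L)) has_real_derivative f1 (s + L)) (at s)"
    using assms(1)[of "s + L"] by (simp add: DERIV_shift)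
  then show ?thesis using DERIV_unique[of f _ s "f1 s"] assms(1)[of s] assms(2) by simp
qed

lemma periodic_int:
  fixes h :: "real \<Rightarrow> 'b" and L :: real
  shows "(\<And>s. h (s + L) = h s) \<Longrightarrow> h (s + of_int j * L) = h s"
proof (induction j arbitrary: s rule: int_induct[where k=0])
  case base show ?case by simp
next
  case (step1 i) then show ?case using step1(3)[of "s + of_int i * L"] by (simp add: algebra_simps)
next
  case (step2 i) then show ?case using step2(3)[of "s + of_int (i - 1) * L"] by (simp add: algebra_simps)
qed

lemma c2_periodicD:
  assumes "c2_periodic L f f1 f2"
  shows "(f has_real_derivative f1 s) (at s)" "(f1 has_real_derivative f2 s) (at s)"
    "continuous_on A f" "continuous_on A f1" "continuous_on A f2"
    "f (s + L) = f s" "f1 (s + L) = f1 s" "f2 (s + L) = f2 s"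
proof -
  have d: "\<And>s. (f has_real_derivative f1 s) (at s)" "\<And>s. (f1 has_real_derivative f2 s) (at s)"
    and p: "\<And>s. f (s + L) = f s"
    using assms by (auto simp: c2_periodic_def)
  show "(f has_real_derivative f1 s) (at s)" "(f1 has_real_derivative f2 s) (at s)" "f (s + L) = f s"
    using d p by auto
  show "continuous_on A f" "continuous_on A f1"
    by (rule DERIV_UNIV_imp_continuous_on, rule d)+
  show "continuous_on A f2" using assms continuous_on_subset unfolding c2_periodic_def by blast
  show p1: "f1 (s + L) = f1 s" for s using periodic_derivative[OF d(1) p] .
  show "f2 (s + L) = f2 s" using periodic_derivative[OF d(2) p1] .
qed

lemma c2_periodic_add_scaled:
  assumes f: "c2_periodic L f f1 f2" and g: "c2_periodic L g g1 g2"
  shows "c2_periodic L (\<lambda>s. f s + t * g s) (\<lambda>s. f1 s + t * g1 s) (\<lambda>s. f2 s + t * g2 s)"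
  unfolding c2_periodic_def
  using c2_periodicD[OF f] c2_periodicD[OF g]
  by (auto intro!: derivative_intros continuous_intros DERIV_cmult)

lemma c2_periodic_const: "c2_periodic L (\<lambda>s. c) (\<lambda>s. 0) (\<lambda>s. 0)"
  by (auto simp: c2_periodic_def)

lemma c2_periodic_by_parts:
  assumes f: "c2_periodic L f f1 f2" and g: "c2_periodic L g g1 g2" and "L \<ge> 0"
  shows "integral {0..L} (\<lambda>s. f1 s * g1 s) = - integral {0..L} (\<lambda>s. f s * g2 s)"
proof -
  note F = c2_periodicD[OF f] note G = c2_periodicD[OF g]
  have "((\<lambda>s. f s * g1 s) has_real_derivative f1 s * g1 s + f s * g2 s) (at s)" for s
    by (auto intro!: derivative_eq_intros F(1) G(2))
  then have "integral {0..L} (\<lambda>s. f1 s * g1 s + f s * g2 s) = f L * g1 L - f 0 * g1 0"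
    using assms by (intro integral_of_derivative) (auto simp: has_real_derivative_iff_has_vector_derivative)
  moreover have "f L = f 0" "g1 L = g1 0" using F(6)[of 0] G(7)[of 0] by auto
  moreover have "integral {0..L} (\<lambda>s. f1 s * g1 s + f s * g2 s)
     = integral {0..L} (\<lambda>s. f1 s * g1 s) + integral {0..L} (\<lambda>s. f s * g2 s)"
    by (intro integral_add integrable_continuous_real continuous_intros F G)
  ultimately show ?thesis by simp
qed

lemma periodic_antiderivative:
  fixes q :: "real \<Rightarrow> real"
  assumes c: "continuous_on UNIV q" and p: "\<And>s. q (s + L) = q s"
    and z: "integral {0..L} q = 0" and L: "L > 0"
  obtains Q where "\<And>s. (Q has_real_derivative q s) (at s)" "\<And>s. Q (s + L) = Q s" "integral {0..L} Q = 0"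
proof -
  obtain Q where Q: "\<And>s. (Q has_real_derivative q s) (at s)" using continuous_antiderivative[OF c] by blast
  have "integral {0..L} q = Q L - Q 0"
    using Q L by (intro integral_of_derivative) (auto simp: has_real_derivative_iff_has_vector_derivative)
  then have per: "Q (s + L) = Q s" for s using DERIV_const_diff_const[of Q q L s, OF Q p] z by simp
  define m where "m = integral {0..L} Q / L"
  have cQ: "continuous_on UNIV Q" by (rule DERIV_UNIV_imp_continuous_on[OF Q])
  have "integral {0..L} (\<lambda>s. Q s - m) = integral {0..L} Q - integral {0..L} (\<lambda>s. m)"
    by (intro integral_diff integrable_on_if_continuous_UNIV cQ continuous_intros)
  then have "integral {0..L} (\<lambda>s. Q s - m) = 0" using L by (simp add: m_def)
  moreover have "((\<lambda>s. Q s - m) has_real_derivative q s) (at s)" for s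
    using DERIV_diff[OF Q DERIV_const, of m s] by simp
  ultimately show thesis using that[of "\<lambda>s. Q s - m"] per by simp
qed

lemma c2_periodic_poisson:
  fixes q :: "real \<Rightarrow> real"
  assumes c: "continuous_on UNIV q" and p: "\<And>s. q (s + L) = q s"
    and z: "integral {0..L} q = 0" and L: "L > 0"
  obtains F F1 where "c2_periodic L F F1 q"
proof -
  obtain F1 where F1: "\<And>s. (F1 has_real_derivative q s) (at s)" "\<And>s. F1 (s + L) = F1 s" "integral {0..L} F1 = 0"
    using periodic_antiderivative[OF assms] by blast
  have "continuous_on UNIV F1" by (rule DERIV_UNIV_imp_continuous_on[OF F1(1)])
  then obtain F where "\<And>s. (F has_real_derivative F1 s) (at s)" "\<And>s. F (s + L) = F s"
    using periodic_antiderivative[OF _ F1(2,3) L] by metis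
  then show thesis using that F1 c unfolding c2_periodic_def by blast
qed

text \<open>A du Bois-Reymond lemma. Let \<open>F\<close> be a classical solution of \<open>F'' = q\<close>. Then \<open>g - F\<close> is orthogonal to
  all second derivatives, and \<open>g - F\<close> minus its mean is itself a second derivative, hence zero.\<close>

lemma weak_second_derivative:
  fixes g q :: "real \<Rightarrow> real"
  assumes cg: "continuous_on UNIV g" and pg: "\<And>s. g (s + L) = g s"
    and cq: "continuous_on UNIV q" and pq: "\<And>s. q (s + L) = q s" and L: "L > 0"
    and zq: "integral {0..L} q = 0"
    and weak: "\<And>f f1 f2. c2_periodic L f f1 f2 \<Longrightarrow>
      integral {0..L} (\<lambda>s. g s * f2 s) = integral {0..L} (\<lambda>s. q s * f s)"
  obtains g1 where "c2_periodic L g g1 q"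
proof -
  obtain F F1 where F: "c2_periodic L F F1 q" using c2_periodic_poisson[OF cq pq zq L] .
  note FD = c2_periodicD[OF F]
  define m where "m = integral {0..L} (\<lambda>s. g s - F s) / L"
  define w where "w = (\<lambda>s. g s - F s - m)"
  have cw: "continuous_on UNIV w" unfolding w_def by (intro continuous_intros cg FD)
  have pw: "w (s + L) = w s" for s unfolding w_def using pg FD(6) by simp
  have "integral {0..L} w = integral {0..L} (\<lambda>s. g s - F s) - integral {0..L} (\<lambda>s. m)"
    unfolding w_def by (intro integral_diff integrable_on_if_continuous_UNIV continuous_intros cg FD)
  then have zw: "integral {0..L} w = 0" using L by (simp add: m_def)
  obtain p p1 where P: "c2_periodic L p p1 w" using c2_periodic_poisson[OF cw pw zw L] .
  note PD = c2_periodicD[OF P]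
  have "integral {0..L} (\<lambda>s. F s * w s) = integral {0..L} (\<lambda>s. q s * p s)"
    using c2_periodic_by_parts[OF F P] c2_periodic_by_parts[OF P F] L by (simp add: mult.commute)
  moreover have "integral {0..L} (\<lambda>s. g s * w s) = integral {0..L} (\<lambda>s. q s * p s)" by (rule weak[OF P])
  moreover have "integral {0..L} (\<lambda>s. w s * w s)
      = integral {0..L} (\<lambda>s. g s * w s) - integral {0..L} (\<lambda>s. F s * w s) - integral {0..L} (\<lambda>s. m * w s)"
  proof -
    have i: "(\<lambda>s. g s * w s) integrable_on {0..L}" "(\<lambda>s. F s * w s) integrable_on {0..L}"
      "(\<lambda>s. m * w s) integrable_on {0..L}"
      by (rule integrable_on_if_continuous_UNIV, intro continuous_intros cw cg FD)+
    have "(\<lambda>s. w s * w s) = (\<lambda>s. g s * w s - F s * w s - m * w s)"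
      by (rule ext) (simp add: w_def algebra_simps)
    show ?thesis unfolding \<open>(\<lambda>s. w s * w s) = _\<close>
      by (simp add: integral_diff integrable_diff i del: integral_mult_right integral_mult_left)
  qed
  ultimately have "integral {0..L} (\<lambda>s. w s * w s) = 0" using zw by simp
  moreover have "continuous_on {0..L} (\<lambda>s. w s * w s)"
    by (intro continuous_intros continuous_on_subset[OF cw]) auto
  moreover have "w s * w s \<ge> 0" for s by simp
  ultimately have "\<forall>s\<in>{0..L}. w s * w s = 0" using integral_eq_0_iff[of 0 L "\<lambda>s. w s * w s"] L by blast
  then have w0: "w s = 0" if "s \<in> {0..L}" for s using that by auto
  have "w s = 0" for s
  proof -
    have "s - of_int \<lfloor>s / L\<rfloor> * L \<in> {0..L}"
      using L floor_divide_lower[of L s] floor_divide_upper[of L s] by (auto simp: algebra_simps)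
    then show ?thesis using w0[of "s + of_int (- \<lfloor>s / L\<rfloor>) * L"] periodic_int[of w L s "- \<lfloor>s / L\<rfloor>", OF pw] by simp
  qed
  then have "g = (\<lambda>s. F s + m * 1)" by (intro ext) (simp add: w_def algebra_simps)
  then show thesis using that c2_periodic_add_scaled[OF F c2_periodic_const, of m 1] by simp
qed


text \<open>The Cauchy-Schwarz inequality on the interval from \<open>s\<close> to \<open>t\<close>; it provides the equicontinuity needed for the
  Arzela-Ascoli theorem.\<close>

lemma c2_periodic_holder:
  assumes f: "c2_periodic L f f1 f2" and st: "0 \<le> s" "s \<le> t" "t \<le> L"
  shows "(f t - f s)\<^sup>2 \<le> (t - s) * integral {0..L} (\<lambda>x. (f1 x)\<^sup>2)"
proof (cases "s = t")
  case False
  note F = c2_periodicD[OF f]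
  have ts: "t - s > 0" using False st by simp
  define m where "m = (f t - f s) / (t - s)"
  have "integral {s..t} f1 = f t - f s"
    using F(1) st by (intro integral_of_derivative) (auto simp: has_real_derivative_iff_has_vector_derivative)
  moreover have "(\<lambda>x. (f1 x - m)\<^sup>2) = (\<lambda>x. (f1 x)\<^sup>2 - 2 * m * f1 x + m\<^sup>2)"
    by (auto simp: power2_eq_square algebra_simps)
  moreover have "integral {s..t} (\<lambda>x. (f1 x)\<^sup>2 - 2 * m * f1 x + m\<^sup>2)
      = integral {s..t} (\<lambda>x. (f1 x)\<^sup>2) - integral {s..t} (\<lambda>x. 2 * m * f1 x) + integral {s..t} (\<lambda>x. m\<^sup>2)"
    by (subst integral_add integral_diff, (intro integrable_continuous_real continuous_intros F)+)+ simp
  moreover have "0 \<le> integral {s..t} (\<lambda>x. (f1 x - m)\<^sup>2)"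
    by (intro integral_nonneg integrable_continuous_real continuous_intros F) simp
  ultimately have "0 \<le> integral {s..t} (\<lambda>x. (f1 x)\<^sup>2) - 2 * m * (f t - f s) + m\<^sup>2 * (t - s)"
    using ts by (simp add: mult.commute)
  also have "\<dots> = integral {s..t} (\<lambda>x. (f1 x)\<^sup>2) - (f t - f s)\<^sup>2 / (t - s)"
  proof -
    have "2 * (d / h) * d - (d / h)\<^sup>2 * h = d\<^sup>2 / h" if "h > 0" for d h :: real
      using that by (simp add: power2_eq_square field_simps)
    from this[OF ts, of "f t - f s"] show ?thesis unfolding m_def by simp
  qed
  finally have "(f t - f s)\<^sup>2 \<le> (t - s) * integral {s..t} (\<lambda>x. (f1 x)\<^sup>2)"
    using ts by (simp add: field_simps)
  also have "\<dots> \<le> (t - s) * integral {0..L} (\<lambda>x. (f1 x)\<^sup>2)"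
    using ts st by (intro mult_left_mono integral_subset_le integrable_continuous_real continuous_intros F) auto
  finally show ?thesis .
qed simp

lemma uniform_limit_integral_tendsto:
  fixes h :: "nat \<Rightarrow> real \<Rightarrow> real"
  assumes "uniform_limit {0..L} h g sequentially" "\<And>n. continuous_on {0..L} (h n)"
  shows "(\<lambda>n. integral {0..L} (h n)) \<longlonglongrightarrow> integral {0..L} g"
proof -
  obtain I J where "\<And>n. (h n has_integral I n) {0..L}" "(g has_integral J) {0..L}" "I \<longlonglongrightarrow> J"
    using uniform_limit_integral[OF assms] by auto
  moreover from this have "(\<lambda>n. integral {0..L} (h n)) = I" "integral {0..L} g = J"
    by (auto simp: integral_unique)
  ultimately show ?thesis by simp
qed

lemma nonneg_quadratic_imp_cauchy_schwarz:
  fixes a b c :: real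
  assumes "\<And>t. 0 \<le> a + 2 * t * b + t\<^sup>2 * c" "c \<ge> 0"
  shows "b\<^sup>2 \<le> a * c"
proof (cases "c = 0")
  case True
  have "b = 0"
  proof (rule ccontr)
    assume "b \<noteq> 0"
    then show False using assms(1)[of "- (a + 1) / (2 * b)"] True by (simp add: field_simps)
  qed
  then show ?thesis using True by simp
next
  case False
  then show ?thesis using assms(1)[of "- b / c"] assms(2) by (simp add: field_simps power2_eq_square)
qed

text \<open>For \<open>k = 1\<close> this expands the Dirichlet energy, for \<open>k = \<kappa>\<close> the weighted norm; together they expand
  the quadratic form whose nonnegativity characterises a minimiser.\<close>

lemma weighted_energy_expand:
  fixes k u v :: "real \<Rightarrow> real"
  assumes "continuous_on {0..L} k" "continuous_on {0..L} u" "continuous_on {0..L} v"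
  shows "integral {0..L} (\<lambda>s. k s * (u s + t * v s)\<^sup>2)
    = integral {0..L} (\<lambda>s. k s * (u s)\<^sup>2) + 2 * t * integral {0..L} (\<lambda>s. k s * u s * v s)
      + t\<^sup>2 * integral {0..L} (\<lambda>s. k s * (v s)\<^sup>2)"
proof -
  have "(\<lambda>s. k s * (u s + t * v s)\<^sup>2)
     = (\<lambda>s. k s * (u s)\<^sup>2 + 2 * t * (k s * u s * v s) + t\<^sup>2 * (k s * (v s)\<^sup>2))"
    by (auto simp: power2_eq_square algebra_simps)
  show ?thesis unfolding \<open>(\<lambda>s. k s * (u s + t * v s)\<^sup>2) = _\<close>
    by (subst integral_add integral_add, (intro integrable_continuous_real continuous_intros assms)+)+ simp
qed

text \<open>For positive \<open>k\<close> the largest such \<open>\<Lambda>\<close> is the first positive eigenvalue of \<open>- f'' = \<Lambda> k f\<close> with periodic boundary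
  conditions.\<close>

definition weighted_poincare :: "real \<Rightarrow> (real \<Rightarrow> real) \<Rightarrow> real \<Rightarrow> bool" where
  "weighted_poincare L k \<Lambda> \<longleftrightarrow> (\<forall>f f1 f2. c2_periodic L f f1 f2 \<longrightarrow> integral {0..L} (\<lambda>s. k s * f s) = 0 \<longrightarrow>
     \<Lambda> * integral {0..L} (\<lambda>s. k s * (f s)\<^sup>2) \<le> integral {0..L} (\<lambda>s. (f1 s)\<^sup>2))"

lemma weighted_poincareD:
  "weighted_poincare L k \<Lambda> \<Longrightarrow> c2_periodic L f f1 f2 \<Longrightarrow> integral {0..L} (\<lambda>s. k s * f s) = 0 \<Longrightarrow>
     \<Lambda> * integral {0..L} (\<lambda>s. k s * (f s)\<^sup>2) \<le> integral {0..L} (\<lambda>s. (f1 s)\<^sup>2)"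
  unfolding weighted_poincare_def by blast

context
  fixes L :: real and k :: "real \<Rightarrow> real"
  assumes L: "L > 0" and ck: "continuous_on UNIV k" and pk: "\<And>s. k (s + L) = k s" and kpos: "\<And>s. k s > 0"
begin

lemma continuous_weight: "continuous_on A k" using ck continuous_on_subset by blast

lemma weight_integral_pos: "integral {0..L} k > 0"
proof -
  have "k s \<ge> 0" for s using kpos[of s] by simp
  then have "integral {0..L} k \<noteq> 0" using integral_eq_0_iff[OF continuous_weight L] kpos[of 0] L by fastforce
  moreover have "integral {0..L} k \<ge> 0"
    using less_imp_le[OF kpos] by (intro integral_nonneg integrable_on_if_continuous_UNIV ck) simp
  ultimately show ?thesis by simp
qed

lemma subtract_weighted_mean:
  assumes f: "c2_periodic L f f1 f2"
  obtains m where "c2_periodic L (\<lambda>s. f s + m) f1 f2" "integral {0..L} (\<lambda>s. k s * (f s + m)) = 0"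
proof -
  note F = c2_periodicD[OF f]
  define m where "m = - integral {0..L} (\<lambda>s. k s * f s) / integral {0..L} k"
  have "integral {0..L} (\<lambda>s. k s * (f s + m)) = integral {0..L} (\<lambda>s. k s * f s) + integral {0..L} (\<lambda>s. k s * m)"
    unfolding distrib_left by (intro integral_add integrable_continuous_real continuous_intros F continuous_weight)
  then have "integral {0..L} (\<lambda>s. k s * (f s + m)) = 0" using weight_integral_pos by (simp add: m_def)
  then show thesis using that c2_periodic_add_scaled[OF f c2_periodic_const, of m 1] by simp
qed

lemma admissible_normalise:
  assumes f: "c2_periodic L f f1 f2" and z: "integral {0..L} (\<lambda>s. k s * f s) = 0"
    and n: "integral {0..L} (\<lambda>s. k s * (f s)\<^sup>2) > 0"
  obtains c where "c2_periodic L (\<lambda>s. c * f s) (\<lambda>s. c * f1 s) (\<lambda>s. c * f2 s)"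
    "integral {0..L} (\<lambda>s. k s * (c * f s)) = 0" "integral {0..L} (\<lambda>s. k s * (c * f s)\<^sup>2) = 1"
    "c\<^sup>2 * integral {0..L} (\<lambda>s. k s * (f s)\<^sup>2) = 1"
proof -
  define c where "c = 1 / sqrt (integral {0..L} (\<lambda>s. k s * (f s)\<^sup>2))"
  have c: "c\<^sup>2 * integral {0..L} (\<lambda>s. k s * (f s)\<^sup>2) = 1"
    using n by (simp add: c_def power_divide)
  moreover have "integral {0..L} (\<lambda>s. k s * (c * f s)) = c * integral {0..L} (\<lambda>s. k s * f s)"
    by (subst integral_mult_right[symmetric]) (simp add: mult.left_commute)
  moreover have "integral {0..L} (\<lambda>s. k s * (c * f s)\<^sup>2) = c\<^sup>2 * integral {0..L} (\<lambda>s. k s * (f s)\<^sup>2)"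
    by (subst integral_mult_right[symmetric]) (simp add: power_mult_distrib mult.left_commute)
  moreover have "c2_periodic L (\<lambda>s. c * f s) (\<lambda>s. c * f1 s) (\<lambda>s. c * f2 s)"
    using c2_periodic_add_scaled[OF c2_periodic_const f, of 0 c] by simp
  ultimately show thesis using that z by simp
qed

lemma admissible_exists:
  obtains f f1 f2 where "c2_periodic L f f1 f2" "integral {0..L} (\<lambda>s. k s * f s) = 0"
    "integral {0..L} (\<lambda>s. k s * (f s)\<^sup>2) = 1"
proof -
  let ?w = "2 * pi / L"
  have "c2_periodic L (\<lambda>s. sin (?w * s)) (\<lambda>s. ?w * cos (?w * s)) (\<lambda>s. - ?w\<^sup>2 * sin (?w * s))"
    unfolding c2_periodic_def using L
    by (auto intro!: derivative_eq_intros continuous_intros simp: power2_eq_square distrib_left)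
  from subtract_weighted_mean[OF this] obtain m where
    m: "c2_periodic L (\<lambda>s. sin (?w * s) + m) (\<lambda>s. ?w * cos (?w * s)) (\<lambda>s. - ?w\<^sup>2 * sin (?w * s))"
      "integral {0..L} (\<lambda>s. k s * (sin (?w * s) + m)) = 0" .
  let ?h = "\<lambda>s. k s * (sin (?w * s) + m)\<^sup>2"
  have ch: "continuous_on {0..L} ?h" by (intro continuous_intros continuous_weight)
  have "integral {0..L} ?h \<noteq> 0"
  proof
    assume "integral {0..L} ?h = 0"
    moreover have "?h s \<ge> 0" for s using kpos[of s] by simp
    ultimately have "\<forall>s\<in>{0..L}. ?h s = 0" using integral_eq_0_iff[OF ch L] by blast
    then have "?h 0 = 0" "?h (L / 4) = 0" using L by auto
    then show False using kpos[of 0] kpos[of "L/4"] L by simp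
  qed
  moreover have "integral {0..L} ?h \<ge> 0"
    using less_imp_le[OF kpos] by (intro integral_nonneg integrable_continuous_real ch) simp
  ultimately have "integral {0..L} ?h > 0" by simp
  from admissible_normalise[OF m this] that show thesis by blast
qed


text \<open>A function of weighted mean zero is controlled by its oscillation: average
  \<open>f s - f t\<close> over \<open>t\<close>.\<close>

lemma c2_periodic_bound:
  assumes f: "c2_periodic L f f1 f2" and z: "integral {0..L} (\<lambda>s. k s * f s) = 0" and s: "s \<in> {0..L}"
  shows "\<bar>f s\<bar> \<le> sqrt (L * integral {0..L} (\<lambda>x. (f1 x)\<^sup>2))"
proof -
  note F = c2_periodicD[OF f]
  define E where "E = integral {0..L} (\<lambda>x. (f1 x)\<^sup>2)"
  have E0: "E \<ge> 0" unfolding E_def by (intro integral_nonneg integrable_continuous_real continuous_intros F) simp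
  have diff: "\<bar>f s - f t\<bar> \<le> sqrt (L * E)" if "t \<in> {0..L}" for t
  proof -
    have "(f s - f t)\<^sup>2 \<le> L * E"
    proof (cases "t \<le> s")
      case True
      then have "(f s - f t)\<^sup>2 \<le> (s - t) * E" using c2_periodic_holder[OF f, of t s] s that by (simp add: E_def)
      also have "\<dots> \<le> L * E" using s that E0 by (intro mult_right_mono) auto
      finally show ?thesis .
    next
      case False
      then have "(f t - f s)\<^sup>2 \<le> (t - s) * E" using c2_periodic_holder[OF f, of s t] s that by (simp add: E_def)
      also have "\<dots> \<le> L * E" using s that E0 by (intro mult_right_mono) auto
      finally show ?thesis by (simp add: power2_commute)
    qed
    then show ?thesis by (simp add: real_le_rsqrt)
  qed
  have "integral {0..L} (\<lambda>t. k t * (f s - f t)) = integral {0..L} (\<lambda>t. k t * f s) - integral {0..L} (\<lambda>t. k t * f t)"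
    unfolding right_diff_distrib by (intro integral_diff integrable_continuous_real continuous_intros F continuous_weight)
  then have "integral {0..L} (\<lambda>t. k t * (f s - f t)) = integral {0..L} k * f s" using z by simp
  moreover have "norm (integral {0..L} (\<lambda>t. k t * (f s - f t))) \<le> integral {0..L} (\<lambda>t. k t * sqrt (L * E))"
  proof (intro integral_norm_bound_integral integrable_continuous_real continuous_intros F continuous_weight)
    fix t assume "t \<in> {0..L}"
    then show "norm (k t * (f s - f t)) \<le> k t * sqrt (L * E)"
      using diff[of t] kpos[of t] by (simp add: abs_mult)
  qed
  ultimately have "integral {0..L} k * \<bar>f s\<bar> \<le> integral {0..L} k * sqrt (L * E)"
    using weight_integral_pos by (simp add: abs_mult)
  then show ?thesis using weight_integral_pos by (simp add: E_def)
qed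

text \<open>Functions of bounded energy are uniformly bounded and equicontinuous. The Arzela-Ascoli theorem is applied on
  one period; periodicity makes the convergence uniform on the whole line, which yields a continuous
  periodic limit.\<close>

lemma c2_periodic_compactness:
  fixes f f1 f2 :: "nat \<Rightarrow> real \<Rightarrow> real"
  assumes f: "\<And>n. c2_periodic L (f n) (f1 n) (f2 n)"
    and z: "\<And>n. integral {0..L} (\<lambda>s. k s * f n s) = 0"
    and E: "\<And>n. integral {0..L} (\<lambda>s. (f1 n s)\<^sup>2) \<le> E"
  obtains g r where "strict_mono r" "uniform_limit UNIV (\<lambda>n. f (r n)) g sequentially"
    "continuous_on UNIV g" "\<And>s. g (s + L) = g s"
proof -
  note F = c2_periodicD[OF f]
  have "0 \<le> integral {0..L} (\<lambda>s. (f1 0 s)\<^sup>2)" by (intro integral_nonneg integrable_continuous_real continuous_intros F) simp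
  with E[of 0] have E0: "E \<ge> 0" by simp
  have bd: "norm (f n s) \<le> sqrt (L * E)" if "s \<in> {0..L}" for n s
  proof -
    have "\<bar>f n s\<bar> \<le> sqrt (L * integral {0..L} (\<lambda>s. (f1 n s)\<^sup>2))" using c2_periodic_bound[OF f z that] .
    also have "\<dots> \<le> sqrt (L * E)" using E[of n] L by simp
    finally show ?thesis by simp
  qed
  have hold: "(f n x - f n y)\<^sup>2 \<le> \<bar>x - y\<bar> * E" if "x \<in> {0..L}" "y \<in> {0..L}" for n x y
  proof -
    have *: "(f n t - f n s)\<^sup>2 \<le> (t - s) * E" if "0 \<le> s" "s \<le> t" "t \<le> L" for s t
      by (rule order_trans[OF c2_periodic_holder[OF f that]]) (use that E[of n] in \<open>simp add: mult_left_mono\<close>)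
    show ?thesis using *[of x y] *[of y x] that by (cases "x \<le> y") (auto simp: power2_commute)
  qed
  have equi: "\<exists>d>0. \<forall>n y. y \<in> {0..L} \<and> norm (x - y) < d \<longrightarrow> norm (f n x - f n y) < e"
    if x: "x \<in> {0..L}" and e: "0 < e" for x e :: real
  proof (intro exI[of _ "e\<^sup>2 / (E + 1)"] conjI allI impI)
    show "0 < e\<^sup>2 / (E + 1)" using e E0 by simp
    fix n y assume y: "y \<in> {0..L} \<and> norm (x - y) < e\<^sup>2 / (E + 1)"
    then have "(f n x - f n y)\<^sup>2 \<le> \<bar>x - y\<bar> * E" using hold x by blast
    also have "\<dots> \<le> \<bar>x - y\<bar> * (E + 1)" by (simp add: mult_left_mono)
    also have "\<dots> < e\<^sup>2" using y E0 by (simp add: field_simps)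
    finally have "(norm (f n x - f n y))\<^sup>2 < e\<^sup>2" by simp
    then show "norm (f n x - f n y) < e" by (rule power2_less_imp_less) (simp add: e less_imp_le)
  qed
  obtain g0 r where r: "strict_mono (r :: nat \<Rightarrow> nat)"
    and lim: "\<And>e. 0 < e \<Longrightarrow> \<exists>N. \<forall>n x. n \<ge> N \<and> x \<in> {0..L} \<longrightarrow> norm (f (r n) x - g0 x) < e"
    by (rule Arzela_Ascoli[OF compact_Icc bd equi]) (assumption | rule that)+
  define p where "p = (\<lambda>s. s - of_int \<lfloor>s / L\<rfloor> * L)"
  define g where "g = (\<lambda>s. g0 (p s))"
  have p: "p s \<in> {0..L}" for s
    using L floor_divide_lower[of L s] floor_divide_upper[of L s] by (auto simp: p_def algebra_simps)
  have fp: "f n (p s) = f n s" for n s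
    using periodic_int[of "f n" L s "- \<lfloor>s / L\<rfloor>"] F(6) by (simp add: p_def)
  have pL: "p (s + L) = p s" for s using L by (simp add: p_def add_divide_distrib algebra_simps)
  have ul: "uniform_limit UNIV (\<lambda>n. f (r n)) g sequentially"
  proof (rule uniform_limitI)
    fix e :: real assume "e > 0"
    then obtain N where "\<forall>n x. n \<ge> N \<and> x \<in> {0..L} \<longrightarrow> norm (f (r n) x - g0 x) < e" using lim by blast
    then have "\<forall>n\<ge>N. \<forall>x\<in>UNIV. dist (f (r n) x) (g x) < e"
      using p fp by (metis dist_norm g_def)
    then show "\<forall>\<^sub>F n in sequentially. \<forall>x\<in>UNIV. dist (f (r n) x) (g x) < e"
      using eventually_sequentially by blast
  qed
  moreover have "continuous_on UNIV g"
    by (rule uniform_limit_theorem[OF always_eventually ul]) (auto intro: F)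
  ultimately show thesis using that[OF r] pL by (simp add: g_def)
qed

text \<open>The quadratic form \<open>\<integral> f'\<^sup>2 - \<Lambda> \<integral> k f\<^sup>2\<close> is nonnegative on functions of weighted mean zero, and hence
  satisfies the Cauchy-Schwarz inequality.\<close>

lemma weighted_poincare_imp_cauchy_schwarz:
  assumes min: "weighted_poincare L k \<Lambda>"
    and f: "c2_periodic L f f1 f2" "integral {0..L} (\<lambda>s. k s * f s) = 0"
    and p: "c2_periodic L p p1 p2" "integral {0..L} (\<lambda>s. k s * p s) = 0"
  shows "(integral {0..L} (\<lambda>s. f1 s * p1 s) - \<Lambda> * integral {0..L} (\<lambda>s. k s * f s * p s))\<^sup>2
    \<le> (integral {0..L} (\<lambda>s. (f1 s)\<^sup>2) - \<Lambda> * integral {0..L} (\<lambda>s. k s * (f s)\<^sup>2))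
      * (integral {0..L} (\<lambda>s. (p1 s)\<^sup>2) - \<Lambda> * integral {0..L} (\<lambda>s. k s * (p s)\<^sup>2))"
proof (rule nonneg_quadratic_imp_cauchy_schwarz)
  let ?I = "integral {0..L}"
  note F = c2_periodicD[OF f(1)] and P = c2_periodicD[OF p(1)]
  fix t
  have ft: "c2_periodic L (\<lambda>s. f s + t * p s) (\<lambda>s. f1 s + t * p1 s) (\<lambda>s. f2 s + t * p2 s)"
    by (rule c2_periodic_add_scaled[OF f(1) p(1)])
  have "?I (\<lambda>s. k s * (f s + t * p s)) = ?I (\<lambda>s. k s * f s + t * (k s * p s))"
    by (simp add: algebra_simps)
  also have "\<dots> = ?I (\<lambda>s. k s * f s) + ?I (\<lambda>s. t * (k s * p s))"
    by (intro integral_add integrable_continuous_real continuous_intros F P continuous_weight)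
  also have "\<dots> = 0" using f(2) p(2) by simp
  finally have "\<Lambda> * ?I (\<lambda>s. k s * (f s + t * p s)\<^sup>2) \<le> ?I (\<lambda>s. (f1 s + t * p1 s)\<^sup>2)"
    by (rule weighted_poincareD[OF min ft])
  then show "0 \<le> (?I (\<lambda>s. (f1 s)\<^sup>2) - \<Lambda> * ?I (\<lambda>s. k s * (f s)\<^sup>2))
      + 2 * t * (?I (\<lambda>s. f1 s * p1 s) - \<Lambda> * ?I (\<lambda>s. k s * f s * p s))
      + t\<^sup>2 * (?I (\<lambda>s. (p1 s)\<^sup>2) - \<Lambda> * ?I (\<lambda>s. k s * (p s)\<^sup>2))"
    using weighted_energy_expand[of L k f p t, OF continuous_weight F(3) P(3)]
      weighted_energy_expand[of L "\<lambda>_. 1" f1 p1 t, OF _ F(4) P(4)]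
    by (simp add: algebra_simps)
next
  show "0 \<le> integral {0..L} (\<lambda>s. (p1 s)\<^sup>2) - \<Lambda> * integral {0..L} (\<lambda>s. k s * (p s)\<^sup>2)"
    using weighted_poincareD[OF min p] by simp
qed

text \<open>Constants may be added to the test function because \<open>k g\<close> has mean zero; so the equation holds for
  all test functions, and \<open>weak_second_derivative\<close> applies.\<close>

lemma weak_eigenfunction_regular:
  assumes cg: "continuous_on UNIV g" and pg: "\<And>s. g (s + L) = g s"
    and gz: "integral {0..L} (\<lambda>s. k s * g s) = 0"
    and weak0: "\<And>p p1 p2. c2_periodic L p p1 p2 \<Longrightarrow> integral {0..L} (\<lambda>s. k s * p s) = 0 \<Longrightarrow>
      integral {0..L} (\<lambda>s. g s * p2 s) = - \<Lambda> * integral {0..L} (\<lambda>s. k s * g s * p s)"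
  obtains g1 where "c2_periodic L g g1 (\<lambda>s. - \<Lambda> * (k s * g s))"
proof -
  let ?I = "integral {0..L}"
  have weak: "?I (\<lambda>s. g s * p2 s) = ?I (\<lambda>s. - \<Lambda> * (k s * g s) * p s)" if p: "c2_periodic L p p1 p2" for p p1 p2
  proof -
    note P = c2_periodicD[OF p]
    have cgA: "continuous_on {0..L} g" using cg continuous_on_subset by blast
    obtain m where m: "c2_periodic L (\<lambda>s. p s + m) p1 p2" "?I (\<lambda>s. k s * (p s + m)) = 0"
      by (rule subtract_weighted_mean[OF p])
    have "?I (\<lambda>s. k s * g s * (p s + m)) = ?I (\<lambda>s. k s * g s * p s + m * (k s * g s))"
      by (simp add: algebra_simps)
    also have "\<dots> = ?I (\<lambda>s. k s * g s * p s) + ?I (\<lambda>s. m * (k s * g s))"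
      by (intro integral_add integrable_continuous_real continuous_intros P cgA continuous_weight)
    finally have e: "?I (\<lambda>s. k s * g s * (p s + m)) = ?I (\<lambda>s. k s * g s * p s)" using gz by simp
    have "?I (\<lambda>s. - \<Lambda> * (k s * g s) * p s) = - \<Lambda> * ?I (\<lambda>s. k s * g s * p s)"
      unfolding mult.assoc by (rule integral_mult_right)
    then show ?thesis using weak0[OF m] e by simp
  qed
  have "continuous_on UNIV (\<lambda>s. - \<Lambda> * (k s * g s))" by (intro continuous_intros ck cg)
  moreover have "?I (\<lambda>s. - \<Lambda> * (k s * g s)) = 0" using gz by simp
  moreover have "- \<Lambda> * (k (s + L) * g (s + L)) = - \<Lambda> * (k s * g s)" for s using pk pg by simp
  ultimately obtain g1 where "c2_periodic L g g1 (\<lambda>s. - \<Lambda> * (k s * g s))"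
    by (rule_tac weak_second_derivative[OF cg pg _ _ L _ weak])
  then show thesis by (rule that)
qed

text \<open>Stated for an arbitrary minimiser: the components of the tangent vector of a curve are to be compared
  with the infimum, not with the minimiser constructed below.\<close>

lemma minimiser_satisfies_ode:
  assumes min: "weighted_poincare L k \<Lambda>"
    and f: "c2_periodic L f f1 f2" "integral {0..L} (\<lambda>s. k s * f s) = 0"
    and eq: "\<Lambda> * integral {0..L} (\<lambda>s. k s * (f s)\<^sup>2) = integral {0..L} (\<lambda>s. (f1 s)\<^sup>2)"
  shows "f2 s = - \<Lambda> * (k s * f s)"
proof -
  note F = c2_periodicD[OF f(1)]
  have "integral {0..L} (\<lambda>s. f s * p2 s) = - \<Lambda> * integral {0..L} (\<lambda>s. k s * f s * p s)"
    if p: "c2_periodic L p p1 p2" "integral {0..L} (\<lambda>s. k s * p s) = 0" for p p1 p2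
    using weighted_poincare_imp_cauchy_schwarz[OF min f p] c2_periodic_by_parts[OF f(1) p(1)] L by (simp add: eq)
  then obtain g1 where g1: "c2_periodic L f g1 (\<lambda>s. - \<Lambda> * (k s * f s))"
    by (rule weak_eigenfunction_regular[OF F(3) F(6) f(2)])
  have "g1 = f1" using DERIV_unique[OF c2_periodicD(1)[OF g1] F(1)] by blast
  then show ?thesis using DERIV_unique[OF F(2) c2_periodicD(2)[OF g1, of s, unfolded \<open>g1 = f1\<close>]] by simp
qed

text \<open>The direct method. A minimising sequence converges uniformly, but its derivatives need not
  converge. The limit \<open>g\<close> satisfies the Euler-Lagrange equation in the very weak sense, where both
  derivatives fall on the test function, and is then regular by \<open>weak_second_derivative\<close>.\<close>

theorem periodic_sturm_liouville_minimiser: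
  obtains \<Lambda> g g1 where "\<Lambda> > 0" "c2_periodic L g g1 (\<lambda>s. - \<Lambda> * (k s * g s))"
    "integral {0..L} (\<lambda>s. k s * (g s)\<^sup>2) = 1"
    "weighted_poincare L k \<Lambda>"
proof -
  let ?I = "integral {0..L}"
  define A where "A = {?I (\<lambda>s. (f1 s)\<^sup>2) | f f1 f2. c2_periodic L f f1 f2 \<and> ?I (\<lambda>s. k s * f s) = 0
     \<and> ?I (\<lambda>s. k s * (f s)\<^sup>2) = 1}"
  define \<Lambda> where "\<Lambda> = Inf A"
  have E_nonneg: "?I (\<lambda>s. (f1 s)\<^sup>2) \<ge> 0" if "c2_periodic L f f1 f2" for f f1 f2
    by (intro integral_nonneg integrable_continuous_real continuous_intros c2_periodicD[OF that]) simp
  have A_mem: "?I (\<lambda>s. (f1 s)\<^sup>2) \<in> A" if "c2_periodic L f f1 f2" "?I (\<lambda>s. k s * f s) = 0"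
    "?I (\<lambda>s. k s * (f s)\<^sup>2) = 1" for f f1 f2
    using that unfolding A_def by blast
  have A_ne: "A \<noteq> {}"
  proof -
    obtain f f1 f2 where "c2_periodic L f f1 f2" "?I (\<lambda>s. k s * f s) = 0" "?I (\<lambda>s. k s * (f s)\<^sup>2) = 1"
      by (rule admissible_exists)
    then have "?I (\<lambda>s. (f1 s)\<^sup>2) \<in> A" by (rule A_mem)
    then show ?thesis by blast
  qed
  have A0: "a \<ge> 0" if "a \<in> A" for a
    using that unfolding A_def by (auto intro: E_nonneg)
  then have bdd: "bdd_below A" by (rule bdd_belowI)
  have L0: "\<Lambda> \<ge> 0" unfolding \<Lambda>_def using A_ne A0 by (rule cInf_greatest)
  have min: "weighted_poincare L k \<Lambda>"
    unfolding weighted_poincare_def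
  proof (intro allI impI)
    fix f f1 f2 assume f: "c2_periodic L f f1 f2" and z: "?I (\<lambda>s. k s * f s) = 0"
    show "\<Lambda> * ?I (\<lambda>s. k s * (f s)\<^sup>2) \<le> ?I (\<lambda>s. (f1 s)\<^sup>2)"
    proof (cases "?I (\<lambda>s. k s * (f s)\<^sup>2) > 0")
      case True
      obtain c where c: "c2_periodic L (\<lambda>s. c * f s) (\<lambda>s. c * f1 s) (\<lambda>s. c * f2 s)"
        "?I (\<lambda>s. k s * (c * f s)) = 0" "?I (\<lambda>s. k s * (c * f s)\<^sup>2) = 1" "c\<^sup>2 * ?I (\<lambda>s. k s * (f s)\<^sup>2) = 1"
        using admissible_normalise[OF f z True] by blast
      have "?I (\<lambda>s. (c * f1 s)\<^sup>2) \<in> A" by (rule A_mem[OF c(1-3)])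
      then have "\<Lambda> \<le> ?I (\<lambda>s. (c * f1 s)\<^sup>2)" unfolding \<Lambda>_def using bdd by (rule cInf_lower)
      then have "\<Lambda> \<le> c\<^sup>2 * ?I (\<lambda>s. (f1 s)\<^sup>2)" by (simp add: power_mult_distrib)
      then have "\<Lambda> * ?I (\<lambda>s. k s * (f s)\<^sup>2) \<le> c\<^sup>2 * ?I (\<lambda>s. (f1 s)\<^sup>2) * ?I (\<lambda>s. k s * (f s)\<^sup>2)"
        using True by (intro mult_right_mono) auto
      also have "\<dots> = ?I (\<lambda>s. (f1 s)\<^sup>2) * (c\<^sup>2 * ?I (\<lambda>s. k s * (f s)\<^sup>2))" by simp
      finally show ?thesis using c(4) by simp
    next
      case False
      then have "\<Lambda> * ?I (\<lambda>s. k s * (f s)\<^sup>2) \<le> 0" using L0 by (simp add: mult_nonneg_nonpos)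
      then show ?thesis using E_nonneg[OF f] by simp
    qed
  qed
  have "\<forall>n. \<exists>f f1 f2. c2_periodic L f f1 f2 \<and> ?I (\<lambda>s. k s * f s) = 0 \<and> ?I (\<lambda>s. k s * (f s)\<^sup>2) = 1
      \<and> ?I (\<lambda>s. (f1 s)\<^sup>2) < \<Lambda> + inverse (real (Suc n))"
  proof
    fix n
    have "Inf A < \<Lambda> + inverse (real (Suc n))" by (simp add: \<Lambda>_def)
    from cInf_lessD[OF A_ne this] show "\<exists>f f1 f2. c2_periodic L f f1 f2 \<and> ?I (\<lambda>s. k s * f s) = 0
      \<and> ?I (\<lambda>s. k s * (f s)\<^sup>2) = 1 \<and> ?I (\<lambda>s. (f1 s)\<^sup>2) < \<Lambda> + inverse (real (Suc n))"
      unfolding A_def by blast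
  qed
  then obtain f f1 f2 where f: "\<And>n. c2_periodic L (f n) (f1 n) (f2 n)"
    and fz: "\<And>n. ?I (\<lambda>s. k s * f n s) = 0" and fn: "\<And>n. ?I (\<lambda>s. k s * (f n s)\<^sup>2) = 1"
    and fE: "\<And>n. ?I (\<lambda>s. (f1 n s)\<^sup>2) < \<Lambda> + inverse (real (Suc n))"
    unfolding choice_iff by blast
  note F = c2_periodicD[OF f]
  have "?I (\<lambda>s. (f1 n s)\<^sup>2) \<le> \<Lambda> + 1" for n
    using fE[of n] by (rule order_trans[OF less_imp_le]) (simp add: inverse_eq_divide)
  then obtain g r where r: "strict_mono r"
    and ul: "uniform_limit UNIV (\<lambda>n. f (r n)) g sequentially"
    and cg: "continuous_on UNIV g" and pg: "\<And>s. g (s + L) = g s"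
    by (rule c2_periodic_compactness[where f = f and ?f1.0 = f1 and ?f2.0 = f2, OF f fz]) (rule that)
  have ul': "uniform_limit {0..L} (\<lambda>n. f (r n)) g sequentially"
    using uniform_limit_on_subset[OF ul] by simp
  have cgA: "continuous_on {0..L} g" using cg continuous_on_subset by blast
  have bddc: "bounded (h ` {0..L})" if "continuous_on {0..L} h" for h :: "real \<Rightarrow> real"
    using compact_continuous_image[OF that compact_Icc] compact_imp_bounded by blast
  have lim: "(\<lambda>n. ?I (\<lambda>s. h s * f (r n) s)) \<longlonglongrightarrow> ?I (\<lambda>s. h s * g s)" if ch: "continuous_on {0..L} h" for h
    by (intro uniform_limit_integral_tendsto uniform_lim_mult uniform_limit_const ul' bddc ch cgA continuous_intros F)
  have "(\<lambda>n. ?I (\<lambda>s. k s * (f (r n) s * f (r n) s))) \<longlonglongrightarrow> ?I (\<lambda>s. k s * (g s * g s))"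
    by (intro uniform_limit_integral_tendsto uniform_lim_mult uniform_limit_const ul' bddc continuous_weight cgA continuous_intros F)
  then have gn: "?I (\<lambda>s. k s * (g s)\<^sup>2) = 1"
    using fn LIMSEQ_unique[OF _ tendsto_const] by (auto simp: power2_eq_square)
  have gz: "?I (\<lambda>s. k s * g s) = 0"
    using lim[OF continuous_weight] fz LIMSEQ_unique[OF _ tendsto_const] by auto
  \<comment> \<open>the quadratic form is nonnegative and tends to zero along the sequence, hence so does its polarisation\<close>
  have weak: "?I (\<lambda>s. g s * p2 s) = - \<Lambda> * ?I (\<lambda>s. k s * g s * p s)"
    if p: "c2_periodic L p p1 p2" and pz: "?I (\<lambda>s. k s * p s) = 0" for p p1 p2
  proof -
    note P = c2_periodicD[OF p]
    define Q where "Q = ?I (\<lambda>s. (p1 s)\<^sup>2) - \<Lambda> * ?I (\<lambda>s. k s * (p s)\<^sup>2)"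
    define B where "B = (\<lambda>n. ?I (\<lambda>s. f1 n s * p1 s) - \<Lambda> * ?I (\<lambda>s. k s * f n s * p s))"
    have Q0: "Q \<ge> 0" using weighted_poincareD[OF min p pz] by (simp add: Q_def)
    have "(B n)\<^sup>2 \<le> inverse (real (Suc n)) * Q" for n
    proof -
      have "(B n)\<^sup>2 \<le> (?I (\<lambda>s. (f1 n s)\<^sup>2) - \<Lambda>) * Q"
        using weighted_poincare_imp_cauchy_schwarz[OF min f[of n] fz p pz] fn[of n] by (simp add: B_def Q_def)
      also have "\<dots> \<le> inverse (real (Suc n)) * Q" using fE[of n] Q0 by (intro mult_right_mono) auto
      finally show ?thesis .
    qed
    moreover have "(\<lambda>n. inverse (real (Suc n)) * Q) \<longlonglongrightarrow> 0"
      using tendsto_mult[OF LIMSEQ_inverse_real_of_nat tendsto_const, of Q] by simp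
    ultimately have "(\<lambda>n. (B n)\<^sup>2) \<longlonglongrightarrow> 0"
      by (rule_tac Lim_null_comparison[OF always_eventually]) auto
    then have "(\<lambda>n. sqrt ((B n)\<^sup>2)) \<longlonglongrightarrow> sqrt 0" by (rule tendsto_real_sqrt)
    then have "B \<longlonglongrightarrow> 0" by (simp add: tendsto_rabs_zero_iff)
    then have B0: "(\<lambda>n. B (r n)) \<longlonglongrightarrow> 0" using LIMSEQ_subseq_LIMSEQ[OF _ r] by (simp add: o_def)
    have "B n = - ?I (\<lambda>s. p2 s * f n s) - \<Lambda> * ?I (\<lambda>s. k s * p s * f n s)" for n
      using c2_periodic_by_parts[OF f p] L by (simp add: B_def mult_ac)
    then have "(\<lambda>n. B (r n)) \<longlonglongrightarrow> - ?I (\<lambda>s. p2 s * g s) - \<Lambda> * ?I (\<lambda>s. k s * p s * g s)"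
      by (simp only:) (intro tendsto_intros lim continuous_intros P continuous_weight)
    from LIMSEQ_unique[OF B0 this] show ?thesis by (simp add: mult_ac)
  qed
  obtain g1 where g1: "c2_periodic L g g1 (\<lambda>s. - \<Lambda> * (k s * g s))"
    by (rule weak_eigenfunction_regular[OF cg pg gz weak])
  note G = c2_periodicD[OF g1]
  \<comment> \<open>for \<open>\<Lambda> = 0\<close> the minimiser would be constant, hence zero because its weighted mean vanishes\<close>
  have "\<Lambda> \<noteq> 0"
  proof
    assume "\<Lambda> = 0"
    then have "?I (\<lambda>s. g1 s * g1 s) = 0" using c2_periodic_by_parts[OF g1 g1] L by simp
    moreover have "continuous_on {0..L} (\<lambda>s. g1 s * g1 s)" by (intro continuous_intros G)
    ultimately have "\<forall>s\<in>{0..L}. g1 s * g1 s = 0"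
      using integral_eq_0_iff[of 0 L "\<lambda>s. g1 s * g1 s"] L zero_le_square by blast
    then have g10: "g1 s = 0" if "0 \<le> s" "s \<le> L" for s using that by auto
    have gc: "g s = g 0" if s: "s \<in> {0..L}" for s
    proof (cases "s = 0")
      case False
      show ?thesis
        by (rule DERIV_isconst2[of 0 s]) (use False s G(1) g10 cg in \<open>auto intro: continuous_on_subset\<close>, metis G(1) g10 less_imp_le order_trans)
    qed simp
    have "?I (\<lambda>s. k s * g s) = ?I (\<lambda>s. k s * g 0)" by (rule integral_cong) (simp only: gc)
    then have "g 0 = 0" using gz weight_integral_pos by simp
    then have "g s = 0" if "s \<in> {0..L}" for s using gc[OF that] by (rule trans[rotated])
    then have "?I (\<lambda>s. k s * (g s)\<^sup>2) = ?I (\<lambda>s. 0)" by (intro integral_cong) simp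
    then show False using gn by simp
  qed
  then show thesis using that[OF _ g1 gn min] L0 by simp
qed

end


section \<open>A resolvent bound for circles of arbitrary radius\<close>

text \<open>The substitution \<open>t = c (s - s0)\<close>, which turns \<open>a = A / c\<close> into \<open>A\<close>, followed by a shift of the
  period.\<close>

lemma circle_mode_gap_scaled:
  fixes c A s0 :: real
  assumes f: "c2_periodic L f f1 f2" and c: "c > 0" and L: "L = 2 * pi / c"
  shows "c\<^sup>2 * integral {0..L} (\<lambda>s. (f1 s - A * sin (c * (s - s0)) * f s)\<^sup>2)
    \<le> integral {0..L} (\<lambda>s. (f2 s - (A\<^sup>2 * (sin (c * (s - s0)))\<^sup>2 + A * c * cos (c * (s - s0))) * f s)\<^sup>2)"
proof -
  note F = c2_periodicD[OF f]
  define v where "v = (\<lambda>s. (f1 s - A * sin (c * (s - s0)) * f s)\<^sup>2)"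
  define w where "w = (\<lambda>s. (f2 s - (A\<^sup>2 * (sin (c * (s - s0)))\<^sup>2 + A * c * cos (c * (s - s0))) * f s)\<^sup>2)"
  have Lpos: "L > 0" and cL: "c * L = 2 * pi" using c L by auto
  have trig: "sin (c * (s + L - s0)) = sin (c * (s - s0))" "cos (c * (s + L - s0)) = cos (c * (s - s0))" for s
  proof -
    have "c * (s + L - s0) = c * (s - s0) + 2 * pi" using cL by (simp add: algebra_simps)
    then show "sin (c * (s + L - s0)) = sin (c * (s - s0))" "cos (c * (s + L - s0)) = cos (c * (s - s0))"
      by simp_all
  qed
  have cv: "continuous_on UNIV v" and cw: "continuous_on UNIV w"
    unfolding v_def w_def by (intro continuous_intros F)+
  have pv: "v (s + L) = v s" and pw: "w (s + L) = w s" for s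
    unfolding v_def w_def trig F(6,7,8) by simp_all
  have shift: "integral {0..2*pi} (\<lambda>t. h (s0 + (1 / c) * t)) = c * integral {0..L} h"
    if ch: "continuous_on UNIV h" and ph: "\<And>s. h (s + L) = h s" for h
  proof -
    obtain Q where Q: "\<And>s. (Q has_real_derivative h s) (at s)" using continuous_antiderivative[OF ch] by blast
    have "(1 / c) * integral {0..2*pi} (\<lambda>t. h (s0 + (1 / c) * t)) = Q (s0 + (1 / c) * (2 * pi)) - Q s0"
      by (rule integral_affine[OF Q]) simp
    also have "\<dots> = Q (s0 + L) - Q s0" by (simp add: L)
    also have "\<dots> = integral {s0..s0 + L} h"
      using Q Lpos by (intro integral_of_derivative[symmetric]) (auto simp: has_real_derivative_iff_has_vector_derivative)
    also have "\<dots> = integral {0..L} h" using Lpos by (intro integral_periodic_shift[OF ch ph]) simp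
    finally show ?thesis using c by (simp add: field_simps)
  qed
  define G where "G = (\<lambda>t. f (s0 + (1 / c) * t))"
  define G1 where "G1 = (\<lambda>t. f1 (s0 + (1 / c) * t) / c)"
  define G2 where "G2 = (\<lambda>t. f2 (s0 + (1 / c) * t) / c\<^sup>2)"
  have d: "((\<lambda>t. s0 + (1 / c) * t) has_real_derivative 1 / c) (at t)" for t
    using c by (auto intro!: derivative_eq_intros)
  have dG: "(G has_real_derivative G1 t) (at t)" "(G1 has_real_derivative G2 t) (at t)" for t
    using DERIV_chain2[where f = f, OF F(1) d] DERIV_cdivide[OF DERIV_chain2[where f = f1, OF F(2) d], of c t] c
    unfolding G_def G1_def G2_def by (simp_all add: power2_eq_square)
  have cG2: "continuous_on UNIV G2" unfolding G2_def
    by (intro continuous_intros continuous_on_compose2[OF F(5)[of UNIV]]) (use c in auto)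
  have "s0 + (1 / c) * (2 * pi) = s0 + L" by (simp add: L)
  then have perG: "G (2 * pi) = G 0" "G1 (2 * pi) = G1 0" unfolding G_def G1_def using F(6,7)[of s0] by simp_all
  have gap: "integral {0..2 * pi} (\<lambda>t. (G1 t - (A / c) * sin t * G t)\<^sup>2)
     \<le> integral {0..2 * pi} (\<lambda>t. (G2 t - ((A / c)\<^sup>2 * (sin t)\<^sup>2 + (A / c) * cos t) * G t)\<^sup>2)"
    by (rule circle_mode_gap[OF dG cG2 perG])
  have "(\<lambda>t. (G1 t - (A / c) * sin t * G t)\<^sup>2) = (\<lambda>t. v (s0 + (1 / c) * t) / c\<^sup>2)"
  proof
    fix t
    have "G1 t - (A / c) * sin t * G t = (f1 (s0 + (1 / c) * t) - A * sin t * f (s0 + (1 / c) * t)) / c"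
      using c by (simp add: G_def G1_def field_simps)
    then show "(G1 t - (A / c) * sin t * G t)\<^sup>2 = v (s0 + (1 / c) * t) / c\<^sup>2"
      using c by (simp add: v_def power_divide)
  qed
  moreover have "(\<lambda>t. (G2 t - ((A / c)\<^sup>2 * (sin t)\<^sup>2 + (A / c) * cos t) * G t)\<^sup>2) = (\<lambda>t. w (s0 + (1 / c) * t) / c\<^sup>2 / c\<^sup>2)"
  proof
    fix t
    have "G2 t - ((A / c)\<^sup>2 * (sin t)\<^sup>2 + (A / c) * cos t) * G t
       = (f2 (s0 + (1 / c) * t) - (A\<^sup>2 * (sin t)\<^sup>2 + A * c * cos t) * f (s0 + (1 / c) * t)) / c\<^sup>2"
      using c by (simp add: G_def G2_def field_simps power2_eq_square)
    then show "(G2 t - ((A / c)\<^sup>2 * (sin t)\<^sup>2 + (A / c) * cos t) * G t)\<^sup>2 = w (s0 + (1 / c) * t) / c\<^sup>2 / c\<^sup>2"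
      using c by (simp add: w_def power_divide power2_eq_square)
  qed
  ultimately have "integral {0..2*pi} (\<lambda>t. v (s0 + (1 / c) * t)) / c\<^sup>2 \<le> integral {0..2*pi} (\<lambda>t. w (s0 + (1 / c) * t)) / c\<^sup>2 / c\<^sup>2"
    using gap by (simp only: integral_divide)
  then have "c * integral {0..L} v / c\<^sup>2 \<le> c * integral {0..L} w / c\<^sup>2 / c\<^sup>2"
    by (simp only: shift[OF cv pv] shift[OF cw pw])
  then have "c\<^sup>2 * integral {0..L} v \<le> integral {0..L} w" using c by (simp add: field_simps power2_eq_square)
  then show ?thesis by (simp add: v_def w_def)
qed

text \<open>Think of \<open>h = T f\<close> for a nonnegative operator \<open>T\<close> with \<open>\<parallel>T f\<parallel>\<^sup>2 \<ge> K \<langle>T f, f\<rangle>\<close>, i.e. without spectrum strictly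
  between \<open>0\<close> and \<open>K\<close>. Writing \<open>h = \<mu> f + e\<close>, the assumption becomes
  \<open>\<mu> (K - \<mu>) \<parallel>f\<parallel>\<^sup>2 \<le> (2\<mu> - K) \<langle>f, e\<rangle> + \<parallel>e\<parallel>\<^sup>2\<close>, and half of the left-hand side absorbs the mixed term.\<close>

lemma gap_imp_resolvent_bound:
  fixes f h :: "real \<Rightarrow> real"
  assumes cf: "continuous_on {0..L} f" and ch: "continuous_on {0..L} h" and K: "0 < \<mu>" "\<mu> < K"
    and gap: "K * integral {0..L} (\<lambda>s. f s * h s) \<le> integral {0..L} (\<lambda>s. (h s)\<^sup>2)"
  shows "integral {0..L} (\<lambda>s. (f s)\<^sup>2)
    \<le> ((K / (\<mu> * (K - \<mu>)))\<^sup>2 + 2 / (\<mu> * (K - \<mu>))) * integral {0..L} (\<lambda>s. (h s - \<mu> * f s)\<^sup>2)"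
proof -
  define a where "a = \<mu> * (K - \<mu>)"
  have a: "a > 0" using K by (simp add: a_def)
  let ?I = "integral {0..L}"
  have "?I (\<lambda>s. (h s)\<^sup>2 - K * (f s * h s)) = ?I (\<lambda>s. (h s)\<^sup>2) - ?I (\<lambda>s. K * (f s * h s))"
    by (intro integral_diff integrable_continuous_real continuous_intros cf ch)
  then have "0 \<le> ?I (\<lambda>s. (h s)\<^sup>2 - K * (f s * h s))" using gap by simp
  also have "\<dots> \<le> ?I (\<lambda>s. (K\<^sup>2 / (2 * a) + 1) * (h s - \<mu> * f s)\<^sup>2 - a / 2 * (f s)\<^sup>2)"
  proof (intro integral_le integrable_continuous_real continuous_intros cf ch)
    fix s
    define e where "e = h s - \<mu> * f s"
    have "(h s)\<^sup>2 - K * (f s * h s) = e\<^sup>2 + (2 * \<mu> - K) * (f s * e) - a * (f s)\<^sup>2"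
      by (simp add: e_def a_def power2_eq_square algebra_simps)
    moreover have "(2 * \<mu> - K) * (f s * e) \<le> K\<^sup>2 / (2 * a) * e\<^sup>2 + a / 2 * (f s)\<^sup>2"
    proof -
      have "(2 * \<mu> - K) * (f s * e) \<le> \<bar>2 * \<mu> - K\<bar> * \<bar>f s * e\<bar>" by (metis abs_ge_self abs_mult)
      also have "\<dots> \<le> K * \<bar>f s * e\<bar>" using K by (intro mult_right_mono) auto
      also have "\<dots> \<le> K\<^sup>2 / (2 * a) * e\<^sup>2 + a / 2 * (f s)\<^sup>2"
      proof -
        have "0 \<le> (K * \<bar>e\<bar> - a * \<bar>f s\<bar>)\<^sup>2 / (2 * a)" using a by simp
        also have "\<dots> = K\<^sup>2 / (2 * a) * e\<^sup>2 + a / 2 * (f s)\<^sup>2 - K * \<bar>f s * e\<bar>"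
          using a by (simp add: power2_eq_square abs_mult field_simps)
        finally show ?thesis by simp
      qed
      finally show ?thesis .
    qed
    ultimately show "(h s)\<^sup>2 - K * (f s * h s) \<le> (K\<^sup>2 / (2 * a) + 1) * (h s - \<mu> * f s)\<^sup>2 - a / 2 * (f s)\<^sup>2"
      unfolding e_def[symmetric] by (simp add: algebra_simps)
  qed
  also have "\<dots> = ?I (\<lambda>s. (K\<^sup>2 / (2 * a) + 1) * (h s - \<mu> * f s)\<^sup>2) - ?I (\<lambda>s. a / 2 * (f s)\<^sup>2)"
    by (intro integral_diff integrable_continuous_real continuous_intros cf ch)
  also have "\<dots> = (K\<^sup>2 / (2 * a) + 1) * ?I (\<lambda>s. (h s - \<mu> * f s)\<^sup>2) - a / 2 * ?I (\<lambda>s. (f s)\<^sup>2)" by simp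
  finally have "a / 2 * ?I (\<lambda>s. (f s)\<^sup>2) \<le> (K\<^sup>2 / (2 * a) + 1) * ?I (\<lambda>s. (h s - \<mu> * f s)\<^sup>2)" by simp
  then have "2 / a * (a / 2 * ?I (\<lambda>s. (f s)\<^sup>2)) \<le> 2 / a * ((K\<^sup>2 / (2 * a) + 1) * ?I (\<lambda>s. (h s - \<mu> * f s)\<^sup>2))"
    using a by (intro mult_left_mono) auto
  also have "2 / a * (a / 2 * ?I (\<lambda>s. (f s)\<^sup>2)) = ?I (\<lambda>s. (f s)\<^sup>2)" using a by simp
  also have "2 / a * ((K\<^sup>2 / (2 * a) + 1) * ?I (\<lambda>s. (h s - \<mu> * f s)\<^sup>2))
     = ((K / a)\<^sup>2 + 2 / a) * ?I (\<lambda>s. (h s - \<mu> * f s)\<^sup>2)"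
    using a by (simp add: power2_eq_square field_simps)
  finally show ?thesis by (simp add: a_def)
qed

text \<open>Here \<open>h = D* D f / (2c)\<close> is the Kohn Laplacian of a mode over a circle of curvature \<open>c\<close>. The constant
  depends neither on the mode, which enters through \<open>A\<close> and \<open>s0\<close>, nor on \<open>f\<close>.\<close>

lemma circle_mode_resolvent_bound:
  fixes c A s0 :: real
  assumes f: "c2_periodic L f f1 f2" and c: "c > 0" and L: "L = 2 * pi / c" and mu: "0 < \<mu>" "\<mu> < c / 2"
    and h: "\<And>s. h s = - (f2 s - (A\<^sup>2 * (sin (c * (s - s0)))\<^sup>2 + A * c * cos (c * (s - s0))) * f s) / (2 * c)"
  shows "integral {0..L} (\<lambda>s. (f s)\<^sup>2)
    \<le> ((c / 2 / (\<mu> * (c / 2 - \<mu>)))\<^sup>2 + 2 / (\<mu> * (c / 2 - \<mu>))) * integral {0..L} (\<lambda>s. (h s - \<mu> * f s)\<^sup>2)"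
proof (rule gap_imp_resolvent_bound[OF _ _ mu])
  note F = c2_periodicD[OF f]
  define w where "w = (\<lambda>s. f2 s - (A\<^sup>2 * (sin (c * (s - s0)))\<^sup>2 + A * c * cos (c * (s - s0))) * f s)"
  have hw: "h = (\<lambda>s. - w s / (2 * c))" by (rule ext) (simp add: h w_def)
  have cw: "continuous_on {0..L} w" unfolding w_def by (intro continuous_intros F)
  show "continuous_on {0..L} f" by (rule F)
  show "continuous_on {0..L} h" unfolding hw using c by (intro continuous_intros cw) auto
  let ?v = "\<lambda>s. (f1 s - A * sin (c * (s - s0)) * f s)\<^sup>2"
  have cL: "c * L = 2 * pi" and Lpos: "L > 0" using c L by auto
  have "((\<lambda>s. f s * f1 s - A * (sin (c * (s - s0)) * (f s)\<^sup>2)) has_real_derivative ?v s + f s * w s) (at s)" for s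
    unfolding w_def by (auto intro!: derivative_eq_intros F simp: power2_eq_square algebra_simps)
  then have "integral {0..L} (\<lambda>s. ?v s + f s * w s) =
    (f L * f1 L - A * (sin (c * (L - s0)) * (f L)\<^sup>2)) - (f 0 * f1 0 - A * (sin (c * (0 - s0)) * (f 0)\<^sup>2))"
    using Lpos by (intro integral_of_derivative) (auto simp: has_real_derivative_iff_has_vector_derivative)
  also have "\<dots> = 0"
  proof -
    have "c * (L - s0) = c * (0 - s0) + 2 * pi" using cL by (simp add: algebra_simps)
    then have "sin (c * (L - s0)) = sin (c * (0 - s0))" by simp
    then show ?thesis using F(6)[of 0] F(7)[of 0] by simp
  qed
  finally have "integral {0..L} ?v + integral {0..L} (\<lambda>s. f s * w s) = 0"
    by (subst (asm) integral_add) (auto intro!: integrable_continuous_real continuous_intros F cw)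
  then have "integral {0..L} ?v = - integral {0..L} (\<lambda>s. f s * w s)" by linarith
  then have "- integral {0..L} (\<lambda>s. f s * w s) * c\<^sup>2 = c\<^sup>2 * integral {0..L} ?v" by simp
  also have "\<dots> \<le> integral {0..L} (\<lambda>s. (w s)\<^sup>2)"
    unfolding w_def by (rule circle_mode_gap_scaled[OF f c L])
  finally have m: "- integral {0..L} (\<lambda>s. f s * w s) * c\<^sup>2 \<le> integral {0..L} (\<lambda>s. (w s)\<^sup>2)" .
  have "integral {0..L} (\<lambda>s. f s * h s) = integral {0..L} (\<lambda>s. (- 1 / (2 * c)) * (f s * w s))" by (simp add: hw)
  also have "\<dots> = - integral {0..L} (\<lambda>s. f s * w s) / (2 * c)" by (subst integral_mult_right) simp
  finally have 1: "integral {0..L} (\<lambda>s. f s * h s) = - integral {0..L} (\<lambda>s. f s * w s) / (2 * c)" .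
  have "integral {0..L} (\<lambda>s. (h s)\<^sup>2) = integral {0..L} (\<lambda>s. (1 / (4 * c\<^sup>2)) * (w s)\<^sup>2)"
    by (simp add: hw power_divide power_mult_distrib)
  also have "\<dots> = integral {0..L} (\<lambda>s. (w s)\<^sup>2) / (4 * c\<^sup>2)" by (subst integral_mult_right) simp
  finally have 2: "integral {0..L} (\<lambda>s. (h s)\<^sup>2) = integral {0..L} (\<lambda>s. (w s)\<^sup>2) / (4 * c\<^sup>2)" .
  show "c / 2 * integral {0..L} (\<lambda>s. f s * h s) \<le> integral {0..L} (\<lambda>s. (h s)\<^sup>2)"
    unfolding 1 2 using m c by (simp add: field_simps power2_eq_square)
qed


section \<open>Density of trigonometric polynomials\<close>

definition torus_char :: "real \<Rightarrow> int \<Rightarrow> int \<Rightarrow> int \<Rightarrow> coords \<Rightarrow> complex" where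
  "torus_char L k m n = (\<lambda>(s, x, y). cis (2 * pi / L * of_int k * s + of_int m * x + of_int n * y))"

inductive trig_poly :: "real \<Rightarrow> (coords \<Rightarrow> complex) \<Rightarrow> bool" for L where
  trig_poly_char: "trig_poly L (\<lambda>p. a * torus_char L k m n p)"
| trig_poly_add: "trig_poly L P \<Longrightarrow> trig_poly L Q \<Longrightarrow> trig_poly L (\<lambda>p. P p + Q p)"

lemma torus_char_mult:
  "torus_char L k m n p * torus_char L k' m' n' p = torus_char L (k + k') (m + m') (n + n') p"
  by (cases p) (simp add: torus_char_def cis_mult algebra_simps add_divide_distrib)

lemma trig_poly_mult:
  assumes "trig_poly L P" "trig_poly L Q"
  shows "trig_poly L (\<lambda>p. P p * Q p)"
  using assms
proof (induction P rule: trig_poly.induct)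
  case (trig_poly_char a k m n)
  then show ?case
  proof (induction Q rule: trig_poly.induct)
    case (trig_poly_char a' k' m' n')
    have "(\<lambda>p. a * torus_char L k m n p * (a' * torus_char L k' m' n' p))
       = (\<lambda>p. a * a' * torus_char L (k + k') (m + m') (n + n') p)"
      by (simp add: torus_char_mult[symmetric] mult_ac)
    then show ?case by (simp only: trig_poly.intros)
  next
    case (trig_poly_add P Q)
    then show ?case by (simp add: distrib_left trig_poly.trig_poly_add)
  qed
next
  case (trig_poly_add P Q')
  then show ?case by (simp add: distrib_right trig_poly.trig_poly_add)
qed

lemma trig_poly_const: "trig_poly L (\<lambda>p. a)"
proof -
  have "(\<lambda>p. a) = (\<lambda>p. a * torus_char L 0 0 0 p)" by (auto simp: torus_char_def)
  then show ?thesis by (simp only: trig_poly_char)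
qed

lemma trig_poly_cmult: "trig_poly L P \<Longrightarrow> trig_poly L (\<lambda>p. a * P p)"
  by (rule trig_poly_mult[OF trig_poly_const])

definition torus_embedding :: "real \<Rightarrow> coords \<Rightarrow> complex \<times> complex \<times> complex" where
  "torus_embedding L = (\<lambda>(s, x, y). (cis (2 * pi / L * s), cis x, cis y))"

lemma continuous_torus_embedding: "continuous_on A (torus_embedding L)"
  unfolding torus_embedding_def split_beta by (intro continuous_intros)

lemma trig_poly_Re_Im_char:
  "trig_poly L (\<lambda>p. complex_of_real (Re (torus_char L k m n p)))"
  "trig_poly L (\<lambda>p. complex_of_real (Im (torus_char L k m n p)))"
proof -
  have cnj: "cnj (torus_char L k m n p) = torus_char L (-k) (-m) (-n) p" for p
    by (cases p) (simp add: torus_char_def cis_cnj)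
  have "(\<lambda>p. complex_of_real (Re (torus_char L k m n p)))
      = (\<lambda>p. 1 / 2 * torus_char L k m n p + 1 / 2 * torus_char L (-k) (-m) (-n) p)"
    unfolding cnj[symmetric] by (rule ext) (simp add: complex_eq_iff)
  then show "trig_poly L (\<lambda>p. complex_of_real (Re (torus_char L k m n p)))"
    by (simp only: trig_poly.intros)
  have "(\<lambda>p. complex_of_real (Im (torus_char L k m n p)))
      = (\<lambda>p. (- \<i> / 2) * torus_char L k m n p + (\<i> / 2) * torus_char L (-k) (-m) (-n) p)"
    unfolding cnj[symmetric] by (rule ext) (simp add: complex_eq_iff)
  then show "trig_poly L (\<lambda>p. complex_of_real (Im (torus_char L k m n p)))"
    by (simp only: trig_poly.intros)
qed

lemma trig_poly_linear:
  fixes h :: "complex \<times> complex \<times> complex \<Rightarrow> real"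
  assumes "bounded_linear h"
  shows "trig_poly L (\<lambda>p. complex_of_real (h (torus_embedding L p)))"
proof -
  interpret h: bounded_linear h by fact
  have split: "h (u, v, w) = Re u * h (1, 0, 0) + Im u * h (\<i>, 0, 0) + Re v * h (0, 1, 0) + Im v * h (0, \<i>, 0)
      + Re w * h (0, 0, 1) + Im w * h (0, 0, \<i>)" for u v w
  proof -
    have "(u, v, w) = Re u *\<^sub>R (1, 0, 0) + Im u *\<^sub>R (\<i>, 0, 0) + Re v *\<^sub>R (0, 1, 0) + Im v *\<^sub>R (0, \<i>, 0)
      + Re w *\<^sub>R (0, 0, 1) + Im w *\<^sub>R (0, 0, \<i>)"
      by (simp add: complex_eq_iff scaleR_conv_of_real)
    then have "h (u, v, w) = h (Re u *\<^sub>R (1, 0, 0) + Im u *\<^sub>R (\<i>, 0, 0) + Re v *\<^sub>R (0, 1, 0) + Im v *\<^sub>R (0, \<i>, 0)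
      + Re w *\<^sub>R (0, 0, 1) + Im w *\<^sub>R (0, 0, \<i>))" by simp
    then show ?thesis by (simp only: h.add h.scaleR real_scaleR_def)
  qed
  have emb: "torus_embedding L p = (torus_char L 1 0 0 p, torus_char L 0 1 0 p, torus_char L 0 0 1 p)" for p
    by (cases p) (simp add: torus_embedding_def torus_char_def)
  have "(\<lambda>p. complex_of_real (h (torus_embedding L p))) =
    (\<lambda>p. complex_of_real (h (1, 0, 0)) * complex_of_real (Re (torus_char L 1 0 0 p))
       + complex_of_real (h (\<i>, 0, 0)) * complex_of_real (Im (torus_char L 1 0 0 p))
       + complex_of_real (h (0, 1, 0)) * complex_of_real (Re (torus_char L 0 1 0 p))
       + complex_of_real (h (0, \<i>, 0)) * complex_of_real (Im (torus_char L 0 1 0 p))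
       + complex_of_real (h (0, 0, 1)) * complex_of_real (Re (torus_char L 0 0 1 p))
       + complex_of_real (h (0, 0, \<i>)) * complex_of_real (Im (torus_char L 0 0 1 p)))"
    by (rule ext) (simp add: emb split[of "torus_char L 1 0 0 _"] mult.commute)
  moreover have "trig_poly L \<dots>"
    by (intro trig_poly_add trig_poly_cmult trig_poly_Re_Im_char)
  ultimately show ?thesis by simp
qed

lemma trig_poly_real_polynomial:
  "real_polynomial_function h \<Longrightarrow> trig_poly L (\<lambda>p. complex_of_real (h (torus_embedding L p)))"
proof (induction h rule: real_polynomial_function.induct)
  case (linear f) then show ?case by (rule trig_poly_linear)
next
  case (const c) then show ?case by (simp add: trig_poly_const)
next
  case (add f g) then show ?case by (simp add: trig_poly_add)
next
  case (mult f g) then show ?case by (simp add: trig_poly_mult)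
qed

lemma cis_eq_imp_diff:
  assumes "cis a = cis b" obtains j :: int where "a = b + 2 * pi * of_int j"
proof -
  have "exp (\<i> * of_real a) = exp (\<i> * of_real b)" using assms by (simp add: cis_conv_exp)
  then obtain j :: int where "\<i> * of_real a = \<i> * of_real b + of_int (2 * j) * pi * \<i>" unfolding exp_eq by blast
  then have "a = b + 2 * pi * of_int j" by (auto simp: complex_eq_iff)
  then show thesis by (rule that)
qed

text \<open>Periodic functions factor through the embedded torus.\<close>

lemma periodic_torus_embedding:
  assumes per: "periodic L U" and L: "L > 0" and eq: "torus_embedding L p = torus_embedding L q"
  shows "U p = U q"
proof -
  obtain s x y s' x' y' where p: "p = (s, x, y)" and q: "q = (s', x', y')" by (cases p, cases q) auto
  have e: "cis (2 * pi / L * s) = cis (2 * pi / L * s')" "cis x = cis x'" "cis y = cis y'"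
    using eq by (auto simp: torus_embedding_def p q)
  obtain i where i: "2 * pi / L * s = 2 * pi / L * s' + 2 * pi * of_int i" by (rule cis_eq_imp_diff[OF e(1)])
  obtain j where j: "x = x' + 2 * pi * of_int j" by (rule cis_eq_imp_diff[OF e(2)])
  obtain k where k: "y = y' + 2 * pi * of_int k" by (rule cis_eq_imp_diff[OF e(3)])
  have "2 * pi * (s / L) = 2 * pi * (s' / L + of_int i)" using i by (simp add: field_simps)
  then have "s / L = s' / L + of_int i" by (simp only: mult_cancel_left) simp
  then have i': "s = s' + of_int i * L" using L by (simp add: field_simps)
  have "U (s' + of_int i * L, x, y) = U (s', x, y)"
    by (rule periodic_int[of "\<lambda>s. U (s, x, y)"]) (use per in \<open>simp add: periodic_def\<close>)
  moreover have "U (s', x' + of_int j * (2 * pi), y) = U (s', x', y)"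
    by (rule periodic_int[of "\<lambda>x. U (s', x, y)"]) (use per in \<open>simp add: periodic_def\<close>)
  moreover have "U (s', x', y' + of_int k * (2 * pi)) = U (s', x', y')"
    by (rule periodic_int[of "\<lambda>y. U (s', x', y)"]) (use per in \<open>simp add: periodic_def\<close>)
  ultimately show ?thesis by (simp add: p q i' j k mult.commute)
qed

text \<open>Stone-Weierstrass on the compact image of the torus in \<open>\<complex>\<^sup>3\<close>: polynomials in the
  coordinates pull back to trigonometric polynomials.\<close>

theorem trig_poly_dense:
  assumes cU: "continuous_on UNIV U" and per: "periodic L U" and L: "L > 0" and e: "e > 0"
  obtains P where "trig_poly L P" "\<And>p. cmod (U p - P p) < e"
proof -
  define K :: "coords set" where "K = cbox (0, 0, 0) (L, 2 * pi, 2 * pi)"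
  define T where "T = range (torus_embedding L)"
  have TK: "T = torus_embedding L ` K"
  proof
    show "T \<subseteq> torus_embedding L ` K"
    proof
      fix t assume "t \<in> T"
      then obtain s x y where t: "t = torus_embedding L (s, x, y)" by (auto simp: T_def)
      have fl: "\<exists>b\<in>{0..R}. \<exists>j::int. a = b + R * of_int j" if "R > 0" for a R :: real
        using that floor_divide_lower[of R a] floor_divide_upper[of R a]
        by (intro bexI[of _ "a - R * of_int \<lfloor>a / R\<rfloor>"] exI[of _ "\<lfloor>a / R\<rfloor>"]) (auto simp: algebra_simps)
      have fl2: "\<exists>b\<in>{0..2*pi}. \<exists>j::int. a = b + 2 * pi * of_int j" for a by (rule fl) simp
      obtain s' i where s: "s' \<in> {0..L}" "s = s' + L * of_int (i::int)" using fl[OF L] by blast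
      obtain x' j where x: "x' \<in> {0..2*pi}" "x = x' + 2 * pi * of_int (j::int)" using fl2[of x] by blast
      obtain y' k where y: "y' \<in> {0..2*pi}" "y = y' + 2 * pi * of_int (k::int)" using fl2[of y] by blast
      have cp: "cis (a + 2 * pi * of_int (j::int)) = cis a" for a j
        by (simp add: cis_mult[symmetric])
      have "2 * pi / L * s = 2 * pi / L * s' + 2 * pi * of_int i" using L s by (simp add: field_simps)
      then have "t = torus_embedding L (s', x', y')"
        unfolding t torus_embedding_def x y by (simp only: prod.case cp)
      moreover have "(s', x', y') \<in> K" using s x y by (simp add: K_def)
      ultimately show "t \<in> torus_embedding L ` K" by blast
    qed
  qed (auto simp: T_def)
  have compT: "compact T" unfolding TK K_def by (intro compact_continuous_image continuous_torus_embedding compact_cbox)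
  define V where "V = (\<lambda>t. U (SOME p. torus_embedding L p = t))"
  have V: "V (torus_embedding L p) = U p" for p
    unfolding V_def by (rule periodic_torus_embedding[OF per L]) (rule someI[of _ p], rule refl)
  \<comment> \<open>the embedding restricted to a period box is a closed map, so \<open>V\<close> inherits continuity from \<open>U\<close>\<close>
  have "continuous_on T V"
    unfolding continuous_on_closed_vimage[OF compact_imp_closed[OF compT]]
  proof (intro allI impI)
    fix C :: "complex set" assume C: "closed C"
    have "V -` C \<inter> T = torus_embedding L ` (U -` C \<inter> K)" unfolding TK using V by auto
    moreover have "closed (U -` C \<inter> K)"
      using continuous_on_closed_vimage[of K U] cU C closed_cbox K_def continuous_on_subset by blast
    then have "compact (U -` C \<inter> K)" by (metis K_def closed_Int_compact compact_cbox inf.right_idem)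
    then have "compact (torus_embedding L ` (U -` C \<inter> K))"
      by (intro compact_continuous_image continuous_torus_embedding)
    ultimately show "closed (V -` C \<inter> T)" using compact_imp_closed by simp
  qed
  from Stone_Weierstrass_polynomial_function[OF compT this e]
  obtain g where g: "polynomial_function g" "\<And>x. x \<in> T \<Longrightarrow> norm (V x - g x) < e" by blast
  have "real_polynomial_function (Re \<circ> g)" "real_polynomial_function (Im \<circ> g)"
    using g(1) bounded_linear_Re bounded_linear_Im unfolding polynomial_function_def by blast+
  then have "trig_poly L (\<lambda>p. complex_of_real ((Re \<circ> g) (torus_embedding L p)))"
    "trig_poly L (\<lambda>p. complex_of_real ((Im \<circ> g) (torus_embedding L p)))"
    using trig_poly_real_polynomial by blast+
  then have "trig_poly L (\<lambda>p. complex_of_real ((Re \<circ> g) (torus_embedding L p)) + \<i> * complex_of_real ((Im \<circ> g) (torus_embedding L p)))"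
    by (intro trig_poly_add trig_poly_cmult)
  then have "trig_poly L (\<lambda>p. g (torus_embedding L p))" by (simp add: complex_eq[symmetric])
  moreover have "cmod (U p - g (torus_embedding L p)) < e" for p
    using g(2)[of "torus_embedding L p"] V by (simp add: T_def)
  ultimately show thesis by (rule that)
qed


section \<open>Fourier modes in the torus variables\<close>

lemma smooth_on_compose_linear:
  assumes l: "bounded_linear l" and h: "smooth_on UNIV h"
  shows "smooth_on UNIV (\<lambda>p. h (l p))"
proof (rule smooth_on_coinduct[where P = "\<lambda>f. \<exists>h. smooth_on UNIV h \<and> f = (\<lambda>p. h (l p))"])
  show "\<exists>h'. smooth_on UNIV h' \<and> (\<lambda>p. h (l p)) = (\<lambda>p. h' (l p))" using h by blast
next
  fix f assume "\<exists>h. smooth_on UNIV h \<and> f = (\<lambda>p. h (l p))"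
  then obtain h where h: "smooth_on UNIV h" and f: "f = (\<lambda>p. h (l p))" by blast
  have d: "(f has_derivative (\<lambda>v. frechet_derivative h (at (l p)) (l v))) (at p)" for p
    unfolding f by (rule has_derivative_compose[OF bounded_linear_imp_has_derivative[OF l] smooth_on_has_derivative[OF h]])
  have "frechet_derivative f (at p) v = frechet_derivative h (at (l p)) (l v)" for p v
    by (simp add: frechet_derivative_at[OF d, symmetric])
  then show "(\<forall>x\<in>UNIV. f differentiable (at x)) \<and>
     (\<forall>v. \<exists>h. smooth_on UNIV h \<and> (\<lambda>x. frechet_derivative f (at x) v) = (\<lambda>p. h (l p)))"
  proof (intro conjI allI ballI)
    show "f differentiable (at p)" for p using d unfolding differentiable_def by blast
    show "\<exists>h. smooth_on UNIV h \<and> (\<lambda>x. frechet_derivative f (at x) v) = (\<lambda>p. h (l p))" for v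
      by (rule exI[of _ "\<lambda>x. frechet_derivative h (at x) (l v)"])
         (simp add: smooth_on_frechet[OF h] \<open>\<And>p v. frechet_derivative f (at p) v = _\<close>)
  qed
qed

lemma smooth_on_cis: "smooth_on UNIV cis"
proof (rule smooth_on_coinduct[where P = "\<lambda>f. \<exists>a. f = (\<lambda>t. a * cis t)"])
  show "\<exists>a. cis = (\<lambda>t. a * cis t)" by (rule exI[of _ 1]) simp
next
  fix f :: "real \<Rightarrow> complex" assume "\<exists>a. f = (\<lambda>t. a * cis t)"
  then obtain a where f: "f = (\<lambda>t. a * cis t)" by blast
  have d: "(f has_vector_derivative a * (\<i> * cis t)) (at t)" for t
    unfolding f
    by (intro has_vector_derivative_mult_right) (auto simp: has_vector_derivative_def intro!: derivative_eq_intros simp: scaleR_conv_of_real mult_ac)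
  have e: "frechet_derivative f (at t) v = (of_real v * a * \<i>) * cis t" for t v
    by (simp add: frechet_derivative_vector[OF d] scaleR_conv_of_real mult_ac)
  show "(\<forall>x\<in>UNIV. f differentiable (at x)) \<and> (\<forall>v. \<exists>a. (\<lambda>x. frechet_derivative f (at x) v) = (\<lambda>t. a * cis t))"
    using d unfolding e has_vector_derivative_def differentiable_def by blast
qed

definition fourier_char :: "int \<Rightarrow> int \<Rightarrow> real \<times> real \<Rightarrow> complex" where
  "fourier_char m n = (\<lambda>(x, y). cis (of_int m * x + of_int n * y))"

abbreviation torus :: "(real \<times> real) set" where
  "torus \<equiv> cbox (0, 0) (2 * pi, 2 * pi)"

definition fourier_mode :: "int \<Rightarrow> int \<Rightarrow> (coords \<Rightarrow> complex) \<Rightarrow> real \<Rightarrow> complex" where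
  "fourier_mode m n U s = integral torus (\<lambda>t. U (s, t) * cnj (fourier_char m n t))"

lemma continuous_fourier_char: "continuous_on A (fourier_char m n)"
  unfolding fourier_char_def split_beta by (intro continuous_intros)

lemma smooth_on_partial:
  assumes U: "smooth_on UNIV U" and l: "(l has_derivative (\<lambda>h. h *\<^sub>R v)) (at r)"
  shows "((\<lambda>r. U (l r)) has_vector_derivative frechet_derivative U (at (l r)) v) (at r)"
proof -
  have "frechet_derivative U (at (l r)) (h *\<^sub>R v) = h *\<^sub>R frechet_derivative U (at (l r)) v" for h
    by (rule linear_cmul[OF linear_frechet_derivative[OF smooth_on_differentiable[OF U]]])
  then show ?thesis unfolding has_vector_derivative_def
    by (intro has_derivative_eq_rhs[OF has_derivative_compose[OF l smooth_on_has_derivative[OF U]]] ext)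
qed

lemma smooth_partials:
  assumes U: "smooth_on UNIV (U :: coords \<Rightarrow> complex)"
  shows smooth_partial_s: "((\<lambda>s. U (s, t)) has_vector_derivative frechet_derivative U (at (s, t)) (1, 0)) (at s)"
    and smooth_partial_x: "((\<lambda>x. U (s, x, y)) has_vector_derivative frechet_derivative U (at (s, x, y)) (0, 1, 0)) (at x)"
    and smooth_partial_y: "((\<lambda>y. U (s, x, y)) has_vector_derivative frechet_derivative U (at (s, x, y)) (0, 0, 1)) (at y)"
  by (rule smooth_on_partial[OF U], auto intro!: derivative_eq_intros simp: zero_prod_def)+

lemma fourier_mode_derivative:
  assumes U: "smooth_on UNIV U"
  shows "(fourier_mode m n U has_vector_derivative
     fourier_mode m n (\<lambda>p. frechet_derivative U (at p) (1, 0, 0)) s) (at s)"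
  unfolding fourier_mode_def
proof (rule leibniz_rule_vector_derivative[where U = UNIV, simplified])
  let ?U' = "\<lambda>p. frechet_derivative U (at p) (1, 0, 0)"
  have c: "continuous_on UNIV U" "continuous_on UNIV ?U'"
    using smooth_on_continuous[OF U] smooth_on_continuous[OF smooth_on_frechet[OF U]] by blast+
  show "((\<lambda>s. U (s, t) * cnj (fourier_char m n t)) has_vector_derivative
      ?U' (s, t) * cnj (fourier_char m n t)) (at s)" for s t
    using has_vector_derivative_mult_left[OF smooth_partial_s[OF U, of t s]] by (simp add: zero_prod_def)
  show "(\<lambda>t. U (s, t) * cnj (fourier_char m n t)) integrable_on torus" for s
    by (intro integrable_continuous continuous_intros continuous_fourier_char continuous_on_compose2[OF c(1)]) auto
  show "continuous_on (UNIV \<times> torus) (\<lambda>(s, t). ?U' (s, t) * cnj (fourier_char m n t))"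
    unfolding split_beta
    by (intro continuous_intros continuous_on_compose2[OF continuous_fourier_char[of UNIV]] continuous_on_compose2[OF c(2)]) auto
qed

lemma smooth_fourier_mode:
  assumes U: "smooth_on UNIV U"
  shows "smooth_on UNIV (fourier_mode m n U)"
proof (rule smooth_on_coinduct[where P = "\<lambda>f. \<exists>U. smooth_on UNIV U \<and> f = fourier_mode m n U"])
  show "\<exists>V. smooth_on UNIV V \<and> fourier_mode m n U = fourier_mode m n V" using U by blast
next
  fix f assume "\<exists>U. smooth_on UNIV U \<and> f = fourier_mode m n U"
  then obtain U where U: "smooth_on UNIV U" and f: "f = fourier_mode m n U" by blast
  note d = fourier_mode_derivative[OF U, of m n, folded f]
  have "frechet_derivative f (at s) v = fourier_mode m n (\<lambda>p. of_real v * frechet_derivative U (at p) (1, 0, 0)) s" for s v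
    by (simp add: frechet_derivative_vector[OF d] fourier_mode_def scaleR_conv_of_real mult.assoc)
  moreover have "smooth_on UNIV (\<lambda>p. of_real v * frechet_derivative U (at p) (1, 0, 0))" for v
    by (intro smooth_on_mult smooth_on_const smooth_on_frechet[OF U])
  ultimately show "(\<forall>x\<in>UNIV. f differentiable (at x)) \<and>
     (\<forall>v. \<exists>U. smooth_on UNIV U \<and> (\<lambda>x. frechet_derivative f (at x) v) = fourier_mode m n U)"
    using d unfolding has_vector_derivative_def differentiable_def by blast
qed

lemma integral_torus_dx:
  fixes G Gx :: "real \<times> real \<Rightarrow> complex"
  assumes d: "\<And>x y. ((\<lambda>x. G (x, y)) has_vector_derivative Gx (x, y)) (at x)"
    and c: "continuous_on UNIV Gx" and p: "\<And>y. G (2 * pi, y) = G (0, y)"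
  shows "integral torus Gx = 0"
proof -
  have c': "continuous_on A Gx" for A using c continuous_on_subset by blast
  have "integral torus Gx = integral (cbox 0 (2*pi)) (\<lambda>x. integral (cbox 0 (2*pi)) (\<lambda>y. Gx (x, y)))"
    by (rule integral_prod_continuous[OF c'])
  also have "\<dots> = integral (cbox 0 (2*pi)) (\<lambda>y. integral (cbox 0 (2*pi)) (\<lambda>x. Gx (x, y)))"
    by (rule integral_swap_continuous) (simp add: c' split_def)
  also have "(\<lambda>y. integral (cbox 0 (2*pi)) (\<lambda>x. Gx (x, y))) = (\<lambda>y. 0)"
  proof
    fix y
    have "integral {0..2*pi} (\<lambda>x. Gx (x, y)) = G (2 * pi, y) - G (0, y)"
      by (rule integral_of_derivative) (simp_all add: d)
    then show "integral (cbox 0 (2*pi)) (\<lambda>x. Gx (x, y)) = 0" using p by simp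
  qed
  finally show ?thesis by simp
qed

lemma integral_torus_dy:
  fixes G Gy :: "real \<times> real \<Rightarrow> complex"
  assumes d: "\<And>x y. ((\<lambda>y. G (x, y)) has_vector_derivative Gy (x, y)) (at y)"
    and c: "continuous_on UNIV Gy" and p: "\<And>x. G (x, 2 * pi) = G (x, 0)"
  shows "integral torus Gy = 0"
proof -
  have c': "continuous_on A Gy" for A using c continuous_on_subset by blast
  have "integral torus Gy = integral (cbox 0 (2*pi)) (\<lambda>x. integral (cbox 0 (2*pi)) (\<lambda>y. Gy (x, y)))"
    by (rule integral_prod_continuous[OF c'])
  also have "(\<lambda>x. integral (cbox 0 (2*pi)) (\<lambda>y. Gy (x, y))) = (\<lambda>x. 0)"
  proof
    fix x
    have "integral {0..2*pi} (\<lambda>y. Gy (x, y)) = G (x, 2 * pi) - G (x, 0)"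
      by (rule integral_of_derivative) (simp_all add: d)
    then show "integral (cbox 0 (2*pi)) (\<lambda>y. Gy (x, y)) = 0" using p by simp
  qed
  finally show ?thesis by simp
qed

lemma fourier_char_derivative:
  "((\<lambda>x. cnj (fourier_char m n (x, y))) has_vector_derivative - \<i> * of_int m * cnj (fourier_char m n (x, y))) (at x)"
  "((\<lambda>y. cnj (fourier_char m n (x, y))) has_vector_derivative - \<i> * of_int n * cnj (fourier_char m n (x, y))) (at y)"
  unfolding fourier_char_def prod.case cis_cnj has_vector_derivative_def
  by (auto intro!: derivative_eq_intros simp: scaleR_conv_of_real mult_ac)

lemma fourier_char_periodic:
  "fourier_char m n (x + 2 * pi, y) = fourier_char m n (x, y)"
  "fourier_char m n (x, y + 2 * pi) = fourier_char m n (x, y)"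
proof -
  have e: "of_int m * (x + 2 * pi) + of_int n * y = (of_int m * x + of_int n * y) + 2 * pi * of_int m"
    "of_int m * x + of_int n * (y + 2 * pi) = (of_int m * x + of_int n * y) + 2 * pi * of_int n"
    by (simp_all add: algebra_simps)
  have cp: "cis (a + 2 * pi * of_int (j::int)) = cis a" for a j by (simp add: cis_mult[symmetric])
  show "fourier_char m n (x + 2 * pi, y) = fourier_char m n (x, y)"
    "fourier_char m n (x, y + 2 * pi) = fourier_char m n (x, y)"
    unfolding fourier_char_def prod.case e cp by (rule refl)+
qed

text \<open>Integration by parts in the angular variables; the boundary terms cancel by periodicity.\<close>

lemma fourier_mode_angular_derivatives:
  assumes U: "U \<in> smooth_functions L"
  shows "fourier_mode m n (\<lambda>p. frechet_derivative U (at p) (0, 1, 0)) s = \<i> * of_int m * fourier_mode m n U s"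
    and "fourier_mode m n (\<lambda>p. frechet_derivative U (at p) (0, 0, 1)) s = \<i> * of_int n * fourier_mode m n U s"
proof -
  have sU: "smooth_on UNIV U" and pU: "periodic L U" using U by (auto simp: smooth_functions_def)
  have c: "continuous_on UNIV U" "\<And>v. continuous_on UNIV (\<lambda>p. frechet_derivative U (at p) v)"
    using smooth_on_continuous[OF sU] smooth_on_continuous[OF smooth_on_frechet[OF sU]] by blast+
  have cs: "continuous_on A (\<lambda>t. U (s, t))" "continuous_on A (\<lambda>t. frechet_derivative U (at (s, t)) v)" for A v
    by (rule continuous_on_compose2[OF c(1)] continuous_on_compose2[OF c(2)[of v]], auto intro!: continuous_intros)+
  let ?e = "\<lambda>t. cnj (fourier_char m n t)"
  have p0: "U (s, 2 * pi, y) = U (s, 0, y)" "U (s, x, 2 * pi) = U (s, x, 0)"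
    "fourier_char m n (2 * pi, y) = fourier_char m n (0, y)" "fourier_char m n (x, 2 * pi) = fourier_char m n (x, 0)" for x y
    using pU fourier_char_periodic[of m n 0 y] fourier_char_periodic[of m n x 0] unfolding periodic_def
    by (metis add_0)+
  note ci = continuous_intros cs continuous_fourier_char
  have "integral torus (\<lambda>t. frechet_derivative U (at (s, t)) (0, 1, 0) * ?e t + U (s, t) * (- \<i> * of_int m * ?e t)) = 0"
  proof (rule integral_torus_dx[where G = "\<lambda>t. U (s, t) * ?e t"])
    show "((\<lambda>x. U (s, x, y) * ?e (x, y)) has_vector_derivative
       frechet_derivative U (at (s, x, y)) (0, 1, 0) * ?e (x, y) + U (s, x, y) * (- \<i> * of_int m * ?e (x, y))) (at x)" for x y
      using has_vector_derivative_mult[OF smooth_partial_x[OF sU, of s y x] fourier_char_derivative(1)[of m n y x]]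
      by (simp add: add.commute)
  qed (intro ci, simp add: p0)
  also have "integral torus (\<lambda>t. frechet_derivative U (at (s, t)) (0, 1, 0) * ?e t + U (s, t) * (- \<i> * of_int m * ?e t))
     = integral torus (\<lambda>t. frechet_derivative U (at (s, t)) (0, 1, 0) * ?e t) + integral torus (\<lambda>t. (- \<i> * of_int m) * (U (s, t) * ?e t))"
    by (subst integral_add[symmetric]) (auto intro!: integrable_continuous ci simp: mult_ac)
  finally show "fourier_mode m n (\<lambda>p. frechet_derivative U (at p) (0, 1, 0)) s = \<i> * of_int m * fourier_mode m n U s"
    unfolding fourier_mode_def integral_mult_right by (simp add: eq_neg_iff_add_eq_0[symmetric] add_eq_0_iff2)
  have "integral torus (\<lambda>t. frechet_derivative U (at (s, t)) (0, 0, 1) * ?e t + U (s, t) * (- \<i> * of_int n * ?e t)) = 0"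
  proof (rule integral_torus_dy[where G = "\<lambda>t. U (s, t) * ?e t"])
    show "((\<lambda>y. U (s, x, y) * ?e (x, y)) has_vector_derivative
       frechet_derivative U (at (s, x, y)) (0, 0, 1) * ?e (x, y) + U (s, x, y) * (- \<i> * of_int n * ?e (x, y))) (at y)" for x y
      using has_vector_derivative_mult[OF smooth_partial_y[OF sU, of s x y] fourier_char_derivative(2)[of m n x y]]
      by (simp add: add.commute)
  qed (intro ci, simp add: p0)
  also have "integral torus (\<lambda>t. frechet_derivative U (at (s, t)) (0, 0, 1) * ?e t + U (s, t) * (- \<i> * of_int n * ?e t))
     = integral torus (\<lambda>t. frechet_derivative U (at (s, t)) (0, 0, 1) * ?e t) + integral torus (\<lambda>t. (- \<i> * of_int n) * (U (s, t) * ?e t))"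
    by (subst integral_add[symmetric]) (auto intro!: integrable_continuous ci simp: mult_ac)
  finally show "fourier_mode m n (\<lambda>p. frechet_derivative U (at p) (0, 0, 1)) s = \<i> * of_int n * fourier_mode m n U s"
    unfolding fourier_mode_def integral_mult_right by (simp add: eq_neg_iff_add_eq_0[symmetric] add_eq_0_iff2)
qed


section \<open>The Kohn Laplacian of a Reinhardt hypersurface in coordinates\<close>

lemma periodic_frechet:
  fixes f :: "real \<Rightarrow> complex"
  assumes f: "smooth_on UNIV f" and p: "\<And>s. f (s + L) = f s"
  shows "frechet_derivative f (at (s + L)) 1 = frechet_derivative f (at s) 1"
proof -
  have "((\<lambda>t. t + L) has_vector_derivative 1) (at s)" by (auto intro!: derivative_eq_intros)
  from vector_diff_chain_at[OF this smooth_on_has_vector_derivative[OF f]]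
  have "((\<lambda>t. f (t + L)) has_vector_derivative frechet_derivative f (at (s + L)) 1) (at s)" by (simp add: o_def)
  then have "(f has_vector_derivative frechet_derivative f (at (s + L)) 1) (at s)" by (simp add: p)
  then show ?thesis by (rule vector_derivative_unique_at[OF _ smooth_on_has_vector_derivative[OF f]])
qed

text \<open>An immersed closed curve. Embeddedness enters only in \<open>constant_curvature_length\<close>, where it
  excludes circles traversed several times.\<close>

locale reinhardt_curve =
  fixes L :: real and \<xi> \<eta> \<kappa> :: "real \<Rightarrow> real"
  assumes L_pos: "L > 0"
    and smooth_xi: "smooth_on UNIV \<xi>" and smooth_eta: "smooth_on UNIV \<eta>"
    and periodic_xi: "\<xi> (s + L) = \<xi> s" and periodic_eta: "\<eta> (s + L) = \<eta> s"
    and unit_speed: "(deriv \<xi> s)\<^sup>2 + (deriv \<eta> s)\<^sup>2 = 1"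
    and deriv2_xi: "deriv (deriv \<xi>) s = - \<kappa> s * deriv \<eta> s"
    and deriv2_eta: "deriv (deriv \<eta>) s = \<kappa> s * deriv \<xi> s"
    and curvature_pos: "\<kappa> s > 0"
begin

lemma smooth_xi': "smooth_on UNIV (deriv \<xi>)" and smooth_eta': "smooth_on UNIV (deriv \<eta>)"
  using smooth_on_deriv(1) smooth_xi smooth_eta by blast+

lemma DERIV_xi: "(\<xi> has_real_derivative deriv \<xi> s) (at s)"
  and DERIV_eta: "(\<eta> has_real_derivative deriv \<eta> s) (at s)"
  using smooth_on_deriv(2) smooth_xi smooth_eta by blast+

lemma DERIV_xi': "(deriv \<xi> has_real_derivative - \<kappa> s * deriv \<eta> s) (at s)"
  and DERIV_eta': "(deriv \<eta> has_real_derivative \<kappa> s * deriv \<xi> s) (at s)"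
  using smooth_on_deriv(2)[OF smooth_xi', of s] smooth_on_deriv(2)[OF smooth_eta', of s]
  by (simp_all add: deriv2_xi deriv2_eta)

lemma periodic_xi': "deriv \<xi> (s + L) = deriv \<xi> s" and periodic_eta': "deriv \<eta> (s + L) = deriv \<eta> s"
  using periodic_derivative[of \<xi>, OF DERIV_xi periodic_xi] periodic_derivative[of \<eta>, OF DERIV_eta periodic_eta] by auto

lemma curvature_eq: "\<kappa> s = deriv \<xi> s * deriv (deriv \<eta>) s - deriv \<eta> s * deriv (deriv \<xi>) s"
proof -
  have "deriv \<xi> s * deriv (deriv \<eta>) s - deriv \<eta> s * deriv (deriv \<xi>) s = \<kappa> s * ((deriv \<xi> s)\<^sup>2 + (deriv \<eta> s)\<^sup>2)"
    by (simp add: deriv2_xi deriv2_eta power2_eq_square algebra_simps)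
  then show ?thesis by (simp add: unit_speed)
qed

lemma smooth_curvature: "smooth_on UNIV \<kappa>"
proof -
  have "smooth_on UNIV (\<lambda>s. deriv \<xi> s * deriv (deriv \<eta>) s - deriv \<eta> s * deriv (deriv \<xi>) s)"
    by (intro smooth_on_diff smooth_on_mult smooth_xi' smooth_eta' smooth_on_deriv(1))
  then show ?thesis by (simp add: curvature_eq[symmetric])
qed

lemma periodic_curvature: "\<kappa> (s + L) = \<kappa> s"
proof -
  have "deriv (deriv \<xi>) (s + L) = deriv (deriv \<xi>) s" "deriv (deriv \<eta>) (s + L) = deriv (deriv \<eta>) s"
    using periodic_derivative[OF smooth_on_deriv(2)[OF smooth_xi'] periodic_xi']
      periodic_derivative[OF smooth_on_deriv(2)[OF smooth_eta'] periodic_eta'] by blast+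
  then show ?thesis by (simp add: curvature_eq periodic_xi' periodic_eta')
qed

lemma continuous_curvature: "continuous_on A \<kappa>"
  by (rule smooth_on_continuous[OF smooth_curvature])

text \<open>The conjugate frame \<open>cvec_cnj (Z p)\<close> acts as this operator times a factor of modulus
  \<open>1 / sqrt (2 \<kappa>)\<close> (\<open>frame_eq_dbar\<close>); the arbitrary phase of \<open>Z\<close> drops out of all pairings.\<close>

definition dbar :: "(coords \<Rightarrow> complex) \<Rightarrow> coords \<Rightarrow> complex" where
  "dbar u p = frechet_derivative u (at p) (1, 0, 0)
     + \<i> * of_real (deriv \<xi> (fst p)) * frechet_derivative u (at p) (0, 1, 0)
     + \<i> * of_real (deriv \<eta> (fst p)) * frechet_derivative u (at p) (0, 0, 1)"

lemma frechet_coords: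
  assumes "u differentiable (at (p :: coords))"
  shows "frechet_derivative u (at p) (a, b, c) = of_real a * frechet_derivative u (at p) (1, 0, 0)
     + of_real b * frechet_derivative u (at p) (0, 1, 0) + of_real c * (frechet_derivative u (at p) (0, 0, 1) :: complex)"
proof -
  interpret l: linear "frechet_derivative u (at p)" by (rule linear_frechet_derivative[OF assms])
  have "(a, b, c) = a *\<^sub>R (1, 0, 0) + b *\<^sub>R (0, 1, 0) + c *\<^sub>R (0, 0, 1::real)" by simp
  then have "frechet_derivative u (at p) (a, b, c)
    = frechet_derivative u (at p) (a *\<^sub>R (1, 0, 0) + b *\<^sub>R (0, 1, 0) + c *\<^sub>R (0, 0, 1))" by simp
  then show ?thesis by (simp only: l.add l.scale scaleR_conv_of_real)
qed

text \<open>Type \<open>(1, 0)\<close> forces \<open>Z = Z\<^sub>s (\<partial>\<^sub>s - \<i> \<xi>' \<partial>\<^sub>x - \<i> \<eta>' \<partial>\<^sub>y)\<close>, and for such vectors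
  \<open>- \<i> d\<theta>(Z, Z-bar) = 2 \<kappa> \<bar>Z\<^sub>s\<bar>\<^sup>2\<close>. So \<open>\<zeta>\<close> is the conjugate of \<open>Z\<^sub>s\<close>, and only its phase is free.\<close>

lemma frame_eq_dbar:
  assumes Z: "normalized_frame \<xi> \<eta> L Z"
  obtains \<zeta> where "2 * \<kappa> (fst p) * (cmod \<zeta>)\<^sup>2 = 1"
    "\<And>u. u differentiable (at p) \<Longrightarrow> cvec_apply (cvec_cnj (Z p)) u p = \<zeta> * dbar u p"
proof -
  obtain s x y where p: "p = (s, x, y)" by (cases p)
  obtain V1 V2 V3 W1 W2 W3 where Zp: "Z p = ((V1, V2, V3), (W1, W2, W3))" by (metis prod.collapse)
  let ?a = "deriv \<xi> s" and ?b = "deriv \<eta> s"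
  have t10: "is_type_10 \<xi> \<eta> p (Z p)"
    and nrm: "- \<i> * complexify2 (ext_deriv (contact_form \<xi> \<eta>) p) (Z p) (cvec_cnj (Z p)) = 1"
    using Z unfolding normalized_frame_def by blast+
  have dfst: "((\<lambda>q. fst q) has_derivative (\<lambda>v. fst v)) (at p)" by (auto intro!: derivative_eq_intros)
  have dcomp: "((\<lambda>q. h (fst q)) has_derivative (\<lambda>v. h' * fst v)) (at p)"
    if "(h has_real_derivative h') (at s)" for h h'
    using has_derivative_compose[OF dfst, of h "\<lambda>v. h' * v"] that p by (simp add: has_field_derivative_def)
  have fr1: "frechet_derivative (\<lambda>q. cnj (fst (chart \<xi> \<eta> q))) (at p) v
      = (of_real (?a * fst v) - \<i> * of_real (fst (snd v))) * exp (of_real (\<xi> s) - \<i> * of_real x)" for v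
  proof -
    have "((\<lambda>q. exp (of_real (\<xi> (fst q)) - \<i> * of_real (fst (snd q)))) has_derivative
       (\<lambda>v. (of_real (?a * fst v) - \<i> * of_real (fst (snd v))) * exp (of_real (\<xi> s) - \<i> * of_real x))) (at p)"
    proof -
      have "((\<lambda>q. of_real (\<xi> (fst q)) - \<i> * of_real (fst (snd q))) has_derivative
         (\<lambda>v. of_real (?a * fst v) - \<i> * of_real (fst (snd v)))) (at p)"
        by (intro has_derivative_diff has_derivative_of_real dcomp[OF DERIV_xi] has_derivative_mult_right)
           (auto intro!: derivative_eq_intros)
      from has_derivative_compose[OF this DERIV_exp[unfolded has_field_derivative_def]]
      show ?thesis by (simp add: p mult.commute)
    qed
    moreover have "(\<lambda>q. cnj (fst (chart \<xi> \<eta> q))) = (\<lambda>q. exp (of_real (\<xi> (fst q)) - \<i> * of_real (fst (snd q))))"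
      by (rule ext) (simp add: chart_def split_beta exp_cnj)
    ultimately show ?thesis by (simp add: frechet_derivative_at[symmetric])
  qed
  have fr2: "frechet_derivative (\<lambda>q. cnj (snd (chart \<xi> \<eta> q))) (at p) v
      = (of_real (?b * fst v) - \<i> * of_real (snd (snd v))) * exp (of_real (\<eta> s) - \<i> * of_real y)" for v
  proof -
    have "((\<lambda>q. exp (of_real (\<eta> (fst q)) - \<i> * of_real (snd (snd q)))) has_derivative
       (\<lambda>v. (of_real (?b * fst v) - \<i> * of_real (snd (snd v))) * exp (of_real (\<eta> s) - \<i> * of_real y))) (at p)"
    proof -
      have "((\<lambda>q. of_real (\<eta> (fst q)) - \<i> * of_real (snd (snd q))) has_derivative
         (\<lambda>v. of_real (?b * fst v) - \<i> * of_real (snd (snd v)))) (at p)"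
        by (intro has_derivative_diff has_derivative_of_real dcomp[OF DERIV_eta] has_derivative_mult_right)
           (auto intro!: derivative_eq_intros)
      from has_derivative_compose[OF this DERIV_exp[unfolded has_field_derivative_def]]
      show ?thesis by (simp add: p mult.commute)
    qed
    moreover have "(\<lambda>q. cnj (snd (chart \<xi> \<eta> q))) = (\<lambda>q. exp (of_real (\<eta> (fst q)) - \<i> * of_real (snd (snd q))))"
      by (rule ext) (simp add: chart_def split_beta exp_cnj)
    ultimately show ?thesis by (simp add: frechet_derivative_at[symmetric])
  qed
  have "(of_real (?a * V1) - \<i> * of_real V2) + \<i> * (of_real (?a * W1) - \<i> * of_real W2) = 0"
    "(of_real (?b * V1) - \<i> * of_real V3) + \<i> * (of_real (?b * W1) - \<i> * of_real W3) = 0"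
  proof -
    have "((of_real (?a * V1) - \<i> * of_real V2) + \<i> * (of_real (?a * W1) - \<i> * of_real W2)) * exp (of_real (\<xi> s) - \<i> * of_real x) = 0"
      "((of_real (?b * V1) - \<i> * of_real V3) + \<i> * (of_real (?b * W1) - \<i> * of_real W3)) * exp (of_real (\<eta> s) - \<i> * of_real y) = 0"
      using t10 unfolding is_type_10_def cvec_apply_def fr1 fr2 Zp by (simp_all add: algebra_simps)
    then show "(of_real (?a * V1) - \<i> * of_real V2) + \<i> * (of_real (?a * W1) - \<i> * of_real W2) = 0"
      "(of_real (?b * V1) - \<i> * of_real V3) + \<i> * (of_real (?b * W1) - \<i> * of_real W3) = 0" by simp_all
  qed
  then have VW: "V2 = ?a * W1" "W2 = - ?a * V1" "V3 = ?b * W1" "W3 = - ?b * V1"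
    by (auto simp: complex_eq_iff)
  have ed: "ext_deriv (contact_form \<xi> \<eta>) p X Y = fst X * \<kappa> s * (?a * fst (snd Y) + ?b * snd (snd Y))
      - fst Y * \<kappa> s * (?a * fst (snd X) + ?b * snd (snd X))" for X Y
  proof -
    have "((\<lambda>q. contact_form \<xi> \<eta> q Y) has_derivative
       (\<lambda>v. \<kappa> s * ?a * fst v * fst (snd Y) - (- \<kappa> s * ?b) * fst v * snd (snd Y))) (at p)" for Y
      unfolding contact_form_def
      by (intro has_derivative_diff has_derivative_mult_left dcomp DERIV_xi' DERIV_eta')
    then have "frechet_derivative (\<lambda>q. contact_form \<xi> \<eta> q Y) (at p)
       = (\<lambda>v. \<kappa> s * ?a * fst v * fst (snd Y) - (- \<kappa> s * ?b) * fst v * snd (snd Y))" for Y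
      by (simp add: frechet_derivative_at[symmetric])
    then show ?thesis by (simp add: ext_deriv_def algebra_simps)
  qed
  define \<zeta> where "\<zeta> = complex_of_real V1 - \<i> * of_real W1"
  have ab: "?a * ?a + ?b * ?b = 1" using unit_speed[of s] by (simp add: power2_eq_square)
  have "complex_of_real (2 * \<kappa> s * ((?a * ?a + ?b * ?b) * (V1\<^sup>2 + W1\<^sup>2))) = 1"
    using nrm unfolding complexify2_def ed Zp cvec_cnj_def VW
    by (simp add: complex_eq_iff power2_eq_square algebra_simps)
  then have "2 * \<kappa> s * (V1\<^sup>2 + W1\<^sup>2) = 1" unfolding ab by (simp only: of_real_eq_1_iff mult_1)
  then have "2 * \<kappa> (fst p) * (cmod \<zeta>)\<^sup>2 = 1" by (simp add: \<zeta>_def cmod_power2 p)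
  moreover have "cvec_apply (cvec_cnj (Z p)) u p = \<zeta> * dbar u p" if u: "u differentiable (at p)" for u
  proof -
    have "- (W1, W2, W3) = (- W1, - W2, - W3)" by simp
    then show ?thesis
      unfolding cvec_apply_def cvec_cnj_def Zp fst_conv snd_conv dbar_def VW \<zeta>_def
      by (simp only: frechet_coords[OF u, of V1] frechet_coords[OF u, of "- W1"]) (simp add: p algebra_simps)
  qed
  ultimately show thesis by (rule that)
qed

lemma frame_pairing:
  assumes Z: "normalized_frame \<xi> \<eta> L Z" and d: "u differentiable (at p)" "f differentiable (at p)"
  shows "cvec_apply (cvec_cnj (Z p)) u p * cnj (cvec_apply (cvec_cnj (Z p)) f p)
    = dbar u p * cnj (dbar f p) / of_real (2 * \<kappa> (fst p))"
proof -
  obtain \<zeta> where z: "2 * \<kappa> (fst p) * (cmod \<zeta>)\<^sup>2 = 1"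
    "\<And>u. u differentiable (at p) \<Longrightarrow> cvec_apply (cvec_cnj (Z p)) u p = \<zeta> * dbar u p"
    using frame_eq_dbar[OF Z] by blast
  have k: "\<kappa> (fst p) \<noteq> 0" using curvature_pos[of "fst p"] by simp
  have "of_real (2 * \<kappa> (fst p)) * (\<zeta> * cnj \<zeta>) = (1::complex)"
    unfolding complex_norm_square[symmetric] of_real_mult[symmetric] z(1) by simp
  then have "\<zeta> * cnj \<zeta> = 1 / of_real (2 * \<kappa> (fst p))" using k by (simp add: field_simps)
  moreover have "\<zeta> * dbar u p * cnj (\<zeta> * dbar f p) = (\<zeta> * cnj \<zeta>) * (dbar u p * cnj (dbar f p))" by simp
  ultimately show ?thesis unfolding z(2)[OF d(1)] z(2)[OF d(2)] by simp
qed

text \<open>Passing from the half-open period box to its closure changes a null set only; on the closed box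
  Fubini's theorem for continuous functions applies.\<close>

lemma vol_integral:
  fixes F :: "coords \<Rightarrow> 'b::euclidean_space"
  assumes cF: "continuous_on UNIV F"
  shows "integrable (vol L \<kappa>) F"
    and "(LINT p|vol L \<kappa>. F p) = integral {0..L} (\<lambda>s. \<kappa> s *\<^sub>R integral torus (\<lambda>t. F (s, t)))"
proof -
  define B :: "coords set" where "B = {0..<L} \<times> {0..<2 * pi} \<times> {0..<2 * pi}"
  define C :: "coords set" where "C = cbox (0, 0, 0) (L, 2 * pi, 2 * pi)"
  define H where "H = (\<lambda>p. \<kappa> (fst p) *\<^sub>R F p)"
  define g :: "coords \<Rightarrow> real" where "g = (\<lambda>p. indicator B p * \<kappa> (fst p))"
  have cH: "continuous_on A H" for A unfolding H_def
    by (intro continuous_intros continuous_on_compose2[OF continuous_curvature[of UNIV]] continuous_on_subset[OF cF]) auto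
  have "B \<in> sets (borel \<Otimes>\<^sub>M (borel \<Otimes>\<^sub>M borel))" unfolding B_def by (intro pair_measureI) auto
  then have B: "B \<in> sets borel" unfolding borel_prod .
  have mk: "(\<lambda>p::coords. \<kappa> (fst p)) \<in> borel_measurable borel"
    by (intro borel_measurable_continuous_onI continuous_on_compose2[OF continuous_curvature[of UNIV]] continuous_intros) auto
  have mg: "g \<in> borel_measurable lborel" unfolding g_def using B mk by simp
  have mF: "F \<in> borel_measurable lborel" using borel_measurable_continuous_onI[OF cF] by simp
  have g0: "AE p in lborel. 0 \<le> g p" unfolding g_def using less_imp_le[OF curvature_pos] by (simp add: indicator_def)
  have BC: "B \<subseteq> C" unfolding B_def C_def by (auto simp: cbox_Pair_eq)
  have boxB: "box (0, 0, 0) (L, 2 * pi, 2 * pi) \<subseteq> B" unfolding B_def by (auto simp: box_def Basis_prod_def inner_Pair_0)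
  have "set_integrable lborel C H"
    unfolding set_integrable_def C_def by (intro borel_integrable_compact cH compact_cbox)
  then have iB: "set_integrable lborel B H"
    by (rule set_integrable_subset) (use B BC in auto)
  have gF: "(\<lambda>p. g p *\<^sub>R F p) = (\<lambda>p. indicator B p *\<^sub>R H p)" by (simp add: g_def H_def)
  have vol: "vol L \<kappa> = density lborel (\<lambda>p. ennreal (g p))" by (simp add: vol_def g_def B_def)
  show "integrable (vol L \<kappa>) F"
    unfolding vol integrable_density[OF mF mg g0] gF using iB by (simp add: set_integrable_def)
  have "(LINT p|vol L \<kappa>. F p) = (LINT p|lborel. g p *\<^sub>R F p)"
    unfolding vol by (rule integral_density[OF mF mg g0])
  also have "\<dots> = (LINT p:B|lborel. H p)" unfolding gF set_lebesgue_integral_def ..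
  also have "\<dots> = integral B H" by (rule set_borel_integral_eq_integral(2)[OF iB])
  also have "\<dots> = integral C H"
  proof (rule integral_spike_set)
    have "{x \<in> C - B. H x \<noteq> 0} \<subseteq> C - box (0, 0, 0) (L, 2 * pi, 2 * pi)" using boxB by blast
    then show "negligible {x \<in> C - B. H x \<noteq> 0}"
      unfolding C_def by (rule negligible_subset[OF negligible_frontier_interval])
    have "{x \<in> B - C. H x \<noteq> 0} = {}" using BC by blast
    then show "negligible {x \<in> B - C. H x \<noteq> 0}" by (simp only: negligible_empty)
  qed
  also have "\<dots> = integral (cbox 0 L) (\<lambda>s. integral torus (\<lambda>t. H (s, t)))"
    unfolding C_def by (rule integral_prod_continuous[OF cH])
  finally show "(LINT p|vol L \<kappa>. F p) = integral {0..L} (\<lambda>s. \<kappa> s *\<^sub>R integral torus (\<lambda>t. F (s, t)))"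
    by (simp add: H_def)
qed

text \<open>Each angular derivative contributes a factor \<open>\<i> m\<close> or \<open>\<i> n\<close>, which the factor \<open>\<i>\<close> in \<open>dbar\<close> turns into
  the real zero-order term of \<open>D\<close>.\<close>

lemma fourier_mode_dbar:
  assumes U: "U \<in> smooth_functions L"
  shows "fourier_mode m n (dbar U) s = frechet_derivative (fourier_mode m n U) (at s) 1
     - of_real (of_int m * deriv \<xi> s + of_int n * deriv \<eta> s) * fourier_mode m n U s"
proof -
  have sU: "smooth_on UNIV U" using U by (auto simp: smooth_functions_def)
  let ?e = "\<lambda>t. cnj (fourier_char m n t)"
  let ?D = "\<lambda>v t. frechet_derivative U (at (s, t)) v * ?e t"
  have cD: "continuous_on A (?D v)" for v A
    by (intro continuous_intros continuous_fourier_char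
      continuous_on_compose2[OF smooth_on_continuous[OF smooth_on_frechet[OF sU, of v], of UNIV]]) auto
  have iD: "(\<lambda>t. c * ?D v t) integrable_on torus" for c v
    by (intro integrable_continuous continuous_intros cD)
  have "fourier_mode m n (dbar U) s
     = integral torus (\<lambda>t. 1 * ?D (1, 0, 0) t + \<i> * of_real (deriv \<xi> s) * ?D (0, 1, 0) t + \<i> * of_real (deriv \<eta> s) * ?D (0, 0, 1) t)"
    unfolding fourier_mode_def dbar_def by (simp add: algebra_simps)
  also have "\<dots> = integral torus (\<lambda>t. 1 * ?D (1, 0, 0) t) + integral torus (\<lambda>t. \<i> * of_real (deriv \<xi> s) * ?D (0, 1, 0) t)
     + integral torus (\<lambda>t. \<i> * of_real (deriv \<eta> s) * ?D (0, 0, 1) t)"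
    using iD by (subst integral_add integral_add; (intro integrable_add iD)?)+ (rule refl)
  also have "\<dots> = fourier_mode m n (\<lambda>p. frechet_derivative U (at p) (1, 0, 0)) s
     + \<i> * of_real (deriv \<xi> s) * fourier_mode m n (\<lambda>p. frechet_derivative U (at p) (0, 1, 0)) s
     + \<i> * of_real (deriv \<eta> s) * fourier_mode m n (\<lambda>p. frechet_derivative U (at p) (0, 0, 1)) s"
    unfolding integral_mult_right fourier_mode_def by simp
  also have "fourier_mode m n (\<lambda>p. frechet_derivative U (at p) (1, 0, 0)) s = frechet_derivative (fourier_mode m n U) (at s) 1"
    by (rule vector_derivative_unique_at[OF fourier_mode_derivative[OF sU] smooth_on_has_vector_derivative[OF smooth_fourier_mode[OF sU]]])
  finally show ?thesis unfolding fourier_mode_angular_derivatives[OF U] by (simp add: algebra_simps)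
qed

lemma smooth_mode_function:
  assumes psi: "smooth_on UNIV \<psi>" "\<And>s. \<psi> (s + L) = \<psi> s"
  shows "(\<lambda>p. \<psi> (fst p) * fourier_char m n (snd p)) \<in> smooth_functions L"
proof -
  have "bounded_linear (\<lambda>p::coords. of_int m * fst (snd p) + of_int n * snd (snd p))"
    by (intro bounded_linear_intros)
  from smooth_on_compose_linear[OF this smooth_on_cis]
  have "smooth_on UNIV (\<lambda>p::coords. fourier_char m n (snd p))" by (simp add: fourier_char_def split_beta)
  then have "smooth_on UNIV (\<lambda>p. \<psi> (fst p) * fourier_char m n (snd p))"
    by (intro smooth_on_mult smooth_on_compose_linear[OF bounded_linear_fst psi(1)])
  then show ?thesis
    by (simp add: smooth_functions_def periodic_def psi(2) fourier_char_periodic)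
qed

lemma dbar_mode_function:
  assumes psi: "smooth_on UNIV \<psi>" "\<And>s. \<psi> (s + L) = \<psi> s"
  shows "dbar (\<lambda>p. \<psi> (fst p) * fourier_char m n (snd p)) (s, t)
    = (frechet_derivative \<psi> (at s) 1 - of_real (of_int m * deriv \<xi> s + of_int n * deriv \<eta> s) * \<psi> s) * fourier_char m n t"
proof -
  let ?f = "\<lambda>p::coords. \<psi> (fst p) * fourier_char m n (snd p)"
  have sf: "smooth_on UNIV ?f" using smooth_mode_function[OF psi] by (simp add: smooth_functions_def)
  obtain x y where t: "t = (x, y)" by (cases t)
  have "frechet_derivative ?f (at (s, t)) (1, 0) = frechet_derivative \<psi> (at s) 1 * fourier_char m n t"
    using smooth_partial_s[OF sf, of t s] has_vector_derivative_mult_left[OF smooth_on_has_vector_derivative[OF psi(1), of s], of "fourier_char m n t"]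
    by (intro vector_derivative_unique_at) auto
  moreover have "((\<lambda>x. fourier_char m n (x, y)) has_vector_derivative \<i> * of_int m * fourier_char m n (x, y)) (at x)"
    "((\<lambda>y. fourier_char m n (x, y)) has_vector_derivative \<i> * of_int n * fourier_char m n (x, y)) (at y)"
    unfolding fourier_char_def prod.case has_vector_derivative_def
    by (auto intro!: derivative_eq_intros simp: scaleR_conv_of_real mult_ac)
  then have "((\<lambda>x. ?f (s, x, y)) has_vector_derivative \<psi> s * (\<i> * of_int m * fourier_char m n (x, y))) (at x)"
    "((\<lambda>y. ?f (s, x, y)) has_vector_derivative \<psi> s * (\<i> * of_int n * fourier_char m n (x, y))) (at y)"
    by (auto intro: has_vector_derivative_mult_right)
  then have "frechet_derivative ?f (at (s, x, y)) (0, 1, 0) = \<psi> s * (\<i> * of_int m * fourier_char m n (x, y))"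
    "frechet_derivative ?f (at (s, x, y)) (0, 0, 1) = \<psi> s * (\<i> * of_int n * fourier_char m n (x, y))"
    using smooth_partial_x[OF sf, of s y x] smooth_partial_y[OF sf, of s x y]
    by (auto intro: vector_derivative_unique_at)
  ultimately show ?thesis unfolding dbar_def t by (simp add: zero_prod_def algebra_simps)
qed

lemma continuous_dbar:
  assumes U: "smooth_on UNIV U"
  shows "continuous_on A (dbar U)"
  unfolding dbar_def
  by (intro continuous_intros smooth_on_continuous[OF smooth_on_frechet[OF U]]
      continuous_on_compose2[OF smooth_on_continuous[OF smooth_xi', of UNIV]]
      continuous_on_compose2[OF smooth_on_continuous[OF smooth_eta', of UNIV]]) auto

lemma inner_product_mode_function:
  assumes G: "smooth_on UNIV G" and psi: "smooth_on UNIV \<psi>"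
  shows "(LINT p|vol L \<kappa>. G p * cnj (\<psi> (fst p) * fourier_char m n (snd p)))
     = integral {0..L} (\<lambda>s. of_real (\<kappa> s) * fourier_mode m n G s * cnj (\<psi> s))"
proof -
  have "continuous_on UNIV (\<lambda>p. G p * cnj (\<psi> (fst p) * fourier_char m n (snd p)))"
    by (intro continuous_intros smooth_on_continuous[OF G] continuous_on_compose2[OF smooth_on_continuous[OF psi, of UNIV]]
        continuous_on_compose2[OF continuous_fourier_char[of UNIV]]) auto
  note vol_integral(2)[OF this]
  also have "(\<lambda>s. \<kappa> s *\<^sub>R integral torus (\<lambda>t. G (s, t) * cnj (\<psi> (fst (s, t)) * fourier_char m n (snd (s, t)))))
    = (\<lambda>s. of_real (\<kappa> s) * fourier_mode m n G s * cnj (\<psi> s))"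
  proof
    fix s
    have "(\<lambda>t. G (s, t) * cnj (\<psi> (fst (s, t)) * fourier_char m n (snd (s, t))))
      = (\<lambda>t. cnj (\<psi> s) * (G (s, t) * cnj (fourier_char m n t)))" by (rule ext) simp
    then have "integral torus (\<lambda>t. G (s, t) * cnj (\<psi> (fst (s, t)) * fourier_char m n (snd (s, t))))
      = cnj (\<psi> s) * fourier_mode m n G s" by (simp only: integral_mult_right fourier_mode_def)
    then show "\<kappa> s *\<^sub>R integral torus (\<lambda>t. G (s, t) * cnj (\<psi> (fst (s, t)) * fourier_char m n (snd (s, t))))
      = of_real (\<kappa> s) * fourier_mode m n G s * cnj (\<psi> s)"
      by (simp only: scaleR_conv_of_real mult_ac)
  qed
  finally show ?thesis .
qed

text \<open>The density \<open>\<kappa>\<close> of the volume cancels against the normalisation \<open>1 / (2 \<kappa>)\<close> of the frame, so the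
  form of a single mode is \<open>\<integral> D f cnj (D \<psi>) / 2\<close> without weight.\<close>

lemma dirichlet_form_mode_function:
  fixes m n :: int
  assumes Z: "normalized_frame \<xi> \<eta> L Z" and U: "U \<in> smooth_functions L"
    and psi: "smooth_on UNIV \<psi>" "\<And>s. \<psi> (s + L) = \<psi> s"
  defines "g \<equiv> \<lambda>s. complex_of_real (of_int m * deriv \<xi> s + of_int n * deriv \<eta> s)"
  defines "\<phi> \<equiv> \<lambda>p. \<psi> (fst p) * fourier_char m n (snd p)"
  shows "(LINT p|vol L \<kappa>. cvec_apply (cvec_cnj (Z p)) U p * cnj (cvec_apply (cvec_cnj (Z p)) \<phi> p))
    = 1 / 2 * integral {0..L} (\<lambda>s. (frechet_derivative (fourier_mode m n U) (at s) 1 - g s * fourier_mode m n U s)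
        * cnj (frechet_derivative \<psi> (at s) 1 - g s * \<psi> s))"
proof -
  have sU: "smooth_on UNIV U" using U by (simp add: smooth_functions_def)
  have sphi: "smooth_on UNIV \<phi>" using smooth_mode_function[OF psi] by (simp add: smooth_functions_def \<phi>_def)
  let ?F = "\<lambda>p. dbar U p * cnj (dbar \<phi> p) / of_real (2 * \<kappa> (fst p))"
  have k: "\<kappa> s \<noteq> 0" for s using curvature_pos[of s] by simp
  have cF: "continuous_on UNIV ?F"
    by (intro continuous_intros continuous_dbar sU sphi continuous_on_compose2[OF continuous_curvature[of UNIV]]) (auto simp: k)
  have "(LINT p|vol L \<kappa>. cvec_apply (cvec_cnj (Z p)) U p * cnj (cvec_apply (cvec_cnj (Z p)) \<phi> p)) = (LINT p|vol L \<kappa>. ?F p)"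
    by (rule arg_cong[where f = "integral\<^sup>L (vol L \<kappa>)"], rule ext,
        rule frame_pairing[OF Z smooth_on_differentiable[OF sU] smooth_on_differentiable[OF sphi]])
  also have "\<dots> = integral {0..L} (\<lambda>s. \<kappa> s *\<^sub>R integral torus (\<lambda>t. ?F (s, t)))"
    by (rule vol_integral(2)[OF cF])
  also have "(\<lambda>s. \<kappa> s *\<^sub>R integral torus (\<lambda>t. ?F (s, t)))
    = (\<lambda>s. 1 / 2 * (fourier_mode m n (dbar U) s * cnj (frechet_derivative \<psi> (at s) 1 - g s * \<psi> s)))"
  proof
    fix s
    let ?c = "cnj (frechet_derivative \<psi> (at s) 1 - g s * \<psi> s)"
    have "(\<lambda>t. ?F (s, t)) = (\<lambda>t. ?c / of_real (2 * \<kappa> s) * (dbar U (s, t) * cnj (fourier_char m n t)))"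
      unfolding \<phi>_def dbar_mode_function[OF psi] g_def by (rule ext) simp
    then have "integral torus (\<lambda>t. ?F (s, t)) = ?c / of_real (2 * \<kappa> s) * fourier_mode m n (dbar U) s"
      by (simp only: integral_mult_right fourier_mode_def)
    then show "\<kappa> s *\<^sub>R integral torus (\<lambda>t. ?F (s, t)) = 1 / 2 * (fourier_mode m n (dbar U) s * ?c)"
      using k[of s] by (simp add: scaleR_conv_of_real)
  qed
  finally show ?thesis unfolding integral_mult_right fourier_mode_dbar[OF U] g_def .
qed

end


section \<open>The Kohn Laplacian mode by mode\<close>

lemma periodic_zero:
  fixes h :: "real \<Rightarrow> 'b::zero"
  assumes "\<And>s. h (s + L) = h s" "L > 0" "\<And>s. s \<in> {0..L} \<Longrightarrow> h s = 0"
  shows "h s = 0"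
proof -
  have "s - of_int \<lfloor>s / L\<rfloor> * L \<in> {0..L}"
    using assms(2) floor_divide_lower[of L s] floor_divide_upper[of L s] by (auto simp: algebra_simps)
  then show ?thesis using assms(3)[of "s + of_int (- \<lfloor>s / L\<rfloor>) * L"] periodic_int[of h L s "- \<lfloor>s / L\<rfloor>", OF assms(1)] by simp
qed

lemma continuous_integral_norm_eq_0:
  fixes h :: "real \<Rightarrow> complex"
  assumes c: "continuous_on {0..L} h" and L: "L > 0" and z: "integral {0..L} (\<lambda>s. h s * cnj (h s)) = 0"
    and s: "s \<in> {0..L}"
  shows "h s = 0"
proof -
  have ch: "continuous_on {0..L} (\<lambda>s. (cmod (h s))\<^sup>2)" by (intro continuous_intros c)
  have "integral {0..L} (\<lambda>s. h s * cnj (h s)) = of_real (integral {0..L} (\<lambda>s. (cmod (h s))\<^sup>2))"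
    unfolding complex_norm_square[symmetric]
    by (rule integral_unique[OF has_integral_of_real[OF integrable_integral[OF integrable_continuous_real[OF ch]]]])
  then have "integral {0..L} (\<lambda>s. (cmod (h s))\<^sup>2) = 0" using z by simp
  then have "\<forall>s\<in>{0..L}. (cmod (h s))\<^sup>2 = 0" using integral_eq_0_iff[OF ch L] zero_le_power2 by blast
  then show ?thesis using s by simp
qed

lemma integral_of_periodic_derivative:
  fixes f :: "real \<Rightarrow> complex"
  assumes "\<And>s. (f has_vector_derivative f' s) (at s)" "f L = f 0" "L > 0"
  shows "integral {0..L} f' = 0"
  using integral_of_derivative[of 0 L f f'] assms by simp

lemma fourier_mode_periodic:
  assumes "periodic L U" shows "fourier_mode m n U (s + L) = fourier_mode m n U s"
proof -
  have "U (s + L, t) = U (s, t)" for t using assms by (cases t) (simp add: periodic_def)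
  then show ?thesis by (simp add: fourier_mode_def)
qed

lemma kohn_laplacianD:
  assumes "kohn_laplacian L \<kappa> Z u g" "f \<in> smooth_functions L"
  shows "(LINT p|vol L \<kappa>. g p * cnj (f p)) =
    (LINT p|vol L \<kappa>. cvec_apply (cvec_cnj (Z p)) u p * cnj (cvec_apply (cvec_cnj (Z p)) f p))"
  using assms unfolding kohn_laplacian_def by blast

context reinhardt_curve
begin

text \<open>Integrating by parts in the weak equation for a single mode gives
  \<open>\<integral> \<psi> cnj \<phi> = 0\<close> for all smooth periodic \<open>\<phi>\<close>, where \<open>\<psi>\<close> is the difference of the two sides. As \<open>\<psi>\<close> is
  smooth and periodic itself, \<open>\<phi> = \<psi>\<close> is an admissible test function, and \<open>\<psi> = 0\<close>.\<close>

theorem kohn_mode_equation: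
  fixes m n :: int
  assumes Z: "normalized_frame \<xi> \<eta> L Z" and K: "kohn_laplacian L \<kappa> Z U G"
  defines "f \<equiv> fourier_mode m n U" and "h \<equiv> fourier_mode m n G"
  defines "f1 \<equiv> \<lambda>s. frechet_derivative f (at s) 1"
  defines "f2 \<equiv> \<lambda>s. frechet_derivative f1 (at s) 1"
  defines "g \<equiv> \<lambda>s. of_int m * deriv \<xi> s + of_int n * deriv \<eta> s"
  defines "g1 \<equiv> \<lambda>s. \<kappa> s * (of_int n * deriv \<xi> s - of_int m * deriv \<eta> s)"
  shows "of_real (\<kappa> s) * h s = - (f2 s - of_real (g1 s + (g s)\<^sup>2) * f s) / 2"
proof -
  have U: "U \<in> smooth_functions L" and G: "G \<in> smooth_functions L" using K by (auto simp: kohn_laplacian_def)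
  have sU: "smooth_on UNIV U" and pU: "periodic L U" and sG: "smooth_on UNIV G" and pG: "periodic L G"
    using U G by (auto simp: smooth_functions_def)
  have sf: "smooth_on UNIV f" and sh: "smooth_on UNIV h"
    unfolding f_def h_def by (rule smooth_fourier_mode[OF sU], rule smooth_fourier_mode[OF sG])
  have sf1: "smooth_on UNIV f1" unfolding f1_def by (rule smooth_on_frechet[OF sf])
  have sf2: "smooth_on UNIV f2" unfolding f2_def by (rule smooth_on_frechet[OF sf1])
  have pf: "f (s + L) = f s" and ph: "h (s + L) = h s" for s
    unfolding f_def h_def by (rule fourier_mode_periodic[OF pU], rule fourier_mode_periodic[OF pG])
  have pf1: "f1 (s + L) = f1 s" for s unfolding f1_def by (rule periodic_frechet[OF sf pf])
  have pf2: "f2 (s + L) = f2 s" for s unfolding f2_def by (rule periodic_frechet[OF sf1 pf1])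
  have pg: "g (s + L) = g s" "g1 (s + L) = g1 s" for s
    unfolding g_def g1_def by (simp_all add: periodic_xi' periodic_eta' periodic_curvature)
  have sg: "smooth_on UNIV g" and sg1: "smooth_on UNIV g1"
    unfolding g_def g1_def
    by (intro smooth_on_add smooth_on_diff smooth_on_mult smooth_on_const smooth_xi' smooth_eta' smooth_curvature)+
  have df: "(f has_vector_derivative f1 s) (at s)" "(f1 has_vector_derivative f2 s) (at s)" for s
    unfolding f1_def[of] f2_def
    by (rule smooth_on_has_vector_derivative[OF sf], rule smooth_on_has_vector_derivative[OF sf1[unfolded f1_def]])
  have dg: "(g has_real_derivative g1 s) (at s)" for s
    unfolding g_def g1_def
    by (auto intro!: derivative_eq_intros DERIV_xi' DERIV_eta' simp: algebra_simps)
  have dgc: "((\<lambda>s. complex_of_real (g s)) has_vector_derivative of_real (g1 s)) (at s)" for s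
    by (rule has_vector_derivative_of_real[OF dg])
  define v where "v = (\<lambda>s. f1 s - of_real (g s) * f s)"
  define v1 where "v1 = (\<lambda>s. f2 s - (of_real (g s) * f1 s + of_real (g1 s) * f s))"
  have dv: "(v has_vector_derivative v1 s) (at s)" for s
    unfolding v_def v1_def by (intro has_vector_derivative_diff has_vector_derivative_mult df dgc)
  have sv: "smooth_on UNIV v" and sv1: "smooth_on UNIV v1"
    unfolding v_def v1_def by (intro smooth_on_add smooth_on_diff smooth_on_mult smooth_on_of_real sf sf1 sf2 sg sg1)+
  define \<psi> where "\<psi> = (\<lambda>s. of_real (\<kappa> s) * h s + 1 / 2 * (v1 s + of_real (g s) * v s))"
  have spsi: "smooth_on UNIV \<psi>"
    unfolding \<psi>_def by (intro smooth_on_add smooth_on_mult smooth_on_of_real smooth_on_const sh sv sv1 sg smooth_curvature)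
  have ppsi: "\<psi> (s + L) = \<psi> s" for s
    unfolding \<psi>_def v_def v1_def by (simp add: pf pf1 pf2 ph pg periodic_curvature)
  define \<psi>1 where "\<psi>1 = (\<lambda>s. frechet_derivative \<psi> (at s) 1)"
  have spsi1: "smooth_on UNIV \<psi>1" unfolding \<psi>1_def by (rule smooth_on_frechet[OF spsi])
  note c = smooth_on_continuous[OF sv] smooth_on_continuous[OF sv1] smooth_on_continuous[OF spsi] smooth_on_continuous[OF spsi1]
    smooth_on_continuous[OF sh] smooth_on_continuous[OF sg] continuous_curvature
  have "integral {0..L} (\<lambda>s. of_real (\<kappa> s) * h s * cnj (\<psi> s))
      = (LINT p|vol L \<kappa>. G p * cnj (\<psi> (fst p) * fourier_char m n (snd p)))"
    unfolding h_def by (rule inner_product_mode_function[OF sG spsi, symmetric])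
  also have "\<dots> = (LINT p|vol L \<kappa>. cvec_apply (cvec_cnj (Z p)) U p
       * cnj (cvec_apply (cvec_cnj (Z p)) (\<lambda>p. \<psi> (fst p) * fourier_char m n (snd p)) p))"
    by (rule kohn_laplacianD[OF K smooth_mode_function[OF spsi ppsi]])
  also have "\<dots> = 1 / 2 * integral {0..L} (\<lambda>s. v s * cnj (\<psi>1 s - of_real (g s) * \<psi> s))"
    unfolding v_def \<psi>1_def f1_def f_def g_def by (rule dirichlet_form_mode_function[OF Z U spsi ppsi])
  finally have e1: "integral {0..L} (\<lambda>s. of_real (\<kappa> s) * h s * cnj (\<psi> s))
     - 1 / 2 * integral {0..L} (\<lambda>s. v s * cnj (\<psi>1 s - of_real (g s) * \<psi> s)) = 0" by simp
  have e2: "integral {0..L} (\<lambda>s. v s * cnj (\<psi>1 s) + v1 s * cnj (\<psi> s)) = 0"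
  proof (rule integral_of_periodic_derivative[OF _ _ L_pos])
    show "((\<lambda>s. v s * cnj (\<psi> s)) has_vector_derivative v s * cnj (\<psi>1 s) + v1 s * cnj (\<psi> s)) (at s)" for s
      unfolding \<psi>1_def
      by (intro has_vector_derivative_mult dv has_vector_derivative_cnj smooth_on_has_vector_derivative[OF spsi])
    show "v L * cnj (\<psi> L) = v 0 * cnj (\<psi> 0)"
      using ppsi[of 0] pf[of 0] pf1[of 0] pg[of 0] by (simp add: v_def)
  qed
  have i: "(\<lambda>s. of_real (\<kappa> s) * h s * cnj (\<psi> s)) integrable_on {0..L}"
    "(\<lambda>s. v s * cnj (\<psi>1 s - of_real (g s) * \<psi> s)) integrable_on {0..L}"
    "(\<lambda>s. v s * cnj (\<psi>1 s) + v1 s * cnj (\<psi> s)) integrable_on {0..L}"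
    by (intro integrable_continuous_real continuous_intros c)+
  note has_integral_add[OF has_integral_diff[OF integrable_integral[OF i(1)]
      has_integral_mult_right[OF integrable_integral[OF i(2)], of "1 / 2"]]
      has_integral_mult_right[OF integrable_integral[OF i(3)], of "1 / 2"], unfolded e1 e2]
  moreover have "(\<lambda>s. of_real (\<kappa> s) * h s * cnj (\<psi> s) - 1 / 2 * (v s * cnj (\<psi>1 s - of_real (g s) * \<psi> s))
     + 1 / 2 * (v s * cnj (\<psi>1 s) + v1 s * cnj (\<psi> s))) = (\<lambda>s. \<psi> s * cnj (\<psi> s))"
  proof
    fix s
    have "of_real (\<kappa> s) * h s * q - 1 / 2 * (v s * (cnj (\<psi>1 s) - of_real (g s) * q)) + 1 / 2 * (v s * cnj (\<psi>1 s) + v1 s * q)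
      = \<psi> s * q" for q by (simp add: \<psi>_def field_simps)
    from this[of "cnj (\<psi> s)"] show "of_real (\<kappa> s) * h s * cnj (\<psi> s) - 1 / 2 * (v s * cnj (\<psi>1 s - of_real (g s) * \<psi> s))
     + 1 / 2 * (v s * cnj (\<psi>1 s) + v1 s * cnj (\<psi> s)) = \<psi> s * cnj (\<psi> s)" by simp
  qed
  ultimately have "((\<lambda>s. \<psi> s * cnj (\<psi> s)) has_integral 0) {0..L}" by simp
  then have "integral {0..L} (\<lambda>s. \<psi> s * cnj (\<psi> s)) = 0" by (rule integral_unique)
  then have "\<psi> s = 0" if "s \<in> {0..L}" for s using continuous_integral_norm_eq_0[OF c(3) L_pos _ that] by blast
  then have "\<psi> s = 0" by (rule periodic_zero[where h = \<psi>, OF ppsi L_pos])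
  then show ?thesis unfolding \<psi>_def v_def v1_def by (simp add: field_simps power2_eq_square add_eq_0_iff)
qed

text \<open>Pairing a function of \<open>s\<close> alone with \<open>f\<close> sees only the mode \<open>(0, 0)\<close> of \<open>f\<close>, so the weak equation
  reduces to an integration by parts on the circle.\<close>

lemma kohn_laplacian_of_ode:
  assumes Z: "normalized_frame \<xi> \<eta> L Z" and F: "c2_periodic L F F1 (\<lambda>s. - \<Lambda> * (\<kappa> s * F s))"
  shows "kohn_laplacian L \<kappa> Z (\<lambda>p. complex_of_real (F (fst p)))
    (\<lambda>p. complex_of_real (\<Lambda> / 2) * complex_of_real (F (fst p)))"
proof -
  note FD = c2_periodicD[OF F]
  have sF: "smooth_on UNIV F"
  proof (rule smooth_on_linear_ode[OF FD(1)])
    show "(F1 has_real_derivative (- \<Lambda> * \<kappa> s) * F s) (at s)" for s using FD(2)[of s] by (simp add: mult.assoc)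
    show "smooth_on UNIV (\<lambda>s. - \<Lambda> * \<kappa> s)" by (intro smooth_on_mult smooth_on_const smooth_curvature)
  qed
  define \<psi> where "\<psi> = (\<lambda>s. complex_of_real (F s))"
  have spsi: "smooth_on UNIV \<psi>" unfolding \<psi>_def by (rule smooth_on_of_real[OF sF])
  have ppsi: "\<psi> (s + L) = \<psi> s" for s by (simp add: \<psi>_def FD(6))
  have dpsi: "frechet_derivative \<psi> (at s) 1 = of_real (F1 s)" for s
    using vector_derivative_unique_at[OF smooth_on_has_vector_derivative[OF spsi]]
      has_vector_derivative_of_real[OF FD(1)]
    unfolding \<psi>_def by blast
  have u: "(\<lambda>p. \<psi> (fst p) * fourier_char 0 0 (snd p)) = (\<lambda>p. complex_of_real (F (fst p)))"
    by (rule ext) (simp add: \<psi>_def fourier_char_def split_beta)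
  have uS: "(\<lambda>p. complex_of_real (F (fst p))) \<in> smooth_functions L"
    using smooth_mode_function[OF spsi ppsi, of 0 0] unfolding u .
  have "smooth_on UNIV (\<lambda>p::coords. complex_of_real (\<Lambda> / 2) * complex_of_real (F (fst p)))"
    by (intro smooth_on_mult smooth_on_const) (use uS in \<open>simp add: smooth_functions_def\<close>)
  moreover have "periodic L (\<lambda>p::coords. complex_of_real (\<Lambda> / 2) * complex_of_real (F (fst p)))"
    using FD(6) by (simp add: periodic_def)
  ultimately have gS: "(\<lambda>p. complex_of_real (\<Lambda> / 2) * complex_of_real (F (fst p))) \<in> smooth_functions L"
    unfolding smooth_functions_def by (intro CollectI conjI)
  have "(LINT p|vol L \<kappa>. complex_of_real (\<Lambda> / 2) * complex_of_real (F (fst p)) * cnj (f p)) =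
      (LINT p|vol L \<kappa>. cvec_apply (cvec_cnj (Z p)) (\<lambda>p. complex_of_real (F (fst p))) p * cnj (cvec_apply (cvec_cnj (Z p)) f p))"
    if f: "f \<in> smooth_functions L" for f
  proof -
    have sf: "smooth_on UNIV f" and pf: "periodic L f" using f by (auto simp: smooth_functions_def)
    define q where "q = fourier_mode 0 0 f"
    have sq: "smooth_on UNIV q" unfolding q_def by (rule smooth_fourier_mode[OF sf])
    have pq: "q (s + L) = q s" for s unfolding q_def by (rule fourier_mode_periodic[OF pf])
    define q1 where "q1 = (\<lambda>s. frechet_derivative q (at s) 1)"
    have sq1: "smooth_on UNIV q1" unfolding q1_def by (rule smooth_on_frechet[OF sq])
    have dq: "(q has_vector_derivative q1 s) (at s)" for s unfolding q1_def by (rule smooth_on_has_vector_derivative[OF sq])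
    note c = smooth_on_continuous[OF sq] smooth_on_continuous[OF sq1] continuous_curvature FD
    have A: "(LINT p|vol L \<kappa>. f p * cnj (complex_of_real (F (fst p)))) = integral {0..L} (\<lambda>s. of_real (\<kappa> s) * q s * of_real (F s))"
      using inner_product_mode_function[OF sf spsi, of 0 0, folded q_def]
      by (simp add: \<psi>_def fourier_char_def split_beta)
    have B: "(LINT p|vol L \<kappa>. cvec_apply (cvec_cnj (Z p)) f p * cnj (cvec_apply (cvec_cnj (Z p)) (\<lambda>p. complex_of_real (F (fst p))) p))
      = 1 / 2 * integral {0..L} (\<lambda>s. q1 s * of_real (F1 s))"
      using dirichlet_form_mode_function[OF Z f spsi ppsi, of 0 0] unfolding u dpsi by (simp add: q1_def q_def)
    have "((\<lambda>s. q s * of_real (F1 s)) has_vector_derivative q s * of_real (- \<Lambda> * (\<kappa> s * F s)) + q1 s * of_real (F1 s)) (at s)" for s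
      by (intro has_vector_derivative_mult dq has_vector_derivative_of_real FD(2))
    then have "integral {0..L} (\<lambda>s. q s * of_real (- \<Lambda> * (\<kappa> s * F s)) + q1 s * of_real (F1 s)) = 0"
      by (rule integral_of_periodic_derivative[OF _ _ L_pos]) (use pq[of 0] FD(7)[of 0] in simp)
    also have "(\<lambda>s. q s * of_real (- \<Lambda> * (\<kappa> s * F s)) + q1 s * of_real (F1 s))
       = (\<lambda>s. (- of_real \<Lambda>) * (of_real (\<kappa> s) * q s * of_real (F s)) + q1 s * of_real (F1 s))"
      by (rule ext) simp
    also have "integral {0..L} \<dots> = integral {0..L} (\<lambda>s. (- of_real \<Lambda>) * (of_real (\<kappa> s) * q s * of_real (F s)))
       + integral {0..L} (\<lambda>s. q1 s * of_real (F1 s))"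
      by (intro integral_add integrable_continuous_real continuous_intros c)
    finally have C: "1 / 2 * integral {0..L} (\<lambda>s. q1 s * of_real (F1 s))
       = of_real (\<Lambda> / 2) * integral {0..L} (\<lambda>s. of_real (\<kappa> s) * q s * of_real (F s))"
      unfolding integral_mult_right by simp
    have "(LINT p|vol L \<kappa>. complex_of_real (\<Lambda> / 2) * complex_of_real (F (fst p)) * cnj (f p))
       = (LINT p|vol L \<kappa>. cnj (of_real (\<Lambda> / 2) * (f p * cnj (complex_of_real (F (fst p))))))"
      by (simp add: mult_ac)
    also have "\<dots> = cnj (of_real (\<Lambda> / 2) * (LINT p|vol L \<kappa>. f p * cnj (complex_of_real (F (fst p)))))"
      by (simp only: Bochner_Integration.integral_cnj integral_mult_right_zero)
    also have "\<dots> = cnj (LINT p|vol L \<kappa>. cvec_apply (cvec_cnj (Z p)) f p * cnj (cvec_apply (cvec_cnj (Z p)) (\<lambda>p. complex_of_real (F (fst p))) p))"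
      unfolding A B C ..
    also have "\<dots> = (LINT p|vol L \<kappa>. cvec_apply (cvec_cnj (Z p)) (\<lambda>p. complex_of_real (F (fst p))) p * cnj (cvec_apply (cvec_cnj (Z p)) f p))"
      unfolding Bochner_Integration.integral_cnj[symmetric] by (simp add: mult.commute)
    finally show ?thesis .
  qed
  then show ?thesis using uS gS unfolding kohn_laplacian_def by blast
qed

lemma smooth_functions_L2:
  assumes "U \<in> smooth_functions L" shows "U \<in> L2 (vol L \<kappa>)"
proof -
  have c: "continuous_on UNIV U" using assms smooth_on_continuous by (auto simp: smooth_functions_def)
  have "integrable (vol L \<kappa>) U" "integrable (vol L \<kappa>) (\<lambda>p. (cmod (U p))\<^sup>2)"
    by (intro vol_integral(1) c continuous_intros)+
  then show ?thesis by (simp add: L2_def borel_measurable_integrable)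
qed

lemma kohn_eigenvalue_of_ode:
  assumes Z: "normalized_frame \<xi> \<eta> L Z" and F: "c2_periodic L F F1 (\<lambda>s. - \<Lambda> * (\<kappa> s * F s))"
    and n: "integral {0..L} (\<lambda>s. \<kappa> s * (F s)\<^sup>2) \<noteq> 0"
  shows "kohn_eigenvalue L \<kappa> Z (\<Lambda> / 2)"
proof -
  let ?u = "\<lambda>p::coords. complex_of_real (F (fst p))"
  let ?g = "\<lambda>p. complex_of_real (\<Lambda> / 2) * ?u p"
  have K: "kohn_laplacian L \<kappa> Z ?u ?g" by (rule kohn_laplacian_of_ode[OF Z F])
  then have "?u \<in> smooth_functions L" "?g \<in> smooth_functions L" unfolding kohn_laplacian_def by blast+
  note L2 = this[THEN smooth_functions_L2]
  have cl: "kohn_laplacian_closure L \<kappa> Z ?u ?g"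
    unfolding kohn_laplacian_closure_def
    by (intro conjI L2 exI[of _ "\<lambda>n. ?u"] exI[of _ "\<lambda>n. ?g"] allI K) (simp_all add: L2_tendsto_def)
  have "\<not> (AE p in vol L \<kappa>. ?u p = 0)"
  proof
    assume "AE p in vol L \<kappa>. ?u p = 0"
    then have "AE p in vol L \<kappa>. (F (fst p))\<^sup>2 = 0" by eventually_elim simp
    then have "(LINT p|vol L \<kappa>. (F (fst p))\<^sup>2) = 0" by (rule integral_eq_zero_AE)
    moreover have "(LINT p|vol L \<kappa>. (F (fst p))\<^sup>2) = integral {0..L} (\<lambda>s. \<kappa> s *\<^sub>R integral torus (\<lambda>t. (F (fst (s, t)))\<^sup>2))"
      by (intro vol_integral(2) continuous_intros continuous_on_compose2[OF c2_periodicD(3)[OF F, of UNIV]]) auto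
    moreover have "\<dots> = integral {0..L} (\<lambda>s. (4 * pi\<^sup>2) * (\<kappa> s * (F s)\<^sup>2))"
      by (simp add: content_Pair power2_eq_square mult_ac)
    ultimately show False using n by simp
  qed
  then show ?thesis using cl unfolding kohn_eigenvalue_def by (intro exI[of _ ?u] conjI)
qed

end


section \<open>Eigenvalues of the closure over a circle\<close>

lemma integral_sq_le:
  fixes u :: "real \<Rightarrow> real"
  assumes c: "continuous_on {0..L} u" and L: "L > 0"
  shows "(integral {0..L} u)\<^sup>2 \<le> L * integral {0..L} (\<lambda>s. (u s)\<^sup>2)"
proof -
  define m where "m = integral {0..L} u / L"
  have i: "(\<lambda>s. (u s)\<^sup>2) integrable_on {0..L}" "(\<lambda>s. 2 * m * u s) integrable_on {0..L}" "(\<lambda>s. m\<^sup>2) integrable_on {0..L}"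
    by (intro integrable_continuous_real continuous_intros c)+
  have "0 \<le> integral {0..L} (\<lambda>s. (u s)\<^sup>2 - 2 * m * u s + m\<^sup>2)"
  proof (rule integral_nonneg)
    show "(\<lambda>s. (u s)\<^sup>2 - 2 * m * u s + m\<^sup>2) integrable_on {0..L}" by (intro integrable_add integrable_diff i)
    show "0 \<le> (u s)\<^sup>2 - 2 * m * u s + m\<^sup>2" for s
      using zero_le_power2[of "u s - m"] by (simp add: power2_diff mult_ac)
  qed
  also have "\<dots> = integral {0..L} (\<lambda>s. (u s)\<^sup>2) - 2 * m * integral {0..L} u + m\<^sup>2 * L"
    using L by (simp only: integral_add integral_diff integrable_diff i integral_mult_right) simp
  also have "\<dots> = integral {0..L} (\<lambda>s. (u s)\<^sup>2) - (integral {0..L} u)\<^sup>2 / L"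
    using L by (simp add: m_def power2_eq_square field_simps)
  finally show ?thesis using L by (simp add: field_simps)
qed

lemma L2_diff:
  assumes "u \<in> L2 N" "v \<in> L2 N"
  shows "(\<lambda>p. u p - v p) \<in> L2 N"
    and "(LINT p|N. (cmod (u p - v p))\<^sup>2) \<le> 2 * (LINT p|N. (cmod (u p))\<^sup>2) + 2 * (LINT p|N. (cmod (v p))\<^sup>2)"
proof -
  have pt: "(cmod (a - b))\<^sup>2 \<le> 2 * (cmod a)\<^sup>2 + 2 * (cmod b)\<^sup>2" for a b :: complex
  proof -
    have "(cmod (a - b))\<^sup>2 \<le> (cmod a + cmod b)\<^sup>2" by (intro power_mono norm_triangle_ineq4) simp
    also have "\<dots> \<le> 2 * (cmod a)\<^sup>2 + 2 * (cmod b)\<^sup>2"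
      using zero_le_power2[of "cmod a - cmod b"] by (simp add: power2_eq_square algebra_simps)
    finally show ?thesis .
  qed
  have m: "u \<in> borel_measurable N" "v \<in> borel_measurable N"
    and i: "integrable N (\<lambda>p. (cmod (u p))\<^sup>2)" "integrable N (\<lambda>p. (cmod (v p))\<^sup>2)"
    using assms by (auto simp: L2_def)
  have i2: "integrable N (\<lambda>p. 2 * (cmod (u p))\<^sup>2 + 2 * (cmod (v p))\<^sup>2)"
    using i by simp
  have m2: "(\<lambda>p. u p - v p) \<in> borel_measurable N" using m by simp
  have id: "integrable N (\<lambda>p. (cmod (u p - v p))\<^sup>2)"
    by (rule Bochner_Integration.integrable_bound[OF i2]) (use m2 pt in \<open>auto intro!: AE_I2 order_trans[OF pt]\<close>)
  then show "(\<lambda>p. u p - v p) \<in> L2 N" using m2 by (simp add: L2_def)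
  have "(LINT p|N. (cmod (u p - v p))\<^sup>2) \<le> (LINT p|N. 2 * (cmod (u p))\<^sup>2 + 2 * (cmod (v p))\<^sup>2)"
    by (rule integral_mono[OF id i2 pt])
  also have "\<dots> = 2 * (LINT p|N. (cmod (u p))\<^sup>2) + 2 * (LINT p|N. (cmod (v p))\<^sup>2)" using i by simp
  finally show "(LINT p|N. (cmod (u p - v p))\<^sup>2) \<le> 2 * (LINT p|N. (cmod (u p))\<^sup>2) + 2 * (LINT p|N. (cmod (v p))\<^sup>2)" .
qed

lemma L2_triangle:
  assumes "u \<in> L2 N" "v \<in> L2 N" "w \<in> L2 N"
  shows "(LINT p|N. (cmod (u p - v p))\<^sup>2) \<le> 2 * (LINT p|N. (cmod (u p - w p))\<^sup>2) + 2 * (LINT p|N. (cmod (v p - w p))\<^sup>2)"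
  using L2_diff(2)[OF L2_diff(1)[OF assms(1,3)] L2_diff(1)[OF assms(2,3)]] by simp

text \<open>Bessel's inequality for one coefficient: \<open>\<integral> \<bar>W - q e\<bar>\<^sup>2 \<ge> 0\<close> for the optimal multiple \<open>q\<close> of the character
  \<open>e\<close>; \<open>4 \<pi>\<^sup>2\<close> is the area of the torus.\<close>

lemma fourier_mode_bessel:
  assumes c: "continuous_on UNIV W"
  shows "(cmod (fourier_mode m n W s))\<^sup>2 \<le> 4 * pi\<^sup>2 * integral torus (\<lambda>t. (cmod (W (s, t)))\<^sup>2)"
proof -
  define A where "A = fourier_mode m n W s"
  define q where "q = A / of_real (4 * pi\<^sup>2)"
  let ?e = "fourier_char m n"
  have cW: "continuous_on B (\<lambda>t. W (s, t))" for B
    by (intro continuous_on_compose2[OF c] continuous_intros) auto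
  have e1: "cmod (?e t) = 1" for t by (cases t) (simp add: fourier_char_def)
  have pt: "(cmod (W (s, t)))\<^sup>2 - 2 * Re (cnj q * (W (s, t) * cnj (?e t))) + (cmod q)\<^sup>2 = (cmod (W (s, t) - q * ?e t))\<^sup>2" for t
  proof -
    have "complex_of_real ((cmod (W (s, t) - q * ?e t))\<^sup>2) = (W (s, t) - q * ?e t) * cnj (W (s, t) - q * ?e t)"
      by (rule complex_norm_square)
    also have "\<dots> = W (s, t) * cnj (W (s, t)) - (cnj q * (W (s, t) * cnj (?e t)) + cnj (cnj q * (W (s, t) * cnj (?e t))))
       + (q * cnj q) * (?e t * cnj (?e t))" by (simp add: algebra_simps)
    also have "\<dots> = of_real ((cmod (W (s, t)))\<^sup>2 - 2 * Re (cnj q * (W (s, t) * cnj (?e t))) + (cmod q)\<^sup>2)"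
      unfolding complex_norm_square[symmetric] e1 complex_add_cnj by simp
    finally show ?thesis by (simp only: of_real_eq_iff)
  qed
  have i: "(\<lambda>t. (cmod (W (s, t)))\<^sup>2) integrable_on torus" "(\<lambda>t. 2 * Re (cnj q * (W (s, t) * cnj (?e t)))) integrable_on torus"
    "(\<lambda>t. (cmod q)\<^sup>2) integrable_on torus"
    by (intro integrable_continuous continuous_intros cW continuous_fourier_char)+
  have iA: "(\<lambda>t. cnj q * (W (s, t) * cnj (?e t))) integrable_on torus"
    by (intro integrable_continuous continuous_intros cW continuous_fourier_char)
  have "0 \<le> integral torus (\<lambda>t. (cmod (W (s, t)))\<^sup>2 - 2 * Re (cnj q * (W (s, t) * cnj (?e t))) + (cmod q)\<^sup>2)"
    unfolding pt by (intro integral_nonneg integrable_continuous continuous_intros cW continuous_fourier_char) simp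
  also have "integral torus (\<lambda>t. (cmod (W (s, t)))\<^sup>2 - 2 * Re (cnj q * (W (s, t) * cnj (?e t))) + (cmod q)\<^sup>2)
     = integral torus (\<lambda>t. (cmod (W (s, t)))\<^sup>2) - integral torus (\<lambda>t. 2 * Re (cnj q * (W (s, t) * cnj (?e t))))
      + integral torus (\<lambda>t. (cmod q)\<^sup>2)"
    by (simp only: integral_add integral_diff integrable_diff i)
  also have "integral torus (\<lambda>t. 2 * Re (cnj q * (W (s, t) * cnj (?e t)))) = 2 * Re (cnj q * A)"
  proof -
    have "integral torus (\<lambda>t. Re (cnj q * (W (s, t) * cnj (?e t)))) = Re (integral torus (\<lambda>t. cnj q * (W (s, t) * cnj (?e t))))"
      using integral_linear[OF iA bounded_linear_Re] by (simp add: o_def)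
    then show ?thesis by (simp only: A_def fourier_mode_def integral_mult_right)
  qed
  also have "integral torus (\<lambda>t. (cmod q)\<^sup>2) = 4 * pi\<^sup>2 * (cmod q)\<^sup>2"
    by (simp add: content_Pair power2_eq_square)
  also have "Re (cnj q * A) = (cmod A)\<^sup>2 / (4 * pi\<^sup>2)"
  proof -
    have "cnj q * A = of_real ((cmod A)\<^sup>2 / (4 * pi\<^sup>2))"
      unfolding q_def of_real_divide complex_norm_square by simp
    then show ?thesis by (simp only: Re_complex_of_real)
  qed
  also have "4 * pi\<^sup>2 * (cmod q)\<^sup>2 = (cmod A)\<^sup>2 / (4 * pi\<^sup>2)"
    unfolding q_def norm_divide norm_of_real by (simp add: power_divide power2_eq_square)
  finally show ?thesis by (simp add: A_def field_simps)
qed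

text \<open>Match the initial values and use conservation of the energy \<open>d'\<^sup>2 + c\<^sup>2 d\<^sup>2\<close> of the difference \<open>d\<close>. This
  finds the axis of symmetry \<open>s0\<close> of the potential of a mode.\<close>

lemma harmonic_oscillator_solution:
  fixes g g1 :: "real \<Rightarrow> real"
  assumes c: "c > 0" and g: "\<And>s. (g has_real_derivative g1 s) (at s)"
    and g1: "\<And>s. (g1 has_real_derivative - c\<^sup>2 * g s) (at s)"
  obtains A s0 where "\<And>s. g s = A * sin (c * (s - s0))" "\<And>s. g1 s = A * c * cos (c * (s - s0))"
proof -
  define z where "z = Complex (g1 0 / c) (- g 0)"
  define s0 where "s0 = Arg z / c"
  define A where "A = cmod z"
  have zA: "z = rcis A (Arg z)" by (simp add: A_def rcis_cmod_Arg)
  have g0: "g 0 = A * sin (c * (0 - s0))" and g10: "g1 0 = A * c * cos (c * (0 - s0))"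
  proof -
    have "Re z = A * cos (Arg z)" "Im z = A * sin (Arg z)"
      using arg_cong[OF zA, of Re] arg_cong[OF zA, of Im] by (simp_all only: Re_rcis Im_rcis)
    then show "g 0 = A * sin (c * (0 - s0))" "g1 0 = A * c * cos (c * (0 - s0))"
      using c by (simp_all add: z_def s0_def field_simps)
  qed
  define d d1 where "d = (\<lambda>s. g s - A * sin (c * (s - s0)))" and "d1 = (\<lambda>s. g1 s - A * c * cos (c * (s - s0)))"
  have dd: "(d has_real_derivative d1 s) (at s)" "(d1 has_real_derivative - c\<^sup>2 * d s) (at s)" for s
    unfolding d_def d1_def by (auto intro!: derivative_eq_intros g g1 simp: power2_eq_square algebra_simps)
  have "((\<lambda>s. (d1 s)\<^sup>2 + c\<^sup>2 * (d s)\<^sup>2) has_real_derivative 0) (at s)" for s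
    by (auto intro!: derivative_eq_intros dd simp: power2_eq_square)
  then have "(d1 s)\<^sup>2 + c\<^sup>2 * (d s)\<^sup>2 = (d1 0)\<^sup>2 + c\<^sup>2 * (d 0)\<^sup>2" for s
    using DERIV_isconst_all[of "\<lambda>s. (d1 s)\<^sup>2 + c\<^sup>2 * (d s)\<^sup>2"] by blast
  then have "(d1 s)\<^sup>2 + (c * d s)\<^sup>2 = 0" for s using g0 g10 by (simp add: d_def d1_def power_mult_distrib)
  then have "d1 s = 0" "c * d s = 0" for s by (simp_all only: sum_power2_eq_zero_iff)
  then have "g s = A * sin (c * (s - s0))" "g1 s = A * c * cos (c * (s - s0))" for s
    using c by (simp_all add: d_def d1_def)
  then show thesis by (rule that)
qed

lemma continuous_trig_poly: "trig_poly L P \<Longrightarrow> continuous_on A P"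
proof (induction rule: trig_poly.induct)
  case (trig_poly_char a k m n)
  then show ?case unfolding torus_char_def split_beta by (intro continuous_intros)
next
  case (trig_poly_add P Q) then show ?case by (intro continuous_intros)
qed

context reinhardt_curve
begin

text \<open>The operator of a mode has real coefficients, so the real bound applies to real and imaginary
  parts separately.\<close>

lemma circle_fourier_mode_bound:
  fixes m n :: int
  assumes Z: "normalized_frame \<xi> \<eta> L Z" and K: "kohn_laplacian L \<kappa> Z U G"
    and c: "\<And>s. \<kappa> s = c" "L = 2 * pi / c" and mu: "0 < \<mu>" "\<mu> < c / 2"
  defines "f \<equiv> fourier_mode m n U" and "h \<equiv> fourier_mode m n G"
  shows "integral {0..L} (\<lambda>s. (cmod (f s))\<^sup>2)
    \<le> ((c / 2 / (\<mu> * (c / 2 - \<mu>)))\<^sup>2 + 2 / (\<mu> * (c / 2 - \<mu>))) * integral {0..L} (\<lambda>s. (cmod (h s - of_real \<mu> * f s))\<^sup>2)"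
proof -
  have c0: "c > 0" using curvature_pos[of 0] c by simp
  have sU: "smooth_on UNIV U" and pU: "periodic L U" and sG: "smooth_on UNIV G"
    using K by (auto simp: kohn_laplacian_def smooth_functions_def)
  have sf: "smooth_on UNIV f" and sh: "smooth_on UNIV h"
    unfolding f_def h_def by (rule smooth_fourier_mode[OF sU], rule smooth_fourier_mode[OF sG])
  define f1 where "f1 = (\<lambda>s. frechet_derivative f (at s) 1)"
  define f2 where "f2 = (\<lambda>s. frechet_derivative f1 (at s) 1)"
  have sf1: "smooth_on UNIV f1" unfolding f1_def by (rule smooth_on_frechet[OF sf])
  have sf2: "smooth_on UNIV f2" unfolding f2_def by (rule smooth_on_frechet[OF sf1])
  have df: "(f has_vector_derivative f1 s) (at s)" for s
    unfolding f1_def by (rule smooth_on_has_vector_derivative[OF sf])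
  have df1: "(f1 has_vector_derivative f2 s) (at s)" for s
    unfolding f2_def by (rule smooth_on_has_vector_derivative[OF sf1])
  have pf: "f (s + L) = f s" for s unfolding f_def by (rule fourier_mode_periodic[OF pU])
  define g where "g = (\<lambda>s. of_int m * deriv \<xi> s + of_int n * deriv \<eta> s)"
  define g1 where "g1 = (\<lambda>s. c * (of_int n * deriv \<xi> s - of_int m * deriv \<eta> s))"
  have dg: "(g has_real_derivative g1 s) (at s)" "(g1 has_real_derivative - c\<^sup>2 * g s) (at s)" for s
    unfolding g_def g1_def
    by (auto intro!: derivative_eq_intros DERIV_xi' DERIV_eta' simp: c(1) power2_eq_square algebra_simps)
  obtain A s0 where A: "\<And>s. g s = A * sin (c * (s - s0))" "\<And>s. g1 s = A * c * cos (c * (s - s0))"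
    using harmonic_oscillator_solution[OF c0 dg] by blast
  define q where "q = (\<lambda>s. A\<^sup>2 * (sin (c * (s - s0)))\<^sup>2 + A * c * cos (c * (s - s0)))"
  have mode: "h s = - (f2 s - of_real (q s) * f s) / of_real (2 * c)" for s
  proof -
    have "of_real c * h s = - (f2 s - of_real (g1 s + (g s)\<^sup>2) * f s) / 2"
      unfolding fun_cong[OF f2_def, of s] using kohn_mode_equation[OF Z K, of s m n]
      unfolding f_def[symmetric] h_def[symmetric] f1_def[symmetric] f2_def[symmetric] g_def g1_def c(1) .
    moreover have "g1 s + (g s)\<^sup>2 = q s" by (simp add: q_def A power_mult_distrib)
    ultimately show ?thesis using c0 by (simp add: field_simps)
  qed
  let ?C = "(c / 2 / (\<mu> * (c / 2 - \<mu>)))\<^sup>2 + 2 / (\<mu> * (c / 2 - \<mu>))"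
  have part: "integral {0..L} (\<lambda>s. (T (f s))\<^sup>2) \<le> ?C * integral {0..L} (\<lambda>s. (T (h s) - \<mu> * T (f s))\<^sup>2)"
    if T: "T = Re \<or> T = Im" for T
  proof -
    have Tl: "bounded_linear T" using T bounded_linear_Re bounded_linear_Im by blast
    have "c2_periodic L (\<lambda>s. T (f s)) (\<lambda>s. T (f1 s)) (\<lambda>s. T (f2 s))"
      unfolding c2_periodic_def has_real_derivative_iff_has_vector_derivative
      using bounded_linear.has_vector_derivative[OF Tl df] bounded_linear.has_vector_derivative[OF Tl df1]
        bounded_linear.continuous_on[OF Tl smooth_on_continuous[OF sf2]] pf by simp
    moreover have "T (h s) = - (T (f2 s) - q s * T (f s)) / (2 * c)" for s
      unfolding mode using T c0 by (auto simp: Re_divide_of_real Im_divide_of_real simp del: of_real_mult)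
    ultimately show ?thesis unfolding q_def by (rule circle_mode_resolvent_bound[OF _ c0 c(2) mu])
  qed
  note cont = smooth_on_continuous[OF sf] smooth_on_continuous[OF sh]
  have "integral {0..L} (\<lambda>s. (cmod (f s))\<^sup>2) = integral {0..L} (\<lambda>s. (Re (f s))\<^sup>2) + integral {0..L} (\<lambda>s. (Im (f s))\<^sup>2)"
    unfolding cmod_power2 by (intro integral_add integrable_continuous_real continuous_intros cont)
  also have "\<dots> \<le> ?C * integral {0..L} (\<lambda>s. (Re (h s) - \<mu> * Re (f s))\<^sup>2) + ?C * integral {0..L} (\<lambda>s. (Im (h s) - \<mu> * Im (f s))\<^sup>2)"
    by (intro add_mono part) auto
  also have "\<dots> = ?C * (integral {0..L} (\<lambda>s. (Re (h s) - \<mu> * Re (f s))\<^sup>2) + integral {0..L} (\<lambda>s. (Im (h s) - \<mu> * Im (f s))\<^sup>2))"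
    by (simp only: distrib_left)
  also have "integral {0..L} (\<lambda>s. (Re (h s) - \<mu> * Re (f s))\<^sup>2) + integral {0..L} (\<lambda>s. (Im (h s) - \<mu> * Im (f s))\<^sup>2)
     = integral {0..L} (\<lambda>s. (Re (h s) - \<mu> * Re (f s))\<^sup>2 + (Im (h s) - \<mu> * Im (f s))\<^sup>2)"
    by (intro integral_add[symmetric] integrable_continuous_real continuous_intros cont)
  also have "\<dots> = integral {0..L} (\<lambda>s. (cmod (h s - of_real \<mu> * f s))\<^sup>2)" by (simp add: cmod_power2)
  finally show ?thesis .
qed

lemma torus_char_mode: "torus_char L k m n p = cis (2 * pi / L * of_int k * fst p) * fourier_char m n (snd p)"
  by (cases p) (simp add: torus_char_def fourier_char_def cis_mult add.assoc)

text \<open>Let \<open>0 < \<mu> < c / 2\<close> and let smooth \<open>U\<^sub>n\<close>, \<open>G\<^sub>n\<close> approximate an eigenfunction \<open>u\<close> and its image \<open>\<mu> u\<close>.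
  Then \<open>W\<^sub>n = G\<^sub>n - \<mu> U\<^sub>n\<close> tends to \<open>0\<close>, hence so does every Fourier mode of \<open>U\<^sub>n\<close>, and \<open>U\<^sub>n\<close> becomes orthogonal to each fixed
  trigonometric polynomial \<open>P\<close>. Choosing \<open>P\<close> close to a fixed \<open>U\<^sub>j\<close> bounds \<open>\<parallel>u\<parallel>\<^sup>2\<close> by a multiple of
  \<open>\<parallel>U\<^sub>j - u\<parallel>\<^sup>2\<close> plus an arbitrarily small error, and \<open>j\<close> is arbitrary.\<close>

lemma circle_eigenvalue_lower_bound:
  assumes Z: "normalized_frame \<xi> \<eta> L Z" and c: "\<And>s. \<kappa> s = c" "L = 2 * pi / c"
    and ev: "kohn_eigenvalue L \<kappa> Z \<mu>" and mu: "\<mu> > 0"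
  shows "c / 2 \<le> \<mu>"
proof (rule ccontr)
  assume "\<not> c / 2 \<le> \<mu>"
  then have mu2: "\<mu> < c / 2" by simp
  have c0: "c > 0" using curvature_pos[of 0] c by simp
  define N where "N = vol L \<kappa>"
  define n2 where "n2 = (\<lambda>v. LINT p|N. (cmod (v p))\<^sup>2)"
  obtain u where u0: "\<not> (AE p in N. u p = 0)" and cl: "kohn_laplacian_closure L \<kappa> Z u (\<lambda>p. of_real \<mu> * u p)"
    using ev unfolding kohn_eigenvalue_def N_def by blast
  have uL: "u \<in> L2 N" and muL: "(\<lambda>p. of_real \<mu> * u p) \<in> L2 N"
    using cl by (auto simp: kohn_laplacian_closure_def N_def)
  obtain U G where UG: "\<And>n. kohn_laplacian L \<kappa> Z (U n) (G n)"
    and limU: "(\<lambda>n. n2 (\<lambda>p. U n p - u p)) \<longlonglongrightarrow> 0" and limG: "(\<lambda>n. n2 (\<lambda>p. G n p - of_real \<mu> * u p)) \<longlonglongrightarrow> 0"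
    using cl unfolding kohn_laplacian_closure_def L2_tendsto_def N_def n2_def by blast
  have US: "U n \<in> smooth_functions L" and GS: "G n \<in> smooth_functions L" for n
    using UG by (auto simp: kohn_laplacian_def)
  have UL: "U n \<in> L2 N" and GL: "G n \<in> L2 N" for n
    unfolding N_def by (rule smooth_functions_L2[OF US], rule smooth_functions_L2[OF GS])
  have cU: "continuous_on A (U n)" and cG: "continuous_on A (G n)" for n A
    using US[of n] GS[of n] smooth_on_continuous by (auto simp: smooth_functions_def)
  define W where "W = (\<lambda>n p. G n p - of_real \<mu> * U n p)"
  have cW: "continuous_on A (W n)" for n A unfolding W_def by (intro continuous_intros cU cG)
  have W0: "(\<lambda>n. n2 (W n)) \<longlonglongrightarrow> 0"
  proof (rule Lim_null_comparison[OF always_eventually])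
    show "\<forall>n. norm (n2 (W n)) \<le> 2 * n2 (\<lambda>p. G n p - of_real \<mu> * u p) + 2 * (\<mu>\<^sup>2 * n2 (\<lambda>p. U n p - u p))"
    proof
      fix n
      have "(\<lambda>p. of_real \<mu> * U n p) \<in> L2 N"
        using UL[of n] by (auto simp: L2_def norm_mult power_mult_distrib)
      from L2_triangle[OF GL[of n] this muL]
      have "n2 (W n) \<le> 2 * n2 (\<lambda>p. G n p - of_real \<mu> * u p) + 2 * n2 (\<lambda>p. of_real \<mu> * U n p - of_real \<mu> * u p)"
        by (simp add: n2_def W_def)
      also have "n2 (\<lambda>p. of_real \<mu> * U n p - of_real \<mu> * u p) = \<mu>\<^sup>2 * n2 (\<lambda>p. U n p - u p)"
        unfolding n2_def right_diff_distrib[symmetric] norm_mult power_mult_distrib by simp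
      finally show "norm (n2 (W n)) \<le> 2 * n2 (\<lambda>p. G n p - of_real \<mu> * u p) + 2 * (\<mu>\<^sup>2 * n2 (\<lambda>p. U n p - u p))"
        by (simp add: n2_def)
    qed
    have "(\<lambda>n. 2 * n2 (\<lambda>p. G n p - of_real \<mu> * u p) + 2 * (\<mu>\<^sup>2 * n2 (\<lambda>p. U n p - u p))) \<longlonglongrightarrow> 2 * 0 + 2 * (\<mu>\<^sup>2 * 0)"
      by (intro tendsto_intros limU limG)
    then show "(\<lambda>n. 2 * n2 (\<lambda>p. G n p - of_real \<mu> * u p) + 2 * (\<mu>\<^sup>2 * n2 (\<lambda>p. U n p - u p))) \<longlonglongrightarrow> 0" by simp
  qed
  define C where "C = (c / 2 / (\<mu> * (c / 2 - \<mu>)))\<^sup>2 + 2 / (\<mu> * (c / 2 - \<mu>))"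
  have C0: "C \<ge> 0" using mu mu2 by (simp add: C_def)
  have mode_bound: "integral {0..L} (\<lambda>s. (cmod (fourier_mode m k (U n) s))\<^sup>2) \<le> C * (4 * pi\<^sup>2 / c * n2 (W n))" for m k n
  proof -
    have WE: "fourier_mode m k (G n) s - of_real \<mu> * fourier_mode m k (U n) s = fourier_mode m k (W n) s" for s
    proof -
      have "(\<lambda>t. G n (s, t) * cnj (fourier_char m k t)) integrable_on torus"
        "(\<lambda>t. of_real \<mu> * (U n (s, t) * cnj (fourier_char m k t))) integrable_on torus"
        by (intro integrable_continuous continuous_intros continuous_fourier_char
            continuous_on_compose2[OF cU[of UNIV]] continuous_on_compose2[OF cG[of UNIV]]; simp)+
      from integral_diff[OF this] show ?thesis
        by (simp add: fourier_mode_def W_def left_diff_distrib mult.assoc)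
    qed
    have cm: "continuous_on A (fourier_mode m k (W n))" for A
      unfolding WE[symmetric]
      by (intro continuous_intros smooth_on_continuous[OF smooth_fourier_mode])
         (use US[of n] GS[of n] in \<open>auto simp: smooth_functions_def\<close>)
    have ct: "continuous_on A (\<lambda>s. integral torus (\<lambda>t. (cmod (W n (s, t)))\<^sup>2))" for A
      by (rule integral_continuous_on_param) (auto intro!: continuous_intros cW simp: split_beta)
    have "integral {0..L} (\<lambda>s. (cmod (fourier_mode m k (W n) s))\<^sup>2)
       \<le> integral {0..L} (\<lambda>s. 4 * pi\<^sup>2 * integral torus (\<lambda>t. (cmod (W n (s, t)))\<^sup>2))"
      by (intro integral_le integrable_continuous_real continuous_intros cm ct fourier_mode_bessel cW)
    also have "\<dots> = 4 * pi\<^sup>2 / c * integral {0..L} (\<lambda>s. c *\<^sub>R integral torus (\<lambda>t. (cmod (W n (s, t)))\<^sup>2))"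
      using c0 by simp
    also have "\<dots> = 4 * pi\<^sup>2 / c * n2 (W n)"
    proof -
      have "continuous_on UNIV (\<lambda>p. (cmod (W n p))\<^sup>2)" by (intro continuous_intros cW)
      from vol_integral(2)[OF this] show ?thesis by (simp add: n2_def N_def c(1))
    qed
    finally have "C * integral {0..L} (\<lambda>s. (cmod (fourier_mode m k (W n) s))\<^sup>2) \<le> C * (4 * pi\<^sup>2 / c * n2 (W n))"
      using C0 by (rule mult_left_mono)
    then show ?thesis
      using circle_fourier_mode_bound[OF Z UG[of n] c mu mu2, of m k] unfolding WE C_def by linarith
  qed
  have char0: "(\<lambda>n. LINT p|N. U n p * cnj (torus_char L j m k p)) \<longlonglongrightarrow> 0" for j m k
  proof -
    have "bounded_linear (\<lambda>s. 2 * pi / L * of_int j * s)" by (rule bounded_linear_mult_right)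
    from smooth_on_compose_linear[OF this smooth_on_cis]
    have sp: "smooth_on UNIV (\<lambda>s. cis (2 * pi / L * of_int j * s))" .
    have "(cmod (LINT p|N. U n p * cnj (torus_char L j m k p)))\<^sup>2 \<le> c\<^sup>2 * (L * (C * (4 * pi\<^sup>2 / c * n2 (W n))))" for n
    proof -
      have sUn: "smooth_on UNIV (U n)" using US by (auto simp: smooth_functions_def)
      note cf = smooth_on_continuous[OF smooth_fourier_mode[OF sUn]]
      have "(LINT p|N. U n p * cnj (torus_char L j m k p))
         = integral {0..L} (\<lambda>s. of_real c * fourier_mode m k (U n) s * cnj (cis (2 * pi / L * of_int j * s)))"
        unfolding N_def torus_char_mode inner_product_mode_function[OF sUn sp] c(1) ..
      also have "cmod \<dots> \<le> integral {0..L} (\<lambda>s. c * cmod (fourier_mode m k (U n) s))"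
        by (intro integral_norm_bound_integral integrable_continuous_real continuous_intros cf smooth_on_continuous[OF sp])
           (use c0 in \<open>simp add: norm_mult\<close>)
      also have "\<dots> = c * integral {0..L} (\<lambda>s. cmod (fourier_mode m k (U n) s))" by simp
      finally have "(cmod (LINT p|N. U n p * cnj (torus_char L j m k p)))\<^sup>2 \<le> (c * integral {0..L} (\<lambda>s. cmod (fourier_mode m k (U n) s)))\<^sup>2"
        by (rule power_mono) simp
      also have "\<dots> = c\<^sup>2 * (integral {0..L} (\<lambda>s. cmod (fourier_mode m k (U n) s)))\<^sup>2" by (rule power_mult_distrib)
      also have "\<dots> \<le> c\<^sup>2 * (L * integral {0..L} (\<lambda>s. (cmod (fourier_mode m k (U n) s))\<^sup>2))"
        by (intro mult_left_mono integral_sq_le continuous_intros cf L_pos) simp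
      also have "\<dots> \<le> c\<^sup>2 * (L * (C * (4 * pi\<^sup>2 / c * n2 (W n))))"
        using L_pos by (intro mult_left_mono mode_bound) auto
      finally show ?thesis .
    qed
    moreover have "(\<lambda>n. c\<^sup>2 * (L * (C * (4 * pi\<^sup>2 / c * n2 (W n))))) \<longlonglongrightarrow> c\<^sup>2 * (L * (C * (4 * pi\<^sup>2 / c * 0)))"
      by (intro tendsto_intros W0)
    then have "(\<lambda>n. c\<^sup>2 * (L * (C * (4 * pi\<^sup>2 / c * n2 (W n))))) \<longlonglongrightarrow> 0" by simp
    ultimately have "(\<lambda>n. (cmod (LINT p|N. U n p * cnj (torus_char L j m k p)))\<^sup>2) \<longlonglongrightarrow> 0"
      by (rule_tac Lim_null_comparison[OF always_eventually]) auto
    then have "(\<lambda>n. sqrt ((cmod (LINT p|N. U n p * cnj (torus_char L j m k p)))\<^sup>2)) \<longlonglongrightarrow> sqrt 0" by (rule tendsto_real_sqrt)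
    then show ?thesis by (simp add: tendsto_norm_zero_iff)
  qed
  have poly0: "(\<lambda>n. LINT p|N. U n p * cnj (P p)) \<longlonglongrightarrow> 0" if "trig_poly L P" for P
    using that
  proof (induction rule: trig_poly.induct)
    case (trig_poly_char a j m k)
    have "(\<lambda>n. LINT p|N. U n p * cnj (a * torus_char L j m k p)) = (\<lambda>n. cnj a * (LINT p|N. U n p * cnj (torus_char L j m k p)))"
    proof
      fix n
      have "(\<lambda>p. U n p * cnj (a * torus_char L j m k p)) = (\<lambda>p. cnj a * (U n p * cnj (torus_char L j m k p)))"
        by (rule ext) simp
      then show "(LINT p|N. U n p * cnj (a * torus_char L j m k p)) = cnj a * (LINT p|N. U n p * cnj (torus_char L j m k p))"
        by (simp only: integral_mult_right_zero)
    qed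
    then show ?case using tendsto_mult[OF tendsto_const char0, of "cnj a" j m k] by simp
  next
    case (trig_poly_add P Q)
    have i: "integrable N (\<lambda>p. U n p * cnj (R p))" if "trig_poly L R" for R n
      unfolding N_def by (intro vol_integral(1) continuous_intros cU continuous_trig_poly[OF that])
    have "(LINT p|N. U n p * cnj (P p + Q p)) = (LINT p|N. U n p * cnj (P p)) + (LINT p|N. U n p * cnj (Q p))" for n
      unfolding complex_cnj_add distrib_left
      by (rule Bochner_Integration.integral_add[OF i[OF trig_poly_add.hyps(1)] i[OF trig_poly_add.hyps(2)]])
    then show ?case using tendsto_add[OF trig_poly_add.IH] by simp
  qed
  define V where "V = (LINT p|N. (1::real))"
  have V0: "V \<ge> 0" by (simp add: V_def)
  have main: "n2 u \<le> 8 * n2 (\<lambda>p. U j p - u p) + 4 * (e\<^sup>2 * V)" if e: "e > 0" for j e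
  proof -
    obtain P where P: "trig_poly L P" "\<And>p. cmod (U j p - P p) < e"
      using trig_poly_dense[OF cU _ L_pos e, of j] US by (auto simp: smooth_functions_def)
    have cP: "continuous_on A P" for A by (rule continuous_trig_poly[OF P(1)])
    have PL: "P \<in> L2 N"
      unfolding L2_def N_def
      using vol_integral(1)[OF cP] vol_integral(1)[of "\<lambda>p. (cmod (P p))\<^sup>2"] continuous_on_power[OF continuous_on_norm[OF cP]]
      by (auto intro: borel_measurable_integrable)
    have UjP: "n2 (\<lambda>p. U j p - P p) \<le> e\<^sup>2 * V"
    proof -
      have "n2 (\<lambda>p. U j p - P p) \<le> (LINT p|N. e\<^sup>2)"
        unfolding n2_def N_def
      proof (rule integral_mono)
        show "(cmod (U j p - P p))\<^sup>2 \<le> e\<^sup>2" for p using P(2)[of p] by (intro power_mono) auto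
      qed (intro vol_integral(1) continuous_intros cU cP)+
      then show ?thesis by (simp add: V_def mult.commute)
    qed
    \<comment> \<open>three applications of \<open>\<parallel>a - b\<parallel>\<^sup>2 \<le> 2 \<parallel>a\<parallel>\<^sup>2 + 2 \<parallel>b\<parallel>\<^sup>2\<close>; the last bracket tends to \<open>0\<close> with \<open>n\<close>\<close>
    have step: "n2 u \<le> 8 * n2 (\<lambda>p. U j p - u p) + 4 * (e\<^sup>2 * V)
        + (10 * n2 (\<lambda>p. U n p - u p) + 4 * Re (LINT p|N. U n p * cnj (P p)))" for n
    proof -
      have "n2 (U n) \<le> (LINT p|N. (cmod (U n p - P p))\<^sup>2 + 2 * Re (U n p * cnj (P p)))"
        unfolding n2_def N_def
      proof (rule integral_mono)
        show "(cmod (U n p))\<^sup>2 \<le> (cmod (U n p - P p))\<^sup>2 + 2 * Re (U n p * cnj (P p))" for p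
        proof -
          have "(cmod (U n p - P p))\<^sup>2 + 2 * Re (U n p * cnj (P p)) = (cmod (U n p))\<^sup>2 + (cmod (P p))\<^sup>2"
            unfolding cmod_power2 by (simp add: power2_eq_square algebra_simps)
          then show ?thesis by simp
        qed
      qed (intro vol_integral(1) continuous_intros cU cP)+
      also have "\<dots> = n2 (\<lambda>p. U n p - P p) + 2 * Re (LINT p|N. U n p * cnj (P p))"
      proof -
        have "integrable N (\<lambda>p. (cmod (U n p - P p))\<^sup>2)" "integrable N (\<lambda>p. U n p * cnj (P p))"
          unfolding N_def by (intro vol_integral(1) continuous_intros cU cP)+
        note i = this
        have "integrable N (\<lambda>p. 2 * Re (U n p * cnj (P p)))"
          unfolding N_def by (intro vol_integral(1) continuous_intros cU cP)
        from Bochner_Integration.integral_add[OF i(1) this] show ?thesis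
          by (simp only: n2_def integral_mult_right_zero integral_Re[OF i(2)])
      qed
      finally have 1: "n2 (U n) \<le> n2 (\<lambda>p. U n p - P p) + 2 * Re (LINT p|N. U n p * cnj (P p))" .
      have "n2 (\<lambda>p. U n p - P p) \<le> 2 * n2 (\<lambda>p. U n p - U j p) + 2 * n2 (\<lambda>p. P p - U j p)"
        unfolding n2_def by (rule L2_triangle[OF UL PL UL])
      moreover have "n2 (\<lambda>p. P p - U j p) = n2 (\<lambda>p. U j p - P p)" by (simp add: n2_def norm_minus_commute)
      moreover have "n2 (\<lambda>p. U n p - U j p) \<le> 2 * n2 (\<lambda>p. U n p - u p) + 2 * n2 (\<lambda>p. U j p - u p)"
        unfolding n2_def by (rule L2_triangle[OF UL UL uL])
      moreover have "n2 u \<le> 2 * n2 (U n) + 2 * n2 (\<lambda>p. U n p - u p)"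
        using L2_diff(2)[OF UL[of n] L2_diff(1)[OF UL[of n] uL]] by (simp add: n2_def)
      ultimately show ?thesis using 1 UjP by linarith
    qed
    have "(\<lambda>n. 8 * n2 (\<lambda>p. U j p - u p) + 4 * (e\<^sup>2 * V)
        + (10 * n2 (\<lambda>p. U n p - u p) + 4 * Re (LINT p|N. U n p * cnj (P p))))
        \<longlonglongrightarrow> 8 * n2 (\<lambda>p. U j p - u p) + 4 * (e\<^sup>2 * V) + (10 * 0 + 4 * Re 0)"
      by (intro tendsto_intros limU poly0 P(1))
    from LIMSEQ_le_const[OF this, of "n2 u"] step show ?thesis by auto
  qed
  have main2: "n2 u \<le> 8 * n2 (\<lambda>p. U j p - u p)" for j
  proof (rule field_le_epsilon)
    fix d :: real assume d: "d > 0"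
    define e where "e = sqrt (d / (4 * (V + 1)))"
    have e: "e > 0" using d V0 by (simp add: e_def)
    have "4 * (e\<^sup>2 * V) \<le> 4 * (e\<^sup>2 * (V + 1))" by (simp add: mult_left_mono)
    also have "\<dots> = d"
    proof -
      have "e\<^sup>2 = d / (4 * (V + 1))" using d V0 by (simp add: e_def)
      then show ?thesis using V0 by (simp add: field_simps)
    qed
    finally show "n2 u \<le> 8 * n2 (\<lambda>p. U j p - u p) + d" using main[OF e, of j] by simp
  qed
  have "(\<lambda>j. 8 * n2 (\<lambda>p. U j p - u p)) \<longlonglongrightarrow> 8 * 0" by (intro tendsto_intros limU)
  from LIMSEQ_le_const[OF this, of "n2 u"] main2 have "n2 u \<le> 0" by auto
  moreover have "n2 u \<ge> 0" by (simp add: n2_def)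
  ultimately have "n2 u = 0" by linarith
  then have "(LINT p|N. (cmod (u p))\<^sup>2) = 0" by (simp add: n2_def)
  moreover have "integrable N (\<lambda>p. (cmod (u p))\<^sup>2)" using uL by (simp add: L2_def)
  ultimately have "AE p in N. (cmod (u p))\<^sup>2 = 0"
    using integral_nonneg_eq_0_iff_AE[of N "\<lambda>p. (cmod (u p))\<^sup>2"] by simp
  then have "AE p in N. u p = 0" by eventually_elim simp
  then show False using u0 by blast
qed

end


section \<open>Geometry of the generating curve\<close>

lemma cis_eq_one_imp: "cis a = 1 \<Longrightarrow> \<exists>j::int. a = 2 * pi * of_int j"
  using cis_eq_imp_diff[of a 0] by auto

lemma mem_sphere_prod: "(x, y) \<in> sphere (X, Y) r \<longleftrightarrow> r \<ge> 0 \<and> (x - X)\<^sup>2 + (y - Y)\<^sup>2 = (r::real)\<^sup>2"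
proof -
  have "(x, y) \<in> sphere (X, Y) r \<longleftrightarrow> sqrt ((x - X)\<^sup>2 + (y - Y)\<^sup>2) = r"
    by (simp add: dist_Pair_Pair dist_real_def power2_commute)
  also have "\<dots> \<longleftrightarrow> r \<ge> 0 \<and> (x - X)\<^sup>2 + (y - Y)\<^sup>2 = r\<^sup>2"
    by (metis add_nonneg_nonneg real_sqrt_ge_zero real_sqrt_pow2 real_sqrt_unique zero_le_power2)
  finally show ?thesis .
qed

context reinhardt_curve
begin

text \<open>\<open>T\<close> is the turning angle; the tangent vector rotated back by \<open>T\<close> is constant.\<close>

lemma tangent_rotation:
  assumes T: "\<And>s. (T has_real_derivative \<kappa> s) (at s)"
  shows "Complex (deriv \<xi> s) (deriv \<eta> s) = Complex (deriv \<xi> 0) (deriv \<eta> 0) * cis (T s - T 0)"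
proof -
  define u where "u = (\<lambda>s. deriv \<xi> s * cos (T s) + deriv \<eta> s * sin (T s))"
  define w where "w = (\<lambda>s. deriv \<eta> s * cos (T s) - deriv \<xi> s * sin (T s))"
  have "(u has_real_derivative 0) (at s)" "(w has_real_derivative 0) (at s)" for s
    unfolding u_def w_def by (auto intro!: derivative_eq_intros T DERIV_xi' DERIV_eta' simp: algebra_simps)
  then have uw: "u s = u 0" "w s = w 0" using DERIV_isconst_all by blast+
  have "Complex (deriv \<xi> s) (deriv \<eta> s) = Complex (u s) (w s) * cis (T s)" for s
  proof -
    define C S where CS: "C = cos (T s)" "S = sin (T s)"
    have "C * C + S * S = 1" unfolding CS using sin_cos_squared_add3[of "T s"] by simp
    then have "deriv \<xi> s = deriv \<xi> s * (C * C + S * S)" "deriv \<eta> s = deriv \<eta> s * (C * C + S * S)" by simp_all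
    then show ?thesis unfolding u_def w_def CS[symmetric] by (simp add: complex_eq_iff CS[symmetric] algebra_simps)
  qed
  from this[of s] this[of 0] show ?thesis by (simp add: uw cis_mult mult.assoc)
qed

lemma tangent_nonzero: "Complex (deriv \<xi> s) (deriv \<eta> s) \<noteq> 0"
  using unit_speed[of s] by (auto simp: complex_eq_iff)

text \<open>The tangent vector is periodic, so \<open>\<integral> \<kappa>\<close> is an integer multiple of \<open>2\<pi>\<close>; it is positive because \<open>\<kappa>\<close> is.\<close>

lemma total_curvature_ge: "2 * pi \<le> integral {0..L} \<kappa>"
proof -
  obtain T where T: "\<And>s. (T has_real_derivative \<kappa> s) (at s)"
    using continuous_antiderivative[OF continuous_curvature] by blast
  have I: "integral {0..L} \<kappa> = T L - T 0"
    using T L_pos by (intro integral_of_derivative) (auto simp: has_real_derivative_iff_has_vector_derivative)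
  have "Complex (deriv \<xi> 0) (deriv \<eta> 0) = Complex (deriv \<xi> 0) (deriv \<eta> 0) * cis (T L - T 0)"
    using tangent_rotation[OF T, of L] periodic_xi'[of 0] periodic_eta'[of 0] by simp
  then have "cis (T L - T 0) = 1" using tangent_nonzero by simp
  then obtain j :: int where j: "T L - T 0 = 2 * pi * of_int j" using cis_eq_one_imp by blast
  have "T L - T 0 > 0"
    using weight_integral_pos[OF L_pos continuous_curvature periodic_curvature curvature_pos] I by simp
  then have "j \<ge> 1" unfolding j by (simp add: zero_less_mult_iff)
  then show ?thesis unfolding I j by simp
qed

lemma c2_periodic_tangent:
  "c2_periodic L (deriv \<xi>) (\<lambda>s. - \<kappa> s * deriv \<eta> s) (\<lambda>s. - deriv \<kappa> s * deriv \<eta> s - (\<kappa> s)\<^sup>2 * deriv \<xi> s)"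
  "c2_periodic L (deriv \<eta>) (\<lambda>s. \<kappa> s * deriv \<xi> s) (\<lambda>s. deriv \<kappa> s * deriv \<xi> s - (\<kappa> s)\<^sup>2 * deriv \<eta> s)"
proof -
  note c = smooth_on_continuous[OF smooth_xi'] smooth_on_continuous[OF smooth_eta'] continuous_curvature
    smooth_on_continuous[OF smooth_on_deriv(1)[OF smooth_curvature]]
  show "c2_periodic L (deriv \<xi>) (\<lambda>s. - \<kappa> s * deriv \<eta> s) (\<lambda>s. - deriv \<kappa> s * deriv \<eta> s - (\<kappa> s)\<^sup>2 * deriv \<xi> s)"
    unfolding c2_periodic_def
  proof (intro conjI allI)
    show "((\<lambda>s. - \<kappa> s * deriv \<eta> s) has_real_derivative - deriv \<kappa> s * deriv \<eta> s - (\<kappa> s)\<^sup>2 * deriv \<xi> s) (at s)" for s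
      by (auto intro!: derivative_eq_intros smooth_on_deriv(2)[OF smooth_curvature] DERIV_eta' simp: power2_eq_square algebra_simps)
  qed (intro DERIV_xi' continuous_intros c periodic_xi')+
  show "c2_periodic L (deriv \<eta>) (\<lambda>s. \<kappa> s * deriv \<xi> s) (\<lambda>s. deriv \<kappa> s * deriv \<xi> s - (\<kappa> s)\<^sup>2 * deriv \<eta> s)"
    unfolding c2_periodic_def
  proof (intro conjI allI)
    show "((\<lambda>s. \<kappa> s * deriv \<xi> s) has_real_derivative deriv \<kappa> s * deriv \<xi> s - (\<kappa> s)\<^sup>2 * deriv \<eta> s) (at s)" for s
      by (auto intro!: derivative_eq_intros smooth_on_deriv(2)[OF smooth_curvature] DERIV_xi' simp: power2_eq_square algebra_simps)
  qed (intro DERIV_eta' continuous_intros c periodic_eta')+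
qed

text \<open>\<open>\<kappa> \<xi>' = \<eta>''\<close> and \<open>\<kappa> \<eta>' = - \<xi>''\<close> are derivatives of periodic functions.\<close>

lemma tangent_mean_zero:
  "integral {0..L} (\<lambda>s. \<kappa> s * deriv \<xi> s) = 0" "integral {0..L} (\<lambda>s. \<kappa> s * deriv \<eta> s) = 0"
proof -
  show "integral {0..L} (\<lambda>s. \<kappa> s * deriv \<xi> s) = 0"
    using integral_of_derivative[of 0 L "deriv \<eta>" "\<lambda>s. \<kappa> s * deriv \<xi> s"] DERIV_eta' L_pos periodic_eta'[of 0]
    by (simp add: has_real_derivative_iff_has_vector_derivative)
  have "integral {0..L} (\<lambda>s. - \<kappa> s * deriv \<eta> s) = 0"
    using integral_of_derivative[of 0 L "deriv \<xi>" "\<lambda>s. - \<kappa> s * deriv \<eta> s"] DERIV_xi' L_pos periodic_xi'[of 0]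
    by (simp add: has_real_derivative_iff_has_vector_derivative)
  then show "integral {0..L} (\<lambda>s. \<kappa> s * deriv \<eta> s) = 0" by simp
qed

lemma tangent_energy_sum:
  "integral {0..L} (\<lambda>s. \<kappa> s * (deriv \<xi> s)\<^sup>2) + integral {0..L} (\<lambda>s. \<kappa> s * (deriv \<eta> s)\<^sup>2) = integral {0..L} \<kappa>"
  "integral {0..L} (\<lambda>s. (- \<kappa> s * deriv \<eta> s)\<^sup>2) + integral {0..L} (\<lambda>s. (\<kappa> s * deriv \<xi> s)\<^sup>2) = integral {0..L} (\<lambda>s. (\<kappa> s)\<^sup>2)"
proof -
  note c = smooth_on_continuous[OF smooth_xi'] smooth_on_continuous[OF smooth_eta'] continuous_curvature
  have "integral {0..L} (\<lambda>s. \<kappa> s * (deriv \<xi> s)\<^sup>2) + integral {0..L} (\<lambda>s. \<kappa> s * (deriv \<eta> s)\<^sup>2)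
      = integral {0..L} (\<lambda>s. \<kappa> s * (deriv \<xi> s)\<^sup>2 + \<kappa> s * (deriv \<eta> s)\<^sup>2)"
    by (intro integral_add[symmetric] integrable_continuous_real continuous_intros c)
  also have "(\<lambda>s. \<kappa> s * (deriv \<xi> s)\<^sup>2 + \<kappa> s * (deriv \<eta> s)\<^sup>2) = \<kappa>"
    by (rule ext) (simp only: distrib_left[symmetric] unit_speed mult_1_right)
  finally show "integral {0..L} (\<lambda>s. \<kappa> s * (deriv \<xi> s)\<^sup>2) + integral {0..L} (\<lambda>s. \<kappa> s * (deriv \<eta> s)\<^sup>2) = integral {0..L} \<kappa>" .
  have "integral {0..L} (\<lambda>s. (- \<kappa> s * deriv \<eta> s)\<^sup>2) + integral {0..L} (\<lambda>s. (\<kappa> s * deriv \<xi> s)\<^sup>2)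
      = integral {0..L} (\<lambda>s. (- \<kappa> s * deriv \<eta> s)\<^sup>2 + (\<kappa> s * deriv \<xi> s)\<^sup>2)"
    by (intro integral_add[symmetric] integrable_continuous_real continuous_intros c)
  also have "(\<lambda>s. (- \<kappa> s * deriv \<eta> s)\<^sup>2 + (\<kappa> s * deriv \<xi> s)\<^sup>2) = (\<lambda>s. (\<kappa> s)\<^sup>2)"
  proof
    fix s
    have "(- \<kappa> s * deriv \<eta> s)\<^sup>2 + (\<kappa> s * deriv \<xi> s)\<^sup>2 = (\<kappa> s)\<^sup>2 * ((deriv \<xi> s)\<^sup>2 + (deriv \<eta> s)\<^sup>2)"
      by (simp add: power_mult_distrib algebra_simps)
    then show "(- \<kappa> s * deriv \<eta> s)\<^sup>2 + (\<kappa> s * deriv \<xi> s)\<^sup>2 = (\<kappa> s)\<^sup>2" by (simp add: unit_speed)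
  qed
  finally show "integral {0..L} (\<lambda>s. (- \<kappa> s * deriv \<eta> s)\<^sup>2) + integral {0..L} (\<lambda>s. (\<kappa> s * deriv \<xi> s)\<^sup>2) = integral {0..L} (\<lambda>s. (\<kappa> s)\<^sup>2)" .
qed

lemma periodic_curve_image: "(\<lambda>s. (\<xi> s, \<eta> s)) ` UNIV = (\<lambda>s. (\<xi> s, \<eta> s)) ` {0..<L}"
proof -
  have "(\<xi> s, \<eta> s) \<in> (\<lambda>s. (\<xi> s, \<eta> s)) ` {0..<L}" for s
  proof (rule image_eqI)
    let ?s = "s + of_int (- \<lfloor>s / L\<rfloor>) * L"
    show "?s \<in> {0..<L}"
      using L_pos floor_divide_lower[of L s] floor_divide_upper[of L s] by (auto simp: algebra_simps)
    show "(\<xi> s, \<eta> s) = (\<xi> ?s, \<eta> ?s)"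
      using periodic_int[where h = \<xi>, OF periodic_xi] periodic_int[where h = \<eta>, OF periodic_eta] by metis
  qed
  then show ?thesis by blast
qed

text \<open>The centre of curvature does not move.\<close>

lemma constant_curvature_centre:
  assumes c: "\<And>s. \<kappa> s = c"
  shows "\<xi> s - deriv \<eta> s / c = \<xi> 0 - deriv \<eta> 0 / c" "\<eta> s + deriv \<xi> s / c = \<eta> 0 + deriv \<xi> 0 / c"
proof -
  have c0: "c > 0" using curvature_pos[of 0] c by simp
  have "((\<lambda>s. \<xi> s - deriv \<eta> s / c) has_real_derivative 0) (at s)"
    "((\<lambda>s. \<eta> s + deriv \<xi> s / c) has_real_derivative 0) (at s)" for s
    using c0 by (auto intro!: derivative_eq_intros DERIV_xi DERIV_eta DERIV_xi' DERIV_eta' simp: c)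
  then show "\<xi> s - deriv \<eta> s / c = \<xi> 0 - deriv \<eta> 0 / c" "\<eta> s + deriv \<xi> s / c = \<eta> 0 + deriv \<xi> 0 / c"
    using DERIV_isconst_all[of "\<lambda>s. \<xi> s - deriv \<eta> s / c"] DERIV_isconst_all[of "\<lambda>s. \<eta> s + deriv \<xi> s / c"] by blast+
qed

lemma constant_curvature_tangent:
  assumes c: "\<And>s. \<kappa> s = c"
  shows "Complex (deriv \<xi> s) (deriv \<eta> s) = Complex (deriv \<xi> 0) (deriv \<eta> 0) * cis (c * s)"
proof -
  have "((\<lambda>s. c * s) has_real_derivative \<kappa> s) (at s)" for s
    by (auto intro!: derivative_eq_intros simp: c)
  from tangent_rotation[OF this, of s] show ?thesis by simp
qed

text \<open>The curve stays on the circle around its centre of curvature. It covers that circle because the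
  tangent vector attains every direction.\<close>

lemma constant_curvature_imp_circle:
  assumes c: "\<And>s. \<kappa> s = c"
  shows "(\<lambda>s. (\<xi> s, \<eta> s)) ` {0..<L} = sphere (\<xi> 0 - deriv \<eta> 0 / c, \<eta> 0 + deriv \<xi> 0 / c) (1 / c)"
proof -
  have c0: "c > 0" using curvature_pos[of 0] c by simp
  define X Y where XY: "X = \<xi> 0 - deriv \<eta> 0 / c" "Y = \<eta> 0 + deriv \<xi> 0 / c"
  have pos: "\<xi> s - X = deriv \<eta> s / c" "\<eta> s - Y = - deriv \<xi> s / c" for s
    using constant_curvature_centre[OF c, of s] unfolding XY by (simp_all add: algebra_simps)
  have "(\<lambda>s. (\<xi> s, \<eta> s)) ` UNIV = sphere (X, Y) (1 / c)"
  proof (intro equalityI subsetI)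
    fix q assume "q \<in> (\<lambda>s. (\<xi> s, \<eta> s)) ` UNIV"
    then obtain s where q: "q = (\<xi> s, \<eta> s)" by blast
    have "(deriv \<eta> s / c)\<^sup>2 + (- deriv \<xi> s / c)\<^sup>2 = ((deriv \<xi> s)\<^sup>2 + (deriv \<eta> s)\<^sup>2) / c\<^sup>2"
      by (simp add: power_divide add_divide_distrib)
    then show "q \<in> sphere (X, Y) (1 / c)"
      unfolding q mem_sphere_prod pos using c0 by (simp add: unit_speed power_divide)
  next
    fix q assume q: "q \<in> sphere (X, Y) (1 / c)"
    obtain x y where xy: "q = (x, y)" by (cases q)
    have e1: "(x - X)\<^sup>2 + (y - Y)\<^sup>2 = (1 / c)\<^sup>2" using q unfolding xy mem_sphere_prod by blast
    define z where "z = Complex (- c * (y - Y)) (c * (x - X))"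
    define z0 where "z0 = Complex (deriv \<xi> 0) (deriv \<eta> 0)"
    have z0: "cmod z0 = 1" "z0 \<noteq> 0" using unit_speed[of 0] tangent_nonzero by (simp_all add: z0_def cmod_def)
    have "(cmod z)\<^sup>2 = c\<^sup>2 * ((x - X)\<^sup>2 + (y - Y)\<^sup>2)" unfolding z_def cmod_power2
      by (simp add: power2_eq_square algebra_simps)
    then have "(cmod z)\<^sup>2 = 1" unfolding e1 using c0 by (simp add: power_divide)
    then have "cmod z = 1" using norm_ge_zero[of z] by (auto simp: power2_eq_1_iff)
    then have "cmod (z / z0) = 1" using z0 by (simp add: norm_divide)
    then have "z / z0 = cis (Arg (z / z0))" using rcis_cmod_Arg[of "z / z0"] by (simp add: rcis_def)
    define s where "s = Arg (z / z0) / c"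
    have "z / z0 = cis (c * s)" using \<open>z / z0 = cis _\<close> c0 by (simp add: s_def)
    then have "z = z0 * cis (c * s)" using z0 by (simp add: field_simps)
    then have "z = Complex (deriv \<xi> s) (deriv \<eta> s)"
      by (rule trans) (simp only: z0_def constant_curvature_tangent[OF c, of s])
    then have "deriv \<xi> s = - c * (y - Y)" "deriv \<eta> s = c * (x - X)" by (simp_all add: z_def)
    then have "\<xi> s = x" "\<eta> s = y" using pos[of s] c0 by simp_all
    then show "q \<in> (\<lambda>s. (\<xi> s, \<eta> s)) ` UNIV" unfolding xy by blast
  qed
  then show ?thesis unfolding periodic_curve_image XY .
qed

text \<open>The circle closes up after the arc length \<open>2\<pi> / c\<close>, so a shorter period contradicts the total
  curvature and a longer one injectivity.\<close>

lemma constant_curvature_length: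
  assumes c: "\<And>s. \<kappa> s = c" and inj: "inj_on (\<lambda>s. (\<xi> s, \<eta> s)) {0..<L}"
  shows "L = 2 * pi / c"
proof -
  have c0: "c > 0" using curvature_pos[of 0] c by simp
  have "\<kappa> = (\<lambda>s. c)" by (rule ext) (rule c)
  then have "2 * pi \<le> c * L" using total_curvature_ge L_pos by (simp add: mult.commute)
  then have le: "2 * pi / c \<le> L" using c0 by (simp add: field_simps)
  have "Complex (deriv \<xi> (2 * pi / c)) (deriv \<eta> (2 * pi / c)) = Complex (deriv \<xi> 0) (deriv \<eta> 0)"
    using constant_curvature_tangent[OF c, of "2 * pi / c"] c0 by simp
  then have "(\<xi> (2 * pi / c), \<eta> (2 * pi / c)) = (\<xi> 0, \<eta> 0)"
    using constant_curvature_centre[OF c, of "2 * pi / c"] by simp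
  then have "\<not> 2 * pi / c < L" using inj_onD[OF inj, of "2 * pi / c" 0] c0 L_pos by auto
  then show ?thesis using le by simp
qed

text \<open>Differentiate the equation of the circle twice. The first derivative shows that the radius vector is
  normal, so \<open>D\<close> is its signed length \<open>\<plusminus> r\<close>; the second gives \<open>\<kappa> D = - 1\<close>, and positivity of \<open>\<kappa>\<close> selects the sign.\<close>

lemma circle_imp_constant_curvature:
  assumes S: "(\<lambda>s. (\<xi> s, \<eta> s)) ` {0..<L} = sphere (X, Y) r" and r: "r > 0"
  shows "\<kappa> s = 1 / r"
proof -
  have on: "(\<xi> s - X)\<^sup>2 + (\<eta> s - Y)\<^sup>2 = r\<^sup>2" for s
  proof -
    have "(\<xi> s, \<eta> s) \<in> sphere (X, Y) r"
      unfolding S[symmetric] periodic_curve_image[symmetric] by (rule imageI) simp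
    then show ?thesis unfolding mem_sphere_prod by blast
  qed
  have 1: "deriv \<xi> s * (\<xi> s - X) + deriv \<eta> s * (\<eta> s - Y) = 0" for s
  proof -
    have "((\<lambda>s. (\<xi> s - X)\<^sup>2 + (\<eta> s - Y)\<^sup>2) has_real_derivative 2 * (deriv \<xi> s * (\<xi> s - X) + deriv \<eta> s * (\<eta> s - Y))) (at s)"
      by (auto intro!: derivative_eq_intros DERIV_xi DERIV_eta simp: algebra_simps)
    moreover have "((\<lambda>s. (\<xi> s - X)\<^sup>2 + (\<eta> s - Y)\<^sup>2) has_real_derivative 0) (at s)" unfolding on by simp
    ultimately have "2 * (deriv \<xi> s * (\<xi> s - X) + deriv \<eta> s * (\<eta> s - Y)) = 0" by (rule DERIV_unique)
    then show ?thesis by simp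
  qed
  define D where "D = deriv \<xi> s * (\<eta> s - Y) - deriv \<eta> s * (\<xi> s - X)"
  have 2: "1 + \<kappa> s * D = 0"
  proof -
    have "((\<lambda>s. deriv \<xi> s * (\<xi> s - X) + deriv \<eta> s * (\<eta> s - Y)) has_real_derivative
       ((deriv \<xi> s)\<^sup>2 + (deriv \<eta> s)\<^sup>2) + \<kappa> s * D) (at s)"
      unfolding D_def
      by (auto intro!: derivative_eq_intros DERIV_xi DERIV_eta DERIV_xi' DERIV_eta' simp: power2_eq_square algebra_simps)
    moreover have "((\<lambda>s. deriv \<xi> s * (\<xi> s - X) + deriv \<eta> s * (\<eta> s - Y)) has_real_derivative 0) (at s)"
      unfolding 1 by simp
    ultimately have "((deriv \<xi> s)\<^sup>2 + (deriv \<eta> s)\<^sup>2) + \<kappa> s * D = 0" by (rule DERIV_unique)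
    then show ?thesis by (simp add: unit_speed)
  qed
  have "D\<^sup>2 = ((deriv \<xi> s)\<^sup>2 + (deriv \<eta> s)\<^sup>2) * ((\<xi> s - X)\<^sup>2 + (\<eta> s - Y)\<^sup>2)
      - (deriv \<xi> s * (\<xi> s - X) + deriv \<eta> s * (\<eta> s - Y))\<^sup>2"
    unfolding D_def by (simp add: power2_eq_square algebra_simps)
  then have "D\<^sup>2 = r\<^sup>2" by (simp add: on 1 unit_speed)
  then have "D = r \<or> D = - r" by (simp add: power2_eq_iff)
  moreover have "D \<noteq> r" using 2 mult_pos_pos[OF curvature_pos[of s] r] by auto
  ultimately have "D = - r" by blast
  then show ?thesis using 2 r by (simp add: field_simps)
qed

end


section \<open>The first positive eigenvalue\<close>

context reinhardt_curve
begin

text \<open>\<open>\<Lambda>\<close> is the minimum of the Rayleigh quotient in the mode \<open>(0, 0)\<close>. In the case of equality both tangent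
  components satisfy \<open>f'' = - \<Lambda> \<kappa> f\<close>; substituting \<open>\<xi>'' = - \<kappa> \<eta>'\<close> and \<open>\<eta>'' = \<kappa> \<xi>'\<close> and eliminating \<open>\<Lambda>\<close>
  leaves \<open>\<kappa>' (\<xi>'\<^sup>2 + \<eta>'\<^sup>2) = 0\<close>.\<close>

lemma positive_eigenvalue_from_minimum:
  assumes Z: "normalized_frame \<xi> \<eta> L Z"
  obtains \<Lambda> where "\<Lambda> > 0" "kohn_eigenvalue L \<kappa> Z (\<Lambda> / 2)"
    "\<Lambda> * integral {0..L} (\<lambda>s. \<kappa> s * (deriv \<xi> s)\<^sup>2) \<le> integral {0..L} (\<lambda>s. (- \<kappa> s * deriv \<eta> s)\<^sup>2)"
    "\<Lambda> * integral {0..L} (\<lambda>s. \<kappa> s * (deriv \<eta> s)\<^sup>2) \<le> integral {0..L} (\<lambda>s. (\<kappa> s * deriv \<xi> s)\<^sup>2)"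
    "\<Lambda> * integral {0..L} (\<lambda>s. \<kappa> s * (deriv \<xi> s)\<^sup>2) = integral {0..L} (\<lambda>s. (- \<kappa> s * deriv \<eta> s)\<^sup>2) \<and>
      \<Lambda> * integral {0..L} (\<lambda>s. \<kappa> s * (deriv \<eta> s)\<^sup>2) = integral {0..L} (\<lambda>s. (\<kappa> s * deriv \<xi> s)\<^sup>2)
      \<longrightarrow> (\<exists>c. \<forall>s. \<kappa> s = c)"
proof (rule periodic_sturm_liouville_minimiser[OF L_pos continuous_curvature periodic_curvature curvature_pos])
  fix \<Lambda> g g1
  assume pos: "\<Lambda> > 0" and g: "c2_periodic L g g1 (\<lambda>s. - \<Lambda> * (\<kappa> s * g s))"
    and n: "integral {0..L} (\<lambda>s. \<kappa> s * (g s)\<^sup>2) = 1"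
    and min: "weighted_poincare L \<kappa> \<Lambda>"
  have ev: "kohn_eigenvalue L \<kappa> Z (\<Lambda> / 2)" by (rule kohn_eigenvalue_of_ode[OF Z g]) (simp add: n)
  have const: "\<exists>c. \<forall>s. \<kappa> s = c"
    if e1: "\<Lambda> * integral {0..L} (\<lambda>s. \<kappa> s * (deriv \<xi> s)\<^sup>2) = integral {0..L} (\<lambda>s. (- \<kappa> s * deriv \<eta> s)\<^sup>2)"
      and e2: "\<Lambda> * integral {0..L} (\<lambda>s. \<kappa> s * (deriv \<eta> s)\<^sup>2) = integral {0..L} (\<lambda>s. (\<kappa> s * deriv \<xi> s)\<^sup>2)"
  proof -
    have "deriv \<kappa> s = 0" for s
    proof -
      have 1: "- deriv \<kappa> s * deriv \<eta> s - (\<kappa> s)\<^sup>2 * deriv \<xi> s = - \<Lambda> * (\<kappa> s * deriv \<xi> s)"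
        by (rule minimiser_satisfies_ode[OF L_pos continuous_curvature periodic_curvature curvature_pos min c2_periodic_tangent(1) tangent_mean_zero(1) e1])
      have 2: "deriv \<kappa> s * deriv \<xi> s - (\<kappa> s)\<^sup>2 * deriv \<eta> s = - \<Lambda> * (\<kappa> s * deriv \<eta> s)"
        by (rule minimiser_satisfies_ode[OF L_pos continuous_curvature periodic_curvature curvature_pos min c2_periodic_tangent(2) tangent_mean_zero(2) e2])
      have "deriv \<kappa> s * ((deriv \<xi> s)\<^sup>2 + (deriv \<eta> s)\<^sup>2)
         = deriv \<xi> s * (deriv \<kappa> s * deriv \<xi> s - (\<kappa> s)\<^sup>2 * deriv \<eta> s)
           - deriv \<eta> s * (- deriv \<kappa> s * deriv \<eta> s - (\<kappa> s)\<^sup>2 * deriv \<xi> s)"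
        by (simp add: power2_eq_square algebra_simps)
      also have "\<dots> = 0" unfolding 1 2 by simp
      finally show ?thesis by (simp add: unit_speed)
    qed
    then have "(\<kappa> has_real_derivative 0) (at s)" for s
      using smooth_on_deriv(2)[OF smooth_curvature, of s] by simp
    then have "\<kappa> s = \<kappa> 0" for s using DERIV_isconst_all[of \<kappa>] by blast
    then show ?thesis by blast
  qed
  show thesis
    by (rule that[OF pos ev weighted_poincareD[OF min c2_periodic_tangent(1) tangent_mean_zero(1)]
          weighted_poincareD[OF min c2_periodic_tangent(2) tangent_mean_zero(2)]]) (use const in blast)
qed

lemma lambda1_le_eigenvalue:
  "\<mu> > 0 \<Longrightarrow> kohn_eigenvalue L \<kappa> Z \<mu> \<Longrightarrow> lambda1 L \<kappa> Z \<le> \<mu>"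
  unfolding lambda1_def by (rule cInf_lower) (auto intro!: bdd_belowI[of _ 0])

text \<open>The chain \<open>2\<pi> \<Lambda> \<le> \<Lambda> \<integral> \<kappa> \<le> \<integral> \<kappa>\<^sup>2\<close> gives the bound. If it is attained, the second inequality is an
  equality, and so are both Rayleigh inequalities of which it is the sum.\<close>

lemma lambda1_upper_bound:
  assumes Z: "normalized_frame \<xi> \<eta> L Z"
  shows "lambda1 L \<kappa> Z \<le> 1 / (4 * pi) * integral {0..L} (\<lambda>s. (\<kappa> s)\<^sup>2)"
    and "lambda1 L \<kappa> Z = 1 / (4 * pi) * integral {0..L} (\<lambda>s. (\<kappa> s)\<^sup>2) \<Longrightarrow> \<exists>c. \<forall>s. \<kappa> s = c"
proof -
  define X where "X = integral {0..L} (\<lambda>s. \<kappa> s * (deriv \<xi> s)\<^sup>2)"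
  define Y where "Y = integral {0..L} (\<lambda>s. \<kappa> s * (deriv \<eta> s)\<^sup>2)"
  define X1 where "X1 = integral {0..L} (\<lambda>s. (- \<kappa> s * deriv \<eta> s)\<^sup>2)"
  define Y1 where "Y1 = integral {0..L} (\<lambda>s. (\<kappa> s * deriv \<xi> s)\<^sup>2)"
  define E where "E = integral {0..L} (\<lambda>s. (\<kappa> s)\<^sup>2)"
  obtain \<Lambda> where \<Lambda>: "\<Lambda> > 0" "kohn_eigenvalue L \<kappa> Z (\<Lambda> / 2)" "\<Lambda> * X \<le> X1" "\<Lambda> * Y \<le> Y1"
    "\<Lambda> * X = X1 \<and> \<Lambda> * Y = Y1 \<longrightarrow> (\<exists>c. \<forall>s. \<kappa> s = c)"
    unfolding X_def Y_def X1_def Y1_def by (rule positive_eigenvalue_from_minimum[OF Z])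
  have "X + Y \<ge> 2 * pi" "X1 + Y1 = E"
    using tangent_energy_sum total_curvature_ge by (simp_all add: X_def Y_def X1_def Y1_def E_def)
  then have a: "\<Lambda> * (2 * pi) \<le> \<Lambda> * (X + Y)" using \<Lambda>(1) by simp
  have b: "\<Lambda> * (X + Y) \<le> E" using \<Lambda>(3,4) \<open>X1 + Y1 = E\<close> by (simp add: distrib_left)
  have l: "lambda1 L \<kappa> Z \<le> \<Lambda> / 2" using lambda1_le_eigenvalue[OF _ \<Lambda>(2)] \<Lambda>(1) by simp
  also have "\<Lambda> / 2 \<le> 1 / (4 * pi) * E" using a b by (simp add: field_simps)
  finally show "lambda1 L \<kappa> Z \<le> 1 / (4 * pi) * integral {0..L} (\<lambda>s. (\<kappa> s)\<^sup>2)" by (simp add: E_def)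
  assume "lambda1 L \<kappa> Z = 1 / (4 * pi) * integral {0..L} (\<lambda>s. (\<kappa> s)\<^sup>2)"
  then have "1 / (4 * pi) * E \<le> \<Lambda> / 2" using l by (simp add: E_def)
  then have "E \<le> \<Lambda> * (2 * pi)" by (simp add: field_simps)
  then have "\<Lambda> * X + \<Lambda> * Y = X1 + Y1" using a b \<open>X1 + Y1 = E\<close> by (simp add: distrib_left)
  then have "\<Lambda> * X = X1" "\<Lambda> * Y = Y1" using \<Lambda>(3,4) by linarith+
  then show "\<exists>c. \<forall>s. \<kappa> s = c" using \<Lambda>(5) by blast
qed

lemma lambda1_circle:
  assumes Z: "normalized_frame \<xi> \<eta> L Z" and c: "\<And>s. \<kappa> s = c" "L = 2 * pi / c"
  shows "lambda1 L \<kappa> Z = 1 / (4 * pi) * integral {0..L} (\<lambda>s. (\<kappa> s)\<^sup>2)"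
proof (rule antisym)
  show "lambda1 L \<kappa> Z \<le> 1 / (4 * pi) * integral {0..L} (\<lambda>s. (\<kappa> s)\<^sup>2)" by (rule lambda1_upper_bound(1)[OF Z])
  have c0: "c > 0" using curvature_pos[of 0] c by simp
  obtain \<Lambda> where \<Lambda>: "\<Lambda> > 0" "kohn_eigenvalue L \<kappa> Z (\<Lambda> / 2)"
    by (rule positive_eigenvalue_from_minimum[OF Z])
  have "1 / (4 * pi) * integral {0..L} (\<lambda>s. (\<kappa> s)\<^sup>2) = c / 2"
    using c0 L_pos by (simp add: c power2_eq_square)
  also have "\<dots> \<le> lambda1 L \<kappa> Z" unfolding lambda1_def
  proof (rule cInf_greatest)
    have "\<Lambda> / 2 \<in> {\<mu>. \<mu> > 0 \<and> kohn_eigenvalue L \<kappa> Z \<mu>}" using \<Lambda> by simp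
    then show "{\<mu>. \<mu> > 0 \<and> kohn_eigenvalue L \<kappa> Z \<mu>} \<noteq> {}" by blast
  qed (use circle_eigenvalue_lower_bound[OF Z c] in blast)
  finally show "1 / (4 * pi) * integral {0..L} (\<lambda>s. (\<kappa> s)\<^sup>2) \<le> lambda1 L \<kappa> Z" .
qed

end

section \<open>Reinhardt hypersurfaces over circles\<close>

text \<open>The torus action reaches every point with the same moduli.\<close>

lemma reinhardt_mem_iff:
  assumes "reinhardt M" "M = star_part M"
  shows "(z, w) \<in> M \<longleftrightarrow> z * w \<noteq> 0 \<and> (ln (cmod z), ln (cmod w)) \<in> generating_curve M"
proof
  assume zw: "(z, w) \<in> M"
  then have s: "(z, w) \<in> star_part M" using assms(2) by simp
  then have "z * w \<noteq> 0" by (simp add: star_part_def)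
  moreover have "(ln (cmod z), ln (cmod w)) \<in> generating_curve M"
    unfolding generating_curve_def using s by (rule rev_image_eqI) simp
  ultimately show "z * w \<noteq> 0 \<and> (ln (cmod z), ln (cmod w)) \<in> generating_curve M" by blast
next
  assume a: "z * w \<noteq> 0 \<and> (ln (cmod z), ln (cmod w)) \<in> generating_curve M"
  then obtain z' w' where m: "(z', w') \<in> star_part M" and l: "ln (cmod z) = ln (cmod z')" "ln (cmod w) = ln (cmod w')"
    unfolding generating_curve_def by auto
  have nz: "z' \<noteq> 0" "w' \<noteq> 0" and M: "(z', w') \<in> M" using m by (auto simp: star_part_def)
  have eq: "cmod z = cmod z'" "cmod w = cmod w'" using l nz a by auto
  have "z = cis (Arg (z / z')) * z'" if "cmod z = cmod z'" "z' \<noteq> 0" for z z' :: complex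
  proof -
    have "cmod (z / z') = 1" using that by (simp add: norm_divide)
    then have "cis (Arg (z / z')) = z / z'" using rcis_cmod_Arg[of "z / z'"] by (simp add: rcis_def)
    then show ?thesis using that by simp
  qed
  note rot = this
  have "(cis (Arg (z / z')) * z', cis (Arg (w / w')) * w') \<in> M"
    using assms(1) M unfolding reinhardt_def by blast
  then show "(z, w) \<in> M" using rot[OF eq(1) nz(1)] rot[OF eq(2) nz(2)] by simp
qed

lemma circle_iff_normal_form:
  assumes M: "reinhardt M" "M = star_part M"
  shows "generating_curve M = sphere (X, Y) R \<longleftrightarrow>
    M = {(z, w). z * w \<noteq> 0 \<and> (ln (cmod z), ln (cmod w)) \<in> sphere (X, Y) R}"
proof
  assume g: "generating_curve M = sphere (X, Y) R"
  show "M = {(z, w). z * w \<noteq> 0 \<and> (ln (cmod z), ln (cmod w)) \<in> sphere (X, Y) R}"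
    using reinhardt_mem_iff[OF M] unfolding g by auto
next
  assume g: "M = {(z, w). z * w \<noteq> 0 \<and> (ln (cmod z), ln (cmod w)) \<in> sphere (X, Y) R}"
  show "generating_curve M = sphere (X, Y) R"
  proof (intro equalityI subsetI)
    fix q assume "q \<in> generating_curve M"
    then obtain z w where "(z, w) \<in> star_part M" and q: "q = (ln (cmod z), ln (cmod w))"
      unfolding generating_curve_def by auto
    then have "(z, w) \<in> M" by (simp add: star_part_def)
    then show "q \<in> sphere (X, Y) R" unfolding q using g by blast
  next
    fix q assume q: "q \<in> sphere (X, Y) R"
    obtain x y where xy: "q = (x, y)" by (cases q)
    let ?p = "(complex_of_real (exp x), complex_of_real (exp y))"
    have "?p \<in> {(z, w). z * w \<noteq> 0 \<and> (ln (cmod z), ln (cmod w)) \<in> sphere (X, Y) R}"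
      using q unfolding xy by simp
    then have "?p \<in> star_part M" using g M(2) by metis
    then have "(\<lambda>(z, w). (ln (cmod z), ln (cmod w))) ?p \<in> generating_curve M"
      unfolding generating_curve_def by (rule imageI)
    then show "q \<in> generating_curve M" by (simp add: xy)
  qed
qed

theorem theorem1p2:
  fixes M :: "(complex \<times> complex) set"
    and L :: real
    and \<xi> \<eta> \<kappa> :: "real \<Rightarrow> real"
    and Z :: "coords \<Rightarrow> cvec"
  assumes "real_hypersurface M"
    and "strictly_pseudoconvex M"
    and "reinhardt M"
    and "has_closed_generating_curve M"
    and "arc_length_parametrization (generating_curve M) L \<xi> \<eta>"
    and "is_curvature \<xi> \<eta> \<kappa>"
    and "\<forall>s. \<kappa> s > 0"
    and "normalized_frame \<xi> \<eta> L Z"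
  shows "lambda1 L \<kappa> Z \<le> 1 / (4 * pi) * integral {0..L} (\<lambda>s. (\<kappa> s)\<^sup>2)
    \<and> (lambda1 L \<kappa> Z = 1 / (4 * pi) * integral {0..L} (\<lambda>s. (\<kappa> s)\<^sup>2)
         \<longleftrightarrow> (\<exists>c r. r > 0 \<and> generating_curve M = sphere c r))
    \<and> ((\<exists>c r. r > 0 \<and> generating_curve M = sphere c r)
         \<longleftrightarrow> (\<exists>a b. a > 0 \<and> b > 0 \<and>
               M = {(z, w). z * w \<noteq> 0 \<and>
                     (ln (a * cmod z))\<^sup>2 + (ln (b * cmod w))\<^sup>2 = L\<^sup>2 / (4 * pi\<^sup>2)}))"
proof -
  have arc: "L > 0" "smooth_on UNIV \<xi>" "smooth_on UNIV \<eta>" "\<And>s. \<xi> (s + L) = \<xi> s" "\<And>s. \<eta> (s + L) = \<eta> s"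
    "\<And>s. (deriv \<xi> s)\<^sup>2 + (deriv \<eta> s)\<^sup>2 = 1" "inj_on (\<lambda>s. (\<xi> s, \<eta> s)) {0..<L}"
    and image: "(\<lambda>s. (\<xi> s, \<eta> s)) ` {0..<L} = generating_curve M"
    using assms(5) unfolding arc_length_parametrization_def by blast+
  interpret reinhardt_curve L \<xi> \<eta> \<kappa>
    using arc assms(6,7) by unfold_locales (auto simp: is_curvature_def)
  note Z = assms(8)
  have star: "M = star_part M" using assms(4) by (simp add: has_closed_generating_curve_def)
  have circle: "\<kappa> s = 1 / r \<and> L = 2 * pi * r" if "r > 0" "generating_curve M = sphere c r" for c r s
  proof -
    obtain X Y where "c = (X, Y)" by (cases c)
    then have k: "\<kappa> s = 1 / r" for s using circle_imp_constant_curvature[of X Y r s] image that by simp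
    then show ?thesis using constant_curvature_length[of "1 / r", OF k arc(7)] by simp
  qed
  have eq: "lambda1 L \<kappa> Z = 1 / (4 * pi) * integral {0..L} (\<lambda>s. (\<kappa> s)\<^sup>2)
         \<longleftrightarrow> (\<exists>c r. r > 0 \<and> generating_curve M = sphere c r)"
  proof
    assume "lambda1 L \<kappa> Z = 1 / (4 * pi) * integral {0..L} (\<lambda>s. (\<kappa> s)\<^sup>2)"
    then obtain c where c: "\<And>s. \<kappa> s = c" using lambda1_upper_bound(2)[OF Z] by blast
    then have "1 / c > 0" using curvature_pos[of 0] by simp
    then show "\<exists>c r. r > 0 \<and> generating_curve M = sphere c r"
      using constant_curvature_imp_circle[OF c] image by metis
  next
    assume "\<exists>c r. r > 0 \<and> generating_curve M = sphere c r"
    then obtain c r where r: "r > 0" "generating_curve M = sphere c r" by blast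
    have k: "\<kappa> s = 1 / r" for s using circle[OF r] by blast
    have "L = 2 * pi / (1 / r)" using circle[OF r] by simp
    then show "lambda1 L \<kappa> Z = 1 / (4 * pi) * integral {0..L} (\<lambda>s. (\<kappa> s)\<^sup>2)"
      using lambda1_circle[OF Z k] by blast
  qed
  have sphere_form: "generating_curve M = sphere (- ln a, - ln b) (L / (2 * pi)) \<longleftrightarrow>
      M = {(z, w). z * w \<noteq> 0 \<and> (ln (a * cmod z))\<^sup>2 + (ln (b * cmod w))\<^sup>2 = L\<^sup>2 / (4 * pi\<^sup>2)}"
    if "a > 0" "b > 0" for a b
  proof -
    have "{(z, w). z * w \<noteq> 0 \<and> (ln (cmod z), ln (cmod w)) \<in> sphere (- ln a, - ln b) (L / (2 * pi))}
      = {(z, w). z * w \<noteq> 0 \<and> (ln (a * cmod z))\<^sup>2 + (ln (b * cmod w))\<^sup>2 = L\<^sup>2 / (4 * pi\<^sup>2)}"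
      unfolding mem_sphere_prod using that L_pos
      by (auto simp: ln_mult power_divide power_mult_distrib add.commute)
    then show ?thesis using circle_iff_normal_form[OF assms(3) star, of "- ln a" "- ln b" "L / (2 * pi)"] by simp
  qed
  have form: "(\<exists>c r. r > 0 \<and> generating_curve M = sphere c r)
         \<longleftrightarrow> (\<exists>a b. a > 0 \<and> b > 0 \<and>
               M = {(z, w). z * w \<noteq> 0 \<and> (ln (a * cmod z))\<^sup>2 + (ln (b * cmod w))\<^sup>2 = L\<^sup>2 / (4 * pi\<^sup>2)})"
  proof
    assume "\<exists>c r. r > 0 \<and> generating_curve M = sphere c r"
    then obtain X Y r where r: "r > 0" "generating_curve M = sphere (X, Y) r" by auto
    have "r = L / (2 * pi)" using circle[OF r] by simp
    then have "generating_curve M = sphere (- ln (exp (- X)), - ln (exp (- Y))) (L / (2 * pi))" using r by simp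
    then show "\<exists>a b. a > 0 \<and> b > 0 \<and>
               M = {(z, w). z * w \<noteq> 0 \<and> (ln (a * cmod z))\<^sup>2 + (ln (b * cmod w))\<^sup>2 = L\<^sup>2 / (4 * pi\<^sup>2)}"
      using sphere_form[of "exp (- X)" "exp (- Y)"] exp_gt_zero by blast
  next
    assume "\<exists>a b. a > 0 \<and> b > 0 \<and>
               M = {(z, w). z * w \<noteq> 0 \<and> (ln (a * cmod z))\<^sup>2 + (ln (b * cmod w))\<^sup>2 = L\<^sup>2 / (4 * pi\<^sup>2)}"
    then obtain a b where ab: "a > 0" "b > 0"
      "M = {(z, w). z * w \<noteq> 0 \<and> (ln (a * cmod z))\<^sup>2 + (ln (b * cmod w))\<^sup>2 = L\<^sup>2 / (4 * pi\<^sup>2)}" by blast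
    have "L / (2 * pi) > 0" using L_pos by simp
    then show "\<exists>c r. r > 0 \<and> generating_curve M = sphere c r"
      using iffD2[OF sphere_form[OF ab(1,2)] ab(3)] by blast
  qed
  show ?thesis using lambda1_upper_bound(1)[OF Z] eq form by blast
qed

end
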